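(* (1) For all $k,l\in\mathbb Z$ the function $\mathscr Fg_{k,l}$ belongs to $C^\infty_q(\overline\Gamma)$ and is integrable with respect to $\mu$. (2) For all $k,l\in\mathbb Z$, $\mathscr F^*\mathscr Fg_{k,l}=(q\sigma_{-i})^2g_{k,l}$. (3) The operator $q^{-1}\mathscr F\circ\sigma_{i}$ (defined on the linear span of the functions $g_{k,l}$) extends to a unitary operator on $L^2(\overline\Gamma)$.
   Context: Fix $0<q<1$; $\Gamma=\{z\in\mathbb C:|z|\in q^{\mathbb Z}\}$, $\overline\Gamma=\Gamma\cup\{0\}$. For a function $f$ on $\Gamma$ (or $\overline\Gamma$) whose restriction to each circle $\{|z|=q^n\}$, $n\in\mathbb Z$, extends to a holomorphic function $f_n$ on $\mathbb C\setminus\{0\}$, write $f(q^{\pm1}\cdot z)=f_n(q^{\pm1}z)$ for $|z|=q^n$ (the value at $t=\mp i$ of the entire continuation of $t\mapsto f(q^{it}z)$). Expressions such as $f(q\cdot q^{-1}z)$ denote the value of $w\mapsto f(q\cdot w)$ at $w=q^{-1}z$, etc. For $z\in\Gamma$ put $$\frac{\partial_R f}{\partial\boldsymbol z}=\frac{f(q^{-1}\cdot q^{-1}z)-f(z)}{(q^{-2}-1)z},\quad \frac{\partial_L f}{\partial\boldsymbol z}=\frac{f(z)-f(q\cdot qz)}{(1-q^2)z},$$ $$\frac{\partial_L f}{\partial\overline{\boldsymbol z}}=\frac{f(q\cdot q^{-1}z)-f(z)}{(q^{-2}-1)\overline z},\quad \frac{\partial_R f}{\partial\overline{\boldsymbol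 z}}=\frac{f(z)-f(q^{-1}\cdot qz)}{(1-q^2)\overline z}.$$ $\mathscr B$ is the algebra of continuous functions on $\overline\Gamma$ whose restriction to each circle $\{|z|=q^n\}$ extends holomorphically to $\mathbb C\setminus\{0\}$. $C^\infty_q(\overline\Gamma)$ is the set of $f\in\mathscr B$ such that for every (finite) product $D$ of the four operators above, $\lim_{\Gamma\ni z\to0}Df(z)$ exists. The measure $\mu$ on $\overline\Gamma$ is $\int_{\overline\Gamma}f\,d\mu=\sum_{k\in\mathbb Z}\frac{q^{2k}}{2\pi}\int_0^{2\pi}f(q^ke^{i\varphi})\,d\varphi$, and $L^2(\overline\Gamma)=L^2(\overline\Gamma,\mu)$. The quantum exponential function is the continuous function $F_q$ on $\overline\Gamma$ with $F_q(z)=\prod_{k=0}^\infty\frac{1+q^{2k}\overline z}{1+q^{2k}z}$ for $z\notin\{-q^{-2k}:k=0,1,2,\dots\}$ (extended by continuity). For $\mu$-integrable $f$, $(\mathscr Ff)(\zeta)=\int_{\overline\Gamma}F_q(\zeta z)f(z)\,d\mu(z)$; $\mathscr F$ extends to a closed operator on $L^2(\overline\Gamma)$, and its adjoint $\mathscr F^*$ is the integral operator $(\mathscr F^*h)(z)=\int_{\overline\Gamma}\overline{F_q(\zeta z)}\,h(\zeta)\,d\mu(\zeta)$. For $k,l\in\mathbb Z$, $g_{k,l}$ is the function on $\overline\Gamma$ with $g_{k,l}(q^ke^{i\vartheta})=e^{il\vartheta}$ and $g_{k,l}(z)=0$ for $|z|\ne q^k$ (i.e. $g_{k,l}(z)=\chi(z,q^l)$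 on $|z|=q^k$, where $\chi(q^{i\varphi+m},q^{i\varphi'+m'})=q^{i(\varphi m'+\varphi'm)}$). The functions $g_{k,l}$ form a maximal orthogonal system in $L^2(\overline\Gamma)$. With $(\sigma_tg)(z)=g(q^{-it}z)$ for $t\in\mathbb R$, $\sigma_{\pm i}$ denotes analytic continuation to $t=\pm i$: $(\sigma_{\pm i}g)(z)=g(q^{\pm1}\cdot z)$. *)

theory Defs
  imports "HOL-Analysis.Analysis"
begin

text \<open>Functions on \<open>\<Gamma>\<close> or its closure are represented by functions on all of \<open>\<complex>\<close>;
  their values outside the closure of \<open>\<Gamma>\<close> play no role in any of the notions below.\<close>

definition Gam :: "real \<Rightarrow> complex set" where
  "Gam q = {z. \<exists>n::int. cmod z = q powi n}"

definition Gam_bar :: "real \<Rightarrow> complex set" where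
  "Gam_bar q = insert 0 (Gam q)"

definition is_circle_extension ::
    "real \<Rightarrow> (complex \<Rightarrow> complex) \<Rightarrow> int \<Rightarrow> (complex \<Rightarrow> complex) \<Rightarrow> bool" where
  "is_circle_extension q f n F \<longleftrightarrow>
     F holomorphic_on (UNIV - {0}) \<and> (\<forall>z. cmod z = q powi n \<longrightarrow> F z = f z)"

text \<open>By the identity theorem, the extension \<open>f\<^sub>n\<close> is unique on \<open>\<complex> - {0}\<close> if it exists.\<close>

definition circle_extension ::
    "real \<Rightarrow> (complex \<Rightarrow> complex) \<Rightarrow> int \<Rightarrow> complex \<Rightarrow> complex" where
  "circle_extension q f n = (SOME F. is_circle_extension q f n F)"

text \<open>\<open>shift q f c z\<close> is \<open>f(c \<cdot> z)\<close>, i.e. \<open>f\<^sub>n (c z)\<close> for \<open>\<bar>z\<bar> = q\<^sup>n\<close>, used for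
  \<open>c = q\<close> and \<open>c = 1/q\<close>. At \<open>z = 0\<close> the function \<open>t \<mapsto> f(q\<^sup>i\<^sup>t z)\<close> is constant,
  whence the value \<open>f 0\<close>.\<close>

definition shift :: "real \<Rightarrow> (complex \<Rightarrow> complex) \<Rightarrow> real \<Rightarrow> complex \<Rightarrow> complex" where
  "shift q f c z =
     (if z = 0 then f 0
      else circle_extension q f (THE n::int. cmod z = q powi n) (of_real c * z))"

definition dR :: "real \<Rightarrow> (complex \<Rightarrow> complex) \<Rightarrow> complex \<Rightarrow> complex" where
  "dR q f z = (shift q f (1/q) (z / of_real q) - f z) / (of_real (q powi (-2) - 1) * z)"

definition dL :: "real \<Rightarrow> (complex \<Rightarrow> complex) \<Rightarrow> complex \<Rightarrow> complex" where
  "dL q f z = (f z - shift q f q (of_real q * z)) / (of_real (1 - q^2) * z)"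

definition dL_bar :: "real \<Rightarrow> (complex \<Rightarrow> complex) \<Rightarrow> complex \<Rightarrow> complex" where
  "dL_bar q f z = (shift q f q (z / of_real q) - f z) / (of_real (q powi (-2) - 1) * cnj z)"

definition dR_bar :: "real \<Rightarrow> (complex \<Rightarrow> complex) \<Rightarrow> complex \<Rightarrow> complex" where
  "dR_bar q f z = (f z - shift q f (1/q) (of_real q * z)) / (of_real (1 - q^2) * cnj z)"

definition alg_B :: "real \<Rightarrow> (complex \<Rightarrow> complex) set" where
  "alg_B q = {f. continuous_on (Gam_bar q) f \<and> (\<forall>n. \<exists>F. is_circle_extension q f n F)}"

definition Cq_inf :: "real \<Rightarrow> (complex \<Rightarrow> complex) set" where
  "Cq_inf q = {f \<in> alg_B q.
     \<forall>Ds \<in> lists {dR q, dL q, dR_bar q, dL_bar q}.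
       \<exists>L. (foldr (\<circ>) Ds id f \<longlongrightarrow> L) (at 0 within Gam q)}"

text \<open>The measure space is the closure of \<open>\<Gamma>\<close> with its Borel sets. Here \<open>\<mu>\<close> is the image, under
  \<open>(k, \<phi>) \<mapsto> q\<^sup>k e\<^sup>i\<^sup>\<phi>\<close>, of the product of the measure on \<open>\<int>\<close> with weights \<open>q\<^sup>2\<^sup>k\<close> and the normalised
  Lebesgue measure on \<open>[0, 2\<pi>]\<close>, so that integrals against \<open>\<mu>\<close> are
  \<open>\<Sum>k. q\<^sup>2\<^sup>k / (2\<pi>) \<integral> f (q\<^sup>k e\<^sup>i\<^sup>\<phi>) d\<phi>\<close>.\<close>

definition mu :: "real \<Rightarrow> complex measure" where
  "mu q = distr
     (density (count_space (UNIV :: int set)) (\<lambda>k. ennreal (q powi (2*k)))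
        \<Otimes>\<^sub>M uniform_measure lborel {0..2*pi})
     (restrict_space borel (Gam_bar q))
     (\<lambda>(k, \<phi>). of_real (q powi k) * cis \<phi>)"

definition Fq_prod :: "real \<Rightarrow> complex \<Rightarrow> complex" where
  "Fq_prod q z = prodinf (\<lambda>k. (1 + of_real (q^(2*k)) * cnj z) / (1 + of_real (q^(2*k)) * z))"

text \<open>At the zeros \<open>-q\<^sup>-\<^sup>2\<^sup>k\<close> of the denominators, \<open>F\<^sub>q\<close> is extended by continuity.\<close>

definition Fq :: "real \<Rightarrow> complex \<Rightarrow> complex" where
  "Fq q z = (if \<exists>k::nat. z = - of_real (1 / q^(2*k))
             then Lim (at z within Gam_bar q) (Fq_prod q) else Fq_prod q z)"

definition fourier :: "real \<Rightarrow> (complex \<Rightarrow> complex) \<Rightarrow> complex \<Rightarrow> complex" where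
  "fourier q f \<zeta> = (LINT z|mu q. Fq q (\<zeta> * z) * f z)"

definition fourier_adj :: "real \<Rightarrow> (complex \<Rightarrow> complex) \<Rightarrow> complex \<Rightarrow> complex" where
  "fourier_adj q h z = (LINT \<zeta>|mu q. cnj (Fq q (\<zeta> * z)) * h \<zeta>)"

definition gkl :: "real \<Rightarrow> int \<Rightarrow> int \<Rightarrow> complex \<Rightarrow> complex" where
  "gkl q k l z = (if cmod z = q powi k then cis (of_int l * Arg z) else 0)"

definition gkl_span :: "real \<Rightarrow> (complex \<Rightarrow> complex) set" where
  "gkl_span q = {f. \<exists>S c. finite S \<and> f = (\<lambda>z. \<Sum>(k, l)\<in>S. c k l * gkl q k l z)}"

definition sigma_i :: "real \<Rightarrow> (complex \<Rightarrow> complex) \<Rightarrow> complex \<Rightarrow> complex" where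
  "sigma_i q g z = shift q g q z"

definition sigma_minus_i :: "real \<Rightarrow> (complex \<Rightarrow> complex) \<Rightarrow> complex \<Rightarrow> complex" where
  "sigma_minus_i q g z = shift q g (1/q) z"

text \<open>Elements of \<open>L\<^sup>2(M)\<close> are handled through representatives, with equality almost everywhere.\<close>

definition L2 :: "'a measure \<Rightarrow> ('a \<Rightarrow> complex) set" where
  "L2 M = {f \<in> borel_measurable M. integrable M (\<lambda>x. (cmod (f x))^2)}"

definition L2_inner :: "'a measure \<Rightarrow> ('a \<Rightarrow> complex) \<Rightarrow> ('a \<Rightarrow> complex) \<Rightarrow> complex" where
  "L2_inner M f g = (LINT x|M. f x * cnj (g x))"

definition unitary_L2 :: "'a measure \<Rightarrow> (('a \<Rightarrow> complex) \<Rightarrow> 'a \<Rightarrow> complex) \<Rightarrow> bool" where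
  "unitary_L2 M U \<longleftrightarrow>
     (\<forall>f \<in> L2 M. U f \<in> L2 M) \<and>
     (\<forall>f \<in> L2 M. \<forall>g \<in> L2 M. (AE x in M. f x = g x) \<longrightarrow> (AE x in M. U f x = U g x)) \<and>
     (\<forall>f \<in> L2 M. \<forall>g \<in> L2 M. AE x in M. U (\<lambda>y. f y + g y) x = U f x + U g x) \<and>
     (\<forall>f \<in> L2 M. \<forall>c. AE x in M. U (\<lambda>y. c * f y) x = c * U f x) \<and>
     (\<forall>f \<in> L2 M. \<forall>g \<in> L2 M. L2_inner M (U f) (U g) = L2_inner M f g) \<and>
     (\<forall>h \<in> L2 M. \<exists>f \<in> L2 M. AE x in M. U f x = h x)"

end

theory Submission
  imports Defs "HOL-Complex_Analysis.Complex_Analysis"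
begin

text \<open>The Fourier coefficients \<open>J(l, m)\<close> of \<open>F\<^sub>q\<close> on the circle of radius \<open>q\<^sup>m\<close> are given by Euler's two product
  expansions as \<open>q\<close>-hypergeometric series, and \<open>\<F> g\<^sub>k\<^sub>l\<close> equals \<open>q\<^sup>2\<^sup>k J(-l, n + k) e\<^sup>-\<^sup>i\<^sup>l\<^sup>\<theta>\<close> on the circle of radius \<open>q\<^sup>n\<close>.
  Two contiguity relations of the series show that the four derivatives permute the functions \<open>\<F> g\<^sub>k\<^sub>l\<close> up to
  constants, which gives smoothness. Expanding one factor of the series once more turns it into a symmetric double
  series, whence \<open>J(l, m) = (-1)\<^sup>l\<^sup>+\<^sup>1\<^sup>+\<^sup>m q\<^sup>l\<^sup>+\<^sup>1\<^sup>-\<^sup>m J(m - 1, l + 1)\<close>. This symmetry converts the orthogonality relations in \<open>l\<close>,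
  which merely express \<open>\<bar>F\<^sub>q\<bar> = 1\<close>, into orthogonality relations in \<open>m\<close>, and these are equivalent to the formula for
  \<open>\<F>\<^sup>* \<F>\<close>. They also say that \<open>q\<^sup>-\<^sup>1 \<F> \<sigma>\<^sub>i\<close> acts on normalised functions by orthogonal Hankel matrices
  with summable rows, so that it maps one orthonormal basis of \<open>L\<^sup>2\<close> to another.\<close>

section \<open>Reciprocal \<open>q\<close>-factorials and Euler's series\<close>

text \<open>The product of the two Euler series represents F_q only inside the unit disc, that is on
  the circles of radius q^m with \<open>m >= 1\<close>. Therefore the coefficients
  \<open>qJ l m\<close> are defined by a series that converges for every \<open>m\<close>. For
  \<open>m <= 0\<close> they are tied to F_q by a recurrence from \<open>m + 2\<close> to
  \<open>m\<close>, and their absolute summability is inherited through a reflection of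
  \<open>m\<close> to \<open>2 - m\<close>. The zeros of the denominators lie on the negative axis,
  which meets each circle in one point, so integrals do not see them. Large radii are the other
  obstacle, since the weights of mu grow there: the symmetry gives summability against q^m, and a
  contiguity relation supplies the second power of q. With normalised functions the matrix of F has
  entries q^(n + k) qJ (-l) (n + k). Orthogonality misses by the factor q^(l - 1), and this is
  exactly the effect of q^-1 sigma_i on g_kl; the inverse square q^(2 - 2l) is that of (q
  sigma_-i)^2. Orthonormality of the image does not give its totality; that comes from the symmetry
  of the Hankel matrix, which makes it its own inverse.\<close>

locale q_parameter =
  fixes q :: real
  assumes q_pos: "0 < q" and q_less_1: "q < 1"
begin

lemma q_neq_0 [simp]: "q \<noteq> 0" "complex_of_real q \<noteq> 0"
  using q_pos by auto

lemma q_powi_pos [simp]: "0 < q powi n"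
  using q_pos by simp

lemma q_power_less_1: "0 < n \<Longrightarrow> q ^ n < 1"
  using q_pos q_less_1 by (simp add: power_less_one_iff)

lemma q_powi_add: "q powi (m + n) = q powi m * q powi n"
  by (simp add: power_int_add)

lemma q_powi_inject [simp]: "q powi m = q powi n \<longleftrightarrow> m = n"
  using power_int_strict_decreasing[of m n q] power_int_strict_decreasing[of n m q] q_pos q_less_1
  by (metis less_irrefl linorder_neqE)

text \<open>The value \<open>0\<close> at negative \<open>n\<close> lets all series below run over \<open>\<int>\<close>.\<close>

definition rpoch :: "int \<Rightarrow> real" where
  "rpoch n = (if n < 0 then 0 else 1 / (\<Prod>k=1..nat n. 1 - q ^ (2 * k)))"

lemma rpoch_0 [simp]: "rpoch 0 = 1"
  by (simp add: rpoch_def)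

lemma rpoch_neg [simp]: "n < 0 \<Longrightarrow> rpoch n = 0"
  by (simp add: rpoch_def)

text \<open>There is no exceptional index: at \<open>n = 0\<close> the vanishing factor
  \<open>1 - q^0\<close> meets \<open>rpoch (-1) = 0\<close>. This allows the contiguity relations
  to be proved term by term over all integers.\<close>

lemma rpoch_step: "(1 - q powi (2 * n)) * rpoch n = rpoch (n - 1)"
proof -
  consider "n < 0" | "n = 0" | m where "n = int (Suc m)"
    by (metis int_cases negative_zless not0_implies_Suc of_nat_0)
  then show ?thesis
  proof cases
    case 3
    have "q powi (2 * n) = q ^ (2 * Suc m)"
      using 3 by (metis mult.commute of_nat_mult of_nat_numeral power_int_of_nat)
    moreover have "1 - q ^ (2 * Suc m) \<noteq> 0"
      using q_power_less_1[of "2 * Suc m"] by simp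
    moreover have "(\<Prod>k=1..m. 1 - q ^ (2 * k)) > 0"
      using q_power_less_1 by (intro prod_pos) auto
    ultimately show ?thesis
      using 3 by (simp add: rpoch_def nat_add_distrib del: mult_Suc_right)
  qed (auto simp: rpoch_def)
qed

lemma rpoch_nonneg [simp]: "0 \<le> rpoch n"
  unfolding rpoch_def
  by (auto intro!: prod_nonneg simp: power_le_one q_pos q_less_1 less_imp_le)

lemma rpoch_Suc: "rpoch (int (Suc n)) = rpoch (int n) / (1 - q ^ (2 * Suc n))"
proof -
  have "q powi (2 * int (Suc n)) = q ^ (2 * Suc n)"
    by (metis of_nat_mult of_nat_numeral power_int_of_nat)
  moreover have "q ^ (2 * Suc n) \<noteq> 1"
    using q_power_less_1[of "2 * Suc n"] by simp
  ultimately show ?thesis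
    using rpoch_step[of "int (Suc n)"] by (simp add: field_simps)
qed

text \<open>Euler's series for 1 / (x; q^2)_inf, convergent for |x| < 1; the companion
  \<open>qExp\<close> is the entire series for (-x; q^2)_inf. The products themselves are not
  introduced: the functional equations and continuity at 0 stand in for them.\<close>

definition qexp :: "complex \<Rightarrow> complex" where
  "qexp x = (\<Sum>n. of_real (rpoch (int n)) * x ^ n)"

definition qExp :: "complex \<Rightarrow> complex" where
  "qExp x = (\<Sum>n. of_real (q ^ (n * (n - 1)) * rpoch (int n)) * x ^ n)"

section \<open>Convergence and functional equations of the two Euler series\<close>

lemma q_power_tendsto_0: "(\<lambda>n. q ^ n) \<longlonglongrightarrow> 0"
  using q_pos q_less_1 by (simp add: LIMSEQ_power_zero)

lemma q_power_double_tendsto_0: "(\<lambda>n. q ^ (2 * n)) \<longlonglongrightarrow> 0"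
  using q_pos q_less_1 by (simp add: power_mult LIMSEQ_power_zero power_less_one_iff abs_square_less_1)

lemma q_power_double_Suc_tendsto_0: "(\<lambda>n. q ^ (2 * Suc n)) \<longlonglongrightarrow> 0"
  using q_power_double_tendsto_0 by (rule LIMSEQ_Suc)

lemma norm_rpoch_term: "norm (complex_of_real (rpoch (int n)) * x ^ n) = rpoch (int n) * norm x ^ n"
  by (simp add: norm_mult norm_power)

lemma norm_qExp_term:
  "norm (complex_of_real (q ^ (n * (n - 1)) * rpoch (int n)) * x ^ n) = q ^ (n * (n - 1)) * rpoch (int n) * norm x ^ n"
  using q_pos by (simp only: norm_mult norm_power norm_of_real) simp

lemma summable_qexp:
  fixes x :: complex
  assumes "norm x < 1"
  shows "summable (\<lambda>n. norm (of_real (rpoch (int n)) * x ^ n))"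
proof -
  define c where "c = (1 + norm x) / 2"
  have c: "norm x < c" "c < 1"
    using assms by (auto simp: c_def)
  have "(\<lambda>n. norm x / (1 - q ^ (2 * Suc n))) \<longlonglongrightarrow> norm x / (1 - 0)"
    by (intro tendsto_intros q_power_double_Suc_tendsto_0) auto
  then have "eventually (\<lambda>n. norm x / (1 - q ^ (2 * Suc n)) < c) sequentially"
    using c by (auto dest: order_tendstoD(2))
  then obtain N where N: "\<And>n. n \<ge> N \<Longrightarrow> norm x / (1 - q ^ (2 * Suc n)) < c"
    unfolding eventually_sequentially by blast
  show ?thesis unfolding norm_rpoch_term
  proof (rule summable_ratio_test[OF c(2), of N])
    fix n assume "N \<le> n"
    have "rpoch (int (Suc n)) * norm x ^ Suc n
        = norm x / (1 - q ^ (2 * Suc n)) * (rpoch (int n) * norm x ^ n)"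
      unfolding rpoch_Suc by simp
    also have "\<dots> \<le> c * (rpoch (int n) * norm x ^ n)"
      using N[OF \<open>N \<le> n\<close>] by (intro mult_right_mono) auto
    finally show "norm (rpoch (int (Suc n)) * norm x ^ Suc n) \<le> c * norm (rpoch (int n) * norm x ^ n)"
      by (simp add: abs_mult)
  qed
qed

lemma summable_qExp:
  fixes x :: complex
  shows "summable (\<lambda>n. norm (of_real (q ^ (n * (n - 1)) * rpoch (int n)) * x ^ n))"
proof -
  have "(\<lambda>n. q ^ (2 * n) * norm x / (1 - q ^ (2 * Suc n))) \<longlonglongrightarrow> 0 * norm x / (1 - 0)"
    by (intro tendsto_intros q_power_double_Suc_tendsto_0 q_power_double_tendsto_0) auto
  then have "eventually (\<lambda>n. q ^ (2 * n) * norm x / (1 - q ^ (2 * Suc n)) < 1/2) sequentially"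
    by (intro order_tendstoD(2)) auto
  then obtain N where N: "\<And>n. n \<ge> N \<Longrightarrow> q ^ (2 * n) * norm x / (1 - q ^ (2 * Suc n)) < 1/2"
    unfolding eventually_sequentially by blast
  show ?thesis unfolding norm_qExp_term
  proof (rule summable_ratio_test[of "1/2" N])
    fix n assume "N \<le> n"
    have e: "Suc n * (Suc n - 1) = 2 * n + n * (n - 1)"
      by (cases n) (auto simp: algebra_simps)
    have "q ^ (Suc n * (Suc n - 1)) * rpoch (int (Suc n)) * norm x ^ Suc n
        = q ^ (2 * n) * norm x / (1 - q ^ (2 * Suc n)) * (q ^ (n * (n - 1)) * rpoch (int n) * norm x ^ n)"
      unfolding rpoch_Suc e power_add by simp
    also have "\<dots> \<le> 1/2 * (q ^ (n * (n - 1)) * rpoch (int n) * norm x ^ n)"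
      using N[OF \<open>N \<le> n\<close>] q_pos by (intro mult_right_mono) auto
    finally show "norm (q ^ (Suc n * (Suc n - 1)) * rpoch (int (Suc n)) * norm x ^ Suc n)
        \<le> 1/2 * norm (q ^ (n * (n - 1)) * rpoch (int n) * norm x ^ n)"
      using q_pos by (simp add: abs_mult del: power_Suc)
  qed simp
qed

lemma qExp_0 [simp]: "qExp 0 = 1"
  unfolding qExp_def by (subst powser_zero) simp

lemma qexp_0 [simp]: "qexp 0 = 1"
  unfolding qexp_def by (subst powser_zero) simp

lemma isCont_qExp_0: "isCont qExp 0"
  unfolding qExp_def
  by (rule isCont_powser[of _ 1]) (use summable_norm_cancel[OF summable_qExp[of 1]] in auto)

lemma isCont_qexp_0: "isCont qexp 0"
  unfolding qexp_def
  by (rule isCont_powser[of _ "1/2"]) (use summable_norm_cancel[OF summable_qexp[of "1/2"]] in auto)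

text \<open>In \<open>qExp x - qExp (q^2 x)\<close> the n-th coefficient gains the factor 1 -
  q^(2n), which cancels the last factor of the q-factorial. As n(n - 1) grows by 2n from n to n + 1,
  what remains is x times \<open>qExp (q^2 x)\<close>.\<close>

lemma qExp_functional: "qExp x = (1 + x) * qExp (of_real (q\<^sup>2) * x)"
proof -
  define c where "c n = complex_of_real (q ^ (n * (n - 1)) * rpoch (int n))" for n
  define Q where "Q = complex_of_real (q\<^sup>2)"
  have S: "summable (\<lambda>n. c n * y ^ n)" for y
    using summable_norm_cancel[OF summable_qExp] by (simp add: c_def)
  have c: "c (Suc n) * (1 - Q ^ Suc n) = c n * Q ^ n" for n
  proof -
    have e: "Suc n * (Suc n - 1) = 2 * n + n * (n - 1)"
      by (cases n) (auto simp: algebra_simps)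
    have "q ^ (Suc n * (Suc n - 1)) * rpoch (int (Suc n)) * (1 - q ^ (2 * Suc n)) =
        q ^ (n * (n - 1)) * rpoch (int n) * q ^ (2 * n)"
      unfolding rpoch_Suc e using q_power_less_1[of "2 * Suc n"] by (simp add: power_add)
    from arg_cong[OF this, of complex_of_real] show ?thesis
      unfolding c_def Q_def power_mult[of q 2]
      by (simp only: of_real_mult of_real_power of_real_diff of_real_1)
  qed
  have "qExp x - qExp (Q * x) = (\<Sum>n. c n * (1 - Q ^ n) * x ^ n)"
    unfolding qExp_def c_def[symmetric] using S[of x] S[of "Q * x"]
    by (simp add: suminf_diff[symmetric] algebra_simps)
  also have "\<dots> = (\<Sum>n. c (Suc n) * (1 - Q ^ Suc n) * x ^ Suc n)"
  proof -
    have "summable (\<lambda>n. c n * (1 - Q ^ n) * x ^ n)"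
      using summable_diff[OF S[of x] S[of "Q * x"]] by (simp add: algebra_simps)
    from suminf_split_head[OF this] show ?thesis by simp
  qed
  also have "\<dots> = (\<Sum>n. x * (c n * (Q * x) ^ n))"
    unfolding c by (simp add: algebra_simps)
  also have "\<dots> = x * qExp (Q * x)"
    unfolding qExp_def c_def[symmetric] by (rule suminf_mult[OF S])
  finally show ?thesis
    unfolding Q_def by (simp add: algebra_simps)
qed

lemma qexp_functional:
  assumes "norm x < 1"
  shows "qexp (of_real (q\<^sup>2) * x) = (1 - x) * qexp x"
proof -
  define c where "c n = complex_of_real (rpoch (int n))" for n
  define Q where "Q = complex_of_real (q\<^sup>2)"
  have Q: "norm (Q * x) < 1"
  proof -
    have "norm Q < 1"
      using q_power_less_1[of 2] by (simp add: Q_def norm_power)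
    then show ?thesis
      using assms mult_strict_mono'[of "norm Q" 1 "norm x" 1] by (simp add: norm_mult)
  qed
  have S: "summable (\<lambda>n. c n * y ^ n)" if "norm y < 1" for y
    using summable_norm_cancel[OF summable_qexp[OF that]] by (simp add: c_def)
  have c: "c (Suc n) * (1 - Q ^ Suc n) = c n" for n
  proof -
    have "rpoch (int (Suc n)) * (1 - q ^ (2 * Suc n)) = rpoch (int n)"
      unfolding rpoch_Suc using q_power_less_1[of "2 * Suc n"] by simp
    from arg_cong[OF this, of complex_of_real] show ?thesis
      unfolding c_def Q_def power_mult[of q 2]
      by (simp only: of_real_mult of_real_power of_real_diff of_real_1)
  qed
  have "qexp x - qexp (Q * x) = (\<Sum>n. c n * (1 - Q ^ n) * x ^ n)"
    unfolding qexp_def c_def[symmetric] using S[OF assms] S[OF Q]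
    by (simp add: suminf_diff[symmetric] algebra_simps)
  also have "\<dots> = (\<Sum>n. c (Suc n) * (1 - Q ^ Suc n) * x ^ Suc n)"
  proof -
    have "summable (\<lambda>n. c n * (1 - Q ^ n) * x ^ n)"
      using summable_diff[OF S[OF assms] S[OF Q]] by (simp add: algebra_simps)
    from suminf_split_head[OF this] show ?thesis by simp
  qed
  also have "\<dots> = (\<Sum>n. x * (c n * x ^ n))"
    unfolding c by (simp add: algebra_simps)
  also have "\<dots> = x * qexp x"
    unfolding qexp_def c_def[symmetric] by (rule suminf_mult[OF S[OF assms]])
  finally show ?thesis
    unfolding Q_def by (simp add: algebra_simps)
qed

text \<open>With unconditional sums over all integers, the index shifts used later are bijections of
  the index set.\<close>

lemma has_sum_int_of_suminf:
  fixes f :: "int \<Rightarrow> complex"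
  assumes "summable (\<lambda>n. norm (f (int n)))" and "\<And>n. n < 0 \<Longrightarrow> f n = 0"
  shows "(f has_sum (\<Sum>n. f (int n))) UNIV"
proof -
  have "((\<lambda>n. f (int n)) has_sum (\<Sum>n. f (int n))) UNIV"
    by (rule norm_summable_imp_has_sum[OF assms(1) summable_sums[OF summable_norm_cancel[OF assms(1)]]])
  then have "(f has_sum (\<Sum>n. f (int n))) (range int)"
    by (subst has_sum_reindex) (auto simp: o_def)
  moreover have "f n = 0" if "n \<notin> range int" for n
    using assms(2)[of n] that by (metis nonneg_int_cases not_less rangeI)
  ultimately show ?thesis
    using has_sum_cong_neutral[of UNIV "range int" f f] by auto
qed

lemma qexp_has_sum:
  assumes "norm x < 1"
  shows "((\<lambda>n. of_real (rpoch n) * x powi n) has_sum qexp x) UNIV"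
  using has_sum_int_of_suminf[of "\<lambda>n. of_real (rpoch n) * x powi n"] summable_qexp[OF assms]
  by (simp add: qexp_def)

lemma powi_int_mult_pred: "q powi (int n * (int n - 1)) = q ^ (n * (n - 1))"
proof -
  have "int n * (int n - 1) = int (n * (n - 1))"
    by (cases n) (auto simp: algebra_simps)
  then show ?thesis by (metis power_int_of_nat)
qed

lemma qExp_has_sum:
  "((\<lambda>n. of_real (q powi (n * (n - 1)) * rpoch n) * x powi n) has_sum qExp x) UNIV"
  using has_sum_int_of_suminf[of "\<lambda>n. of_real (q powi (n * (n - 1)) * rpoch n) * x powi n"] summable_qExp[of x]
  by (simp add: qExp_def powi_int_mult_pred)

end

section \<open>The Fourier coefficients of the quantum exponential function\<close>

lemma summable_on_product_nonneg:
  fixes f :: "'a \<Rightarrow> real" and g :: "'b \<Rightarrow> real"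
  assumes "f summable_on UNIV" "g summable_on UNIV" "\<And>i. 0 \<le> f i" "\<And>j. 0 \<le> g j"
  shows "(\<lambda>(i, j). f i * g j) summable_on UNIV \<times> UNIV"
proof (rule summable_on_SigmaI)
  fix i
  show "((\<lambda>j. case (i, j) of (i, j) \<Rightarrow> f i * g j) has_sum f i * infsum g UNIV) UNIV"
    using assms(2) by (auto intro: has_sum_cmult_right)
  show "(\<lambda>i. f i * infsum g UNIV) summable_on UNIV"
    using assms(1) by (rule summable_on_cmult_left)
qed (use assms in auto)

lemma has_sum_minus:
  fixes f g :: "'a \<Rightarrow> 'b :: real_normed_field"
  assumes "(f has_sum a) A" "(g has_sum b) A"
  shows "((\<lambda>x. f x - g x) has_sum a - b) A"
  using has_sum_add[OF assms(1) has_sum_uminusI[OF assms(2)]] by simp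

lemma abs_summable_on_le:
  fixes f :: "'a \<Rightarrow> 'b :: real_normed_vector" and g :: "'a \<Rightarrow> real"
  assumes "g summable_on A" and "\<And>x. norm (f x) \<le> g x"
  shows "(\<lambda>x. norm (f x)) summable_on A"
  using assms(1) by (rule Infinite_Sum.abs_summable_on_comparison_test') (rule assms(2))

lemma minus_one_powi: "(- 1) powi n = (if even n then 1 else - 1 :: 'a :: division_ring)"
  by (auto simp: power_int_minus_left)

lemma cnj_unit_powi: "norm u = 1 \<Longrightarrow> cnj u powi n = u powi (- n)"
proof -
  assume u: "norm u = 1"
  then have "u \<noteq> 0" "u * cnj u = 1"
    by (auto simp: complex_norm_square[symmetric])
  then have "cnj u = inverse u"
    by (metis inverse_unique)
  then show ?thesis by (simp add: power_int_inverse power_int_minus)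
qed

context q_parameter
begin

section \<open>Euler's expansion of the reciprocal factorials\<close>

lemma summable_qExp_coeff:
  "(\<lambda>i. q powi (i * (i - 1) + k * i) * rpoch i) summable_on UNIV"
proof -
  have "(\<lambda>n. of_real (q powi (n * (n - 1)) * rpoch n) * of_real (q powi k) powi n :: complex)
      summable_on UNIV"
    using qExp_has_sum has_sum_imp_summable by blast
  then have "(\<lambda>n. Re (of_real (q powi (n * (n - 1)) * rpoch n) * of_real (q powi k) powi n :: complex))
      summable_on UNIV"
    by (rule summable_on_Re)
  moreover have "Re (of_real (q powi (n * (n - 1)) * rpoch n) * of_real (q powi k) powi n :: complex)
      = q powi (n * (n - 1) + k * n) * rpoch n" for n
    unfolding of_real_power_int[symmetric] of_real_mult[symmetric] Re_complex_of_real
    by (simp add: power_int_mult[symmetric] q_powi_add)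
  ultimately show ?thesis by simp
qed

text \<open>This is (q^(2n+2); q^2)_inf, so that \<open>qE0\<close> below is (q^2; q^2)_inf.\<close>

definition qE_at :: "int \<Rightarrow> complex" where
  "qE_at n = qExp (- of_real (q powi (2 * (n + 1))))"

lemma qE_at_step: "qE_at (n - 1) = of_real (1 - q powi (2 * n)) * qE_at n"
proof -
  have "q\<^sup>2 * q powi (2 * n) = q powi (2 * (n + 1))"
    using q_powi_add[of 2 "2 * n"] by (simp add: algebra_simps)
  then have e: "of_real (q\<^sup>2) * - complex_of_real (q powi (2 * n)) = - of_real (q powi (2 * (n + 1)))"
    by (metis mult_minus_right of_real_mult)
  show ?thesis
    using qExp_functional[of "- of_real (q powi (2 * n))"] unfolding e by (simp add: qE_at_def)
qed

definition qE0 :: real where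
  "qE0 = Re (qE_at 0)"

text \<open>Both sides satisfy X (n - 1) = (1 - q^(2n)) X n. Upwards one divides by a nonzero
  factor; downwards one multiplies, and the zero factor at n = 0 makes both sides vanish at all
  negative n.\<close>

lemma qE_at_eq: "qE_at n = qE_at 0 * of_real (rpoch n)"
proof (induction n rule: int_induct[where k = 0])
  case base
  show ?case by simp
next
  case (step1 n)
  have "2 * (n + 1) \<noteq> 0"
    using step1.hyps by presburger
  then have "q powi (2 * (n + 1)) \<noteq> 1"
    using q_powi_inject[of "2 * (n + 1)" 0] by (metis power_int_0_right)
  then have d: "complex_of_real (1 - q powi (2 * (n + 1))) \<noteq> 0"
    by (metis eq_iff_diff_eq_0 of_real_eq_0_iff)
  have "of_real (rpoch n) = of_real (1 - q powi (2 * (n + 1))) * complex_of_real (rpoch (n + 1))"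
    using rpoch_step[of "n + 1"] by (metis add_diff_cancel_right' of_real_mult)
  then have "of_real (1 - q powi (2 * (n + 1))) * qE_at (n + 1) =
      of_real (1 - q powi (2 * (n + 1))) * (qE_at 0 * of_real (rpoch (n + 1)))"
    using qE_at_step[of "n + 1"] step1.IH by (simp only: add_diff_cancel_right' mult.left_commute)
  with d show ?case
    by (metis mult_left_cancel)
next
  case (step2 n)
  then show ?case
    using qE_at_step[of n] rpoch_step[of n] by (metis mult.left_commute of_real_mult)
qed

lemma qE_at_tendsto: "(\<lambda>n. qE_at (int n)) \<longlonglongrightarrow> 1"
proof -
  have "(\<lambda>n. - of_real (q ^ (2 * Suc n)) :: complex) \<longlonglongrightarrow> - of_real 0"
    by (intro tendsto_intros q_power_double_Suc_tendsto_0)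
  then have "(\<lambda>n. qExp (- of_real (q ^ (2 * Suc n)))) \<longlonglongrightarrow> qExp 0"
    by (intro isCont_tendsto_compose[OF isCont_qExp_0]) simp
  moreover have "q powi (2 * (int n + 1)) = q ^ (2 * Suc n)" for n
    by (metis of_nat_Suc of_nat_mult of_nat_numeral power_int_of_nat add.commute)
  ultimately show ?thesis
    unfolding qE_at_def by simp
qed

text \<open>The limit 1 forces \<open>qE0\<close> to be nonzero and \<open>rpoch\<close> to be
  bounded.\<close>

lemma qE0_rpoch_tendsto: "(\<lambda>n. qE0 * rpoch (int n)) \<longlonglongrightarrow> 1"
proof -
  have "(\<lambda>n. Re (qE_at (int n))) \<longlonglongrightarrow> Re 1"
    by (intro tendsto_intros qE_at_tendsto)
  then show ?thesis by (subst (asm) qE_at_eq) (simp add: qE0_def)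
qed

lemma qE0_nonzero: "qE0 \<noteq> 0"
proof
  assume "qE0 = 0"
  then show False using qE0_rpoch_tendsto by (simp add: LIMSEQ_const_iff)
qed

lemma rpoch_bounded: obtains B where "0 < B" "\<And>n. rpoch n \<le> B"
proof -
  have "(\<lambda>n. qE0 * rpoch (int n) / qE0) \<longlonglongrightarrow> 1 / qE0"
    by (intro tendsto_intros qE0_rpoch_tendsto qE0_nonzero)
  then have "Bseq (\<lambda>n. rpoch (int n))"
    using qE0_nonzero by (intro convergent_imp_Bseq convergentI) simp
  then obtain B where B: "0 < B" "\<And>n. norm (rpoch (int n)) \<le> B"
    by (auto simp: Bseq_def)
  have "rpoch n \<le> B" for n
    using B(1) B(2)[of "nat n"] by (cases "n < 0") auto
  with B(1) show ?thesis by (rule that)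
qed

text \<open>Euler's expansion of \<open>(q\<^sup>2\<^sup>n\<^sup>+\<^sup>2; q\<^sup>2)\<^sub>\<infinity>\<close>, valid for negative \<open>n\<close> because both sides then vanish.\<close>

lemma rpoch_expansion:
  "((\<lambda>j. (-1) powi j * q powi (j * (j - 1) + 2 * (n + 1) * j) * rpoch j) has_sum qE0 * rpoch n) UNIV"
proof -
  have "((\<lambda>j. of_real (q powi (j * (j - 1)) * rpoch j) * (- of_real (q powi (2 * (n + 1)))) powi j)
      has_sum qE_at n) UNIV"
    unfolding qE_at_def by (rule qExp_has_sum)
  then have "((\<lambda>j. Re (of_real (q powi (j * (j - 1)) * rpoch j) * (- of_real (q powi (2 * (n + 1)))) powi j))
      has_sum Re (qE_at n)) UNIV"
    by (rule has_sum_Re)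
  moreover have "Re (qE_at n) = qE0 * rpoch n"
    by (subst qE_at_eq) (simp add: qE0_def)
  moreover have "Re (of_real (q powi (j * (j - 1)) * rpoch j) * (- of_real (q powi (2 * (n + 1)))) powi j)
      = (-1) powi j * q powi (j * (j - 1) + 2 * (n + 1) * j) * rpoch j" for j
  proof -
    have "(- of_real (q powi (2 * (n + 1))) :: complex) powi j = of_real ((- (q powi (2 * (n + 1)))) powi j)"
      by simp
    also have "(- (q powi (2 * (n + 1)))) powi j = (-1) powi j * q powi (2 * (n + 1) * j)"
      unfolding power_int_mult[of q "2 * (n + 1)" j] power_int_mult_distrib[symmetric] by simp
    finally have *: "(- of_real (q powi (2 * (n + 1))) :: complex) powi j =
        of_real ((-1) powi j * q powi (2 * (n + 1) * j))" .
    show ?thesis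
      unfolding * of_real_mult[symmetric] Re_complex_of_real by (simp add: q_powi_add)
  qed
  ultimately show ?thesis by simp
qed

text \<open>\<open>qJ l m\<close> is the \<open>l\<close>-th Fourier coefficient of \<open>F\<^sub>q\<close> on the circle of radius \<open>q\<^sup>m\<close>,
  up to normalisation a Hahn--Exton \<open>q\<close>-Bessel function.\<close>

definition qJ_term :: "int \<Rightarrow> int \<Rightarrow> int \<Rightarrow> real" where
  "qJ_term l m i = (-1) powi (i + l) * q powi (2 * m * i + m * l + i * (i - 1)) * rpoch i * rpoch (i + l)"

definition qJ :: "int \<Rightarrow> int \<Rightarrow> real" where
  "qJ l m = (\<Sum>\<^sub>\<infinity>i. qJ_term l m i)"

section \<open>Symmetries and contiguity relations of the coefficients\<close>

lemma abs_minus_one_powi [simp]: "\<bar>(- 1) powi n\<bar> = (1 :: real)"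
  by (simp add: minus_one_powi)

lemma summable_qJ_term: "qJ_term l m summable_on UNIV"
proof -
  obtain B where B: "0 < B" "\<And>n. rpoch n \<le> B"
    using rpoch_bounded by blast
  have "(\<lambda>i. q powi (m * l) * B * (q powi (i * (i - 1) + 2 * m * i) * rpoch i)) summable_on UNIV"
    by (rule summable_on_cmult_right[OF summable_qExp_coeff])
  moreover have "norm (qJ_term l m i) \<le> q powi (m * l) * B * (q powi (i * (i - 1) + 2 * m * i) * rpoch i)" for i
  proof -
    have "norm (qJ_term l m i) = q powi (m * l) * q powi (i * (i - 1) + 2 * m * i) * rpoch i * rpoch (i + l)"
      unfolding qJ_term_def q_powi_add[symmetric]
      by (simp add: abs_mult less_imp_le abs_of_pos algebra_simps)
    also have "\<dots> \<le> q powi (m * l) * q powi (i * (i - 1) + 2 * m * i) * rpoch i * B"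
      by (intro mult_left_mono B) (auto simp: less_imp_le)
    finally show ?thesis by (simp add: algebra_simps)
  qed
  ultimately have "(\<lambda>i. norm (qJ_term l m i)) summable_on UNIV"
    by (rule abs_summable_on_le)
  then show ?thesis by (rule abs_summable_summable)
qed

lemma qJ_has_sum: "(qJ_term l m has_sum qJ l m) UNIV"
  unfolding qJ_def using summable_qJ_term by (rule has_sum_infsum)

text \<open>Replacing the summation index \<open>i\<close> by \<open>i - l\<close> exchanges the two
  reciprocal factorials \<open>rpoch i\<close> and \<open>rpoch (i + l)\<close>; the quadratic
  exponent then turns \<open>m\<close> into \<open>m - l\<close>.\<close>

lemma qJ_neg: "qJ l m = (-1) powi l * q powi l * qJ (- l) (m - l)"
proof -
  have "((\<lambda>i. (-1) powi l * q powi l * qJ_term (- l) (m - l) i) has_sum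
      (-1) powi l * q powi l * qJ (- l) (m - l)) UNIV"
    by (intro has_sum_cmult_right qJ_has_sum)
  moreover have "(-1) powi l * q powi l * qJ_term (- l) (m - l) i = qJ_term l m (i - l)" for i
  proof -
    have "q powi l * q powi (2 * (m - l) * i + (m - l) * (- l) + i * (i - 1))
        = q powi (2 * m * (i - l) + m * l + (i - l) * (i - l - 1))"
      unfolding q_powi_add[symmetric] by (simp add: algebra_simps)
    moreover have "(-1) powi l * (-1) powi (i + - l) = ((-1) powi (i - l + l) :: real)"
      by (auto simp: minus_one_powi)
    moreover have "(-1) powi l * q powi l * qJ_term (- l) (m - l) i =
        ((-1) powi l * (-1) powi (i + - l)) *
        (q powi l * q powi (2 * (m - l) * i + (m - l) * (- l) + i * (i - 1))) * rpoch i * rpoch (i + - l)"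
      unfolding qJ_term_def by (simp only: mult_ac)
    ultimately show ?thesis
      unfolding qJ_term_def by (simp only: diff_add_cancel) (simp add: mult_ac)
  qed
  ultimately have "((\<lambda>i. qJ_term l m (i - l)) has_sum (-1) powi l * q powi l * qJ (- l) (m - l)) UNIV"
    by simp
  moreover have "bij (\<lambda>i. i - l)"
    by (rule bij_betwI[of _ _ _ "\<lambda>i. i + l"]) auto
  ultimately show ?thesis
    using has_sum_reindex_bij_betw[of "\<lambda>i. i - l" UNIV UNIV "qJ_term l m"] qJ_has_sum has_sum_unique
    by blast
qed

text \<open>Up to prefactors these are the terms of \<open>qE0 * qJ (l - 1) m\<close> after
  \<open>rpoch (i + l - 1)\<close> has been expanded by Euler's series. Taking the first argument
  one above the order makes the expression invariant under the exchange of \<open>(l, j)\<close>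
  with \<open>(m, i)\<close>.\<close>

definition qJ_double :: "int \<Rightarrow> int \<Rightarrow> int \<Rightarrow> int \<Rightarrow> real" where
  "qJ_double l m i j = (-1) powi (i + j) *
     q powi (i * (i - 1) + j * (j - 1) + 2 * i * j + 2 * m * i + 2 * l * j) * rpoch i * rpoch j"

lemma summable_qJ_double: "(\<lambda>(i, j). qJ_double l m i j) summable_on UNIV \<times> UNIV"
proof -
  define b where "b k i = q powi (i * (i - 1) + 2 * k * i) * rpoch i" for k i
  have "(\<lambda>(i, j). b m i * b l j) summable_on UNIV \<times> UNIV"
    unfolding b_def
    by (intro summable_on_product_nonneg summable_qExp_coeff) (auto simp: less_imp_le)
  moreover have "norm (case x of (i, j) \<Rightarrow> qJ_double l m i j) \<le> (case x of (i, j) \<Rightarrow> b m i * b l j)" for x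
  proof -
    obtain i j where x: "x = (i, j)" by fastforce
    show ?thesis
    proof (cases "i < 0 \<or> j < 0")
      case True
      then show ?thesis by (auto simp: x b_def qJ_double_def)
    next
      case False
      have e: "q powi (i * (i - 1) + j * (j - 1) + 2 * i * j + 2 * m * i + 2 * l * j)
          = q powi (2 * (i * j)) * (q powi (i * (i - 1) + 2 * m * i) * q powi (j * (j - 1) + 2 * l * j))"
        unfolding q_powi_add[symmetric] by (simp add: algebra_simps)
      have "norm (qJ_double l m i j) = q powi (2 * (i * j)) * (b m i * b l j)"
        unfolding qJ_double_def b_def e by (simp add: abs_mult less_imp_le abs_of_pos)
      \<comment> \<open>The mixed factor q^(2ij) is at most 1 because \<open>i\<close> and
        \<open>j\<close> are nonnegative here; a product of two summable sequences is left.\<close>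
      also have "\<dots> \<le> 1 * (b m i * b l j)"
        using False q_pos q_less_1 by (intro mult_right_mono power_int_le_one)
          (auto simp: b_def less_imp_le)
      finally show ?thesis by (simp add: x)
    qed
  qed
  ultimately have "(\<lambda>x. norm (case x of (i, j) \<Rightarrow> qJ_double l m i j)) summable_on UNIV \<times> UNIV"
    by (rule abs_summable_on_le)
  then show ?thesis by (rule abs_summable_summable)
qed

lemma qJ_eq_double: "qE0 * qJ l m = (-1) powi l * q powi (m * l) * (\<Sum>\<^sub>\<infinity>i. \<Sum>\<^sub>\<infinity>j. qJ_double (l + 1) m i j)"
proof -
  have inner: "(\<Sum>\<^sub>\<infinity>j. qJ_double (l + 1) m i j) =
      (-1) powi i * q powi (i * (i - 1) + 2 * m * i) * rpoch i * (qE0 * rpoch (i + l))" for i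
  proof (rule infsumI)
    have "((\<lambda>j. (-1) powi i * q powi (i * (i - 1) + 2 * m * i) * rpoch i *
          ((-1) powi j * q powi (j * (j - 1) + 2 * (i + l + 1) * j) * rpoch j)) has_sum
        (-1) powi i * q powi (i * (i - 1) + 2 * m * i) * rpoch i * (qE0 * rpoch (i + l))) UNIV"
      by (intro has_sum_cmult_right rpoch_expansion)
    moreover have "(-1) powi i * q powi (i * (i - 1) + 2 * m * i) * rpoch i *
          ((-1) powi j * q powi (j * (j - 1) + 2 * (i + l + 1) * j) * rpoch j) = qJ_double (l + 1) m i j" for j
    proof -
      have "q powi (i * (i - 1) + 2 * m * i) * q powi (j * (j - 1) + 2 * (i + l + 1) * j) =
          q powi (i * (i - 1) + j * (j - 1) + 2 * i * j + 2 * m * i + 2 * (l + 1) * j)"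
        unfolding q_powi_add[symmetric] by (simp add: algebra_simps)
      then show ?thesis
        unfolding qJ_double_def by (simp add: power_int_add)
    qed
    ultimately show "(qJ_double (l + 1) m i has_sum
        (-1) powi i * q powi (i * (i - 1) + 2 * m * i) * rpoch i * (qE0 * rpoch (i + l))) UNIV"
      by simp
  qed
  have "(-1) powi l * q powi (m * l) * (\<Sum>\<^sub>\<infinity>j. qJ_double (l + 1) m i j) = qE0 * qJ_term l m i" for i
  proof -
    have "q powi (m * l) * q powi (i * (i - 1) + 2 * m * i) = q powi (2 * m * i + m * l + i * (i - 1))"
      unfolding q_powi_add[symmetric] by (simp add: algebra_simps)
    then show ?thesis
      unfolding inner qJ_term_def by (simp add: power_int_add mult.left_commute)
  qed
  then have "(\<Sum>\<^sub>\<infinity>i. (-1) powi l * q powi (m * l) * (\<Sum>\<^sub>\<infinity>j. qJ_double (l + 1) m i j)) = qE0 * qJ l m"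
    by (simp add: infsum_cmult_right' qJ_def)
  then show ?thesis
    by (simp add: infsum_cmult_right')
qed

lemma qJ_symmetric: "qJ l m = (-1) powi (l + 1 + m) * q powi (l + 1 - m) * qJ (m - 1) (l + 1)"
proof -
  have sw: "(\<Sum>\<^sub>\<infinity>i. \<Sum>\<^sub>\<infinity>j. qJ_double (l + 1) m i j) = (\<Sum>\<^sub>\<infinity>i. \<Sum>\<^sub>\<infinity>j. qJ_double m (l + 1) i j)"
  proof -
    have "(\<Sum>\<^sub>\<infinity>i. \<Sum>\<^sub>\<infinity>j. qJ_double (l + 1) m i j) = (\<Sum>\<^sub>\<infinity>j. \<Sum>\<^sub>\<infinity>i. qJ_double (l + 1) m i j)"
      by (rule infsum_swap_banach) (use summable_qJ_double in auto)
    also have "\<dots> = (\<Sum>\<^sub>\<infinity>j. \<Sum>\<^sub>\<infinity>i. qJ_double m (l + 1) j i)"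
      by (intro infsum_cong) (simp add: qJ_double_def algebra_simps)
    finally show ?thesis .
  qed
  have "qE0 * qJ l m = (-1) powi l * q powi (m * l) * (\<Sum>\<^sub>\<infinity>i. \<Sum>\<^sub>\<infinity>j. qJ_double m (l + 1) i j)"
    unfolding qJ_eq_double sw ..
  also have "\<dots> = (-1) powi (l + 1 + m) * q powi (l + 1 - m) *
      ((-1) powi (m - 1) * q powi ((l + 1) * (m - 1)) * (\<Sum>\<^sub>\<infinity>i. \<Sum>\<^sub>\<infinity>j. qJ_double m (l + 1) i j))"
  proof -
    have "q powi (m * l) = q powi (l + 1 - m) * q powi ((l + 1) * (m - 1))"
      unfolding q_powi_add[symmetric] by (simp add: algebra_simps)
    moreover have "(-1) powi l = ((-1) powi (l + 1 + m) * (-1) powi (m - 1) :: real)"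
      by (auto simp: minus_one_powi)
    ultimately show ?thesis by simp
  qed
  also have "\<dots> = (-1) powi (l + 1 + m) * q powi (l + 1 - m) * (qE0 * qJ (m - 1) (l + 1))"
    using qJ_eq_double[of "m - 1" "l + 1"] by simp
  finally show ?thesis
    using qE0_nonzero by (simp add: mult.left_commute)
qed

text \<open>Symmetry, change of sign of the order, and symmetry again. The circles with
  \<open>m <= 0\<close>, which the product of Euler series does not reach, are carried to circles
  with \<open>m >= 2\<close>.\<close>

lemma qJ_reflect: "qJ l m = qJ (l + 1 - m) (2 - m)"
proof -
  have "qJ l m = (-1) powi (l + 1 + m) * q powi (l + 1 - m) *
      ((-1) powi (m - 1) * q powi (m - 1) * ((-1) powi l * q powi (- l) * qJ (l + 1 - m) (2 - m)))"
    using qJ_symmetric[of l m] qJ_neg[of "m - 1" "l + 1"] qJ_symmetric[of "1 - m" "l + 2 - m"]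
    by (simp add: algebra_simps minus_one_powi)
  also have "\<dots> = ((-1) powi (l + 1 + m) * (-1) powi (m - 1) * (-1) powi l) *
      (q powi (l + 1 - m) * q powi (m - 1) * q powi (- l)) * qJ (l + 1 - m) (2 - m)"
    by (simp add: mult_ac)
  also have "q powi (l + 1 - m) * q powi (m - 1) * q powi (- l) = 1"
    unfolding q_powi_add[symmetric] by simp
  also have "(-1) powi (l + 1 + m) * (-1) powi (m - 1) * (-1) powi l = (1 :: real)"
    by (auto simp: minus_one_powi)
  finally show ?thesis by simp
qed

text \<open>Passing from \<open>m\<close> to \<open>m + 1\<close> multiplies the i-th term by q^(2i
  + l). The difference therefore carries 1 - q^(2(i + l)), which \<open>rpoch_step\<close> absorbs
  by lowering the argument of \<open>rpoch (i + l)\<close>.\<close>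

lemma qJ_contig_pred: "q powi l * qJ l (m + 1) - qJ l m = q powi m * qJ (l - 1) m"
proof -
  have "((\<lambda>i. q powi l * qJ_term l (m + 1) i - qJ_term l m i) has_sum q powi l * qJ l (m + 1) - qJ l m) UNIV"
    by (intro has_sum_minus has_sum_cmult_right qJ_has_sum)
  moreover have "q powi l * qJ_term l (m + 1) i - qJ_term l m i = q powi m * qJ_term (l - 1) m i" for i
  proof -
    have e1: "q powi l * q powi (2 * (m + 1) * i + (m + 1) * l + i * (i - 1)) =
        q powi (2 * m * i + m * l + i * (i - 1)) * q powi (2 * (i + l))"
      unfolding q_powi_add[symmetric] by (simp add: algebra_simps)
    have e2: "q powi m * q powi (2 * m * i + m * (l - 1) + i * (i - 1)) = q powi (2 * m * i + m * l + i * (i - 1))"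
      unfolding q_powi_add[symmetric] by (simp add: algebra_simps)
    have "q powi l * qJ_term l (m + 1) i - qJ_term l m i =
      (-1) powi (i + l) * (q powi l * q powi (2 * (m + 1) * i + (m + 1) * l + i * (i - 1))) * rpoch i * rpoch (i + l)
      - (-1) powi (i + l) * q powi (2 * m * i + m * l + i * (i - 1)) * rpoch i * rpoch (i + l)"
      by (simp add: qJ_term_def)
    also have "\<dots> = - ((-1) powi (i + l)) * q powi (2 * m * i + m * l + i * (i - 1)) * rpoch i *
        ((1 - q powi (2 * (i + l))) * rpoch (i + l))"
      unfolding e1 by (simp add: algebra_simps)
    also have "\<dots> = (-1) powi (i + (l - 1)) * q powi (2 * m * i + m * l + i * (i - 1)) * rpoch i * rpoch (i + (l - 1))"
      unfolding rpoch_step by (simp add: minus_one_powi algebra_simps)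
    also have "\<dots> = q powi m * qJ_term (l - 1) m i"
      unfolding qJ_term_def e2[symmetric] by simp
    finally show ?thesis .
  qed
  ultimately have "((\<lambda>i. q powi m * qJ_term (l - 1) m i) has_sum q powi l * qJ l (m + 1) - qJ l m) UNIV"
    by simp
  moreover have "((\<lambda>i. q powi m * qJ_term (l - 1) m i) has_sum q powi m * qJ (l - 1) m) UNIV"
    by (intro has_sum_cmult_right qJ_has_sum)
  ultimately show ?thesis by (rule has_sum_unique)
qed

text \<open>The preceding relation at order \<open>- l\<close> and radius index
  \<open>m - l - 1\<close>, carried back by \<open>qJ_neg\<close>.\<close>

lemma qJ_contig_succ: "q powi l * qJ l (m - 1) - qJ l m = q powi (m - 2) * qJ (l + 1) m"
proof -
  define s :: real where "s = (-1) powi l"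
  \<comment> \<open>Here \<open>a\<close> and \<open>b\<close> stand for q^l and its inverse,
    \<open>B\<close>, \<open>C\<close>, \<open>D\<close> for the three reflected values of
    \<open>qJ\<close>, and \<open>X\<close>, \<open>Y\<close>, \<open>E\<close> for powers of q. The
    claim is a polynomial consequence of the reflected relation and two identities between
    powers.\<close>
  have elim: "a * (s * a * B) - s * a * C = Y * (- s * E * D)"
    if "a * b = 1" "b * C - B = X * D" "a * a * X = Y * E" for a b B C D E X Y :: real
    using that by algebra
  have idx: "m - 1 - l = m - l - 1" "- (l + 1) = - l - 1" "m - (l + 1) = m - l - 1" "m - l - 1 + 1 = m - l"
    by auto
  have sgn: "(-1) powi (l + 1) = - s"
    by (simp add: s_def minus_one_powi)
  have 1: "qJ l (m - 1) = s * q powi l * qJ (- l) (m - l - 1)"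
    using qJ_neg[of l "m - 1"] unfolding s_def idx .
  have 2: "qJ l m = s * q powi l * qJ (- l) (m - l)"
    using qJ_neg[of l m] unfolding s_def .
  have 3: "qJ (l + 1) m = - s * q powi (l + 1) * qJ (- l - 1) (m - l - 1)"
    using qJ_neg[of "l + 1" m] unfolding idx sgn .
  have contig: "q powi (- l) * qJ (- l) (m - l) - qJ (- l) (m - l - 1) = q powi (m - l - 1) * qJ (- l - 1) (m - l - 1)"
    using qJ_contig_pred[of "- l" "m - l - 1"] unfolding idx .
  have inv: "q powi l * q powi (- l) = 1"
    unfolding q_powi_add[symmetric] by simp
  have "q powi l * q powi l * q powi (m - l - 1) = q powi (m - 2) * q powi (l + 1)"
    unfolding q_powi_add[symmetric] by (simp add: algebra_simps)
  then show ?thesis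
    unfolding 1 2 3 by (rule elim[OF inv contig])
qed

text \<open>The Cauchy product of the two Euler series at z = q^m u, regrouped by the difference
  \<open>l\<close> of the indices: since |u| = 1, conj(u)^i u^(i + l) depends on \<open>l\<close>
  alone. The condition \<open>1 <= m\<close> puts z into the disc where \<open>qexp\<close>
  converges.\<close>

lemma qExp_mult_qexp_has_sum:
  assumes m: "1 \<le> m" and u: "norm u = 1"
  shows "((\<lambda>l. of_real (qJ l m) * u powi l) has_sum
    qExp (cnj (of_real (q powi m) * u)) * qexp (- (of_real (q powi m) * u))) UNIV"
proof -
  define z where "z = of_real (q powi m) * u"
  have z: "norm (- z) < 1"
    using m u power_int_strict_decreasing[of 0 m q] q_pos q_less_1
    by (simp add: z_def norm_mult norm_power_int)
  define f where "f i = of_real (q powi (i * (i - 1)) * rpoch i) * cnj z powi i" for i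
  define g where "g j = of_real (rpoch j) * (- z) powi j" for j
  have f: "(f has_sum qExp (cnj z)) UNIV"
    unfolding f_def by (rule qExp_has_sum)
  have g: "(g has_sum qexp (- z)) UNIV"
    unfolding g_def by (rule qexp_has_sum[OF z])
  have "(\<lambda>i. norm (f i)) summable_on UNIV" "(\<lambda>i. norm (g i)) summable_on UNIV"
    using has_sum_imp_summable[OF f] has_sum_imp_summable[OF g]
    by (auto simp: summable_on_iff_abs_summable_on_complex)
  then have "(\<lambda>(i, j). norm (f i) * norm (g j)) summable_on UNIV \<times> UNIV"
    by (intro summable_on_product_nonneg) auto
  then have S: "(\<lambda>(i, j). f i * g j) summable_on UNIV \<times> UNIV"
    unfolding summable_on_iff_abs_summable_on_complex by (simp add: norm_mult case_prod_unfold)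
  have "((\<lambda>(i, j). f i * g j) has_sum qExp (cnj z) * qexp (- z)) (UNIV \<times> UNIV)"
  proof (rule has_sum_SigmaI[OF _ _ S])
    show "((\<lambda>j. case (i, j) of (i, j) \<Rightarrow> f i * g j) has_sum f i * qexp (- z)) UNIV" for i
      using g by (auto intro: has_sum_cmult_right)
    show "((\<lambda>i. f i * qexp (- z)) has_sum qExp (cnj z) * qexp (- z)) UNIV"
      by (rule has_sum_cmult_left[OF f])
  qed
  moreover have "bij_betw (\<lambda>(l, i). (i, i + l)) (UNIV \<times> UNIV) (UNIV \<times> (UNIV :: int set))"
    by (rule bij_betwI[of _ _ _ "\<lambda>(i, j). (j - i, i)"]) auto
  ultimately have "((\<lambda>x. (case (case x of (l, i) \<Rightarrow> (i, i + l)) of (i, j) \<Rightarrow> f i * g j)) has_sum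
      qExp (cnj z) * qexp (- z)) (UNIV \<times> UNIV)"
    by (subst has_sum_reindex_bij_betw)
  then have "((\<lambda>(l, i). f i * g (i + l)) has_sum qExp (cnj z) * qexp (- z)) (UNIV \<times> UNIV)"
    by (simp add: case_prod_unfold)
  then have "((\<lambda>l. of_real (qJ l m) * u powi l) has_sum qExp (cnj z) * qexp (- z)) UNIV"
  proof (rule has_sum_SigmaD)
    fix l
    have "f i * g (i + l) = of_real (qJ_term l m i) * u powi l" for i
    proof -
      have "cnj z powi i * (- z) powi (i + l) = of_real ((-1) powi (i + l) * q powi (m * i) * q powi (m * (i + l)))
          * (cnj u powi i * u powi (i + l))"
      proof -
        have "- z = - 1 * of_real (q powi m) * u" by (simp add: z_def)
        then have "(- z) powi (i + l) = (- 1) powi (i + l) * of_real (q powi m) powi (i + l) * u powi (i + l)"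
          by (simp only: power_int_mult_distrib)
        moreover have "cnj z powi i = of_real (q powi m) powi i * cnj u powi i"
          by (simp add: z_def power_int_mult_distrib)
        moreover have "(- 1) powi (i + l) = complex_of_real ((-1) powi (i + l))"
          by (simp add: minus_one_powi)
        moreover have "complex_of_real (q powi m) powi n = of_real (q powi (m * n))" for n
          by (simp only: of_real_power_int[symmetric] power_int_mult)
        ultimately have "cnj z powi i * (- z) powi (i + l) = (of_real (q powi (m * i)) * cnj u powi i) *
            (of_real ((-1) powi (i + l)) * of_real (q powi (m * (i + l))) * u powi (i + l))"
          by (simp only:)
        then show ?thesis by (simp only: of_real_mult mult_ac)
      qed
      also have "cnj u powi i * u powi (i + l) = u powi l"
      proof -
        have "u \<noteq> 0" using u by auto
        then show ?thesis
          unfolding cnj_unit_powi[OF u] by (simp flip: power_int_add)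
      qed
      finally have "f i * g (i + l) = of_real (q powi (i * (i - 1)) * rpoch i * rpoch (i + l) *
          ((-1) powi (i + l) * q powi (m * i) * q powi (m * (i + l)))) * u powi l"
        by (simp add: f_def g_def)
      also have "q powi (i * (i - 1)) * rpoch i * rpoch (i + l) *
          ((-1) powi (i + l) * q powi (m * i) * q powi (m * (i + l))) = qJ_term l m i"
      proof -
        have "q powi (2 * m * i + m * l + i * (i - 1)) = q powi (i * (i - 1)) * q powi (m * i) * q powi (m * (i + l))"
          unfolding q_powi_add[symmetric] by (simp add: algebra_simps)
        then show ?thesis by (simp add: qJ_term_def)
      qed
      finally show ?thesis .
    qed
    moreover have "((\<lambda>i. of_real (qJ_term l m i) * u powi l) has_sum of_real (qJ l m) * u powi l) UNIV"
      by (intro has_sum_cmult_left has_sum_of_real qJ_has_sum)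
    ultimately show "((\<lambda>i. case (l, i) of (l, i) \<Rightarrow> f i * g (i + l)) has_sum of_real (qJ l m) * u powi l) UNIV"
      by simp
  qed
  then show ?thesis by (simp add: z_def)
qed

lemma summable_qJ: "(\<lambda>l. \<bar>qJ l m\<bar>) summable_on UNIV"
proof -
  have pos: "(\<lambda>l. \<bar>qJ l m\<bar>) summable_on UNIV" if "1 \<le> m" for m
  proof -
    have "(\<lambda>l. of_real (qJ l m) * 1 powi l :: complex) summable_on UNIV"
      using qExp_mult_qexp_has_sum[OF that, of 1] has_sum_imp_summable by (metis norm_one)
    then show ?thesis
      unfolding summable_on_iff_abs_summable_on_complex by simp
  qed
  show ?thesis
  proof (cases "1 \<le> m")
    case False
    have "bij (\<lambda>l :: int. l + 1 - m)"
      by (rule bij_betwI[of _ _ _ "\<lambda>l. l - 1 + m"]) auto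
    from summable_on_reindex_bij_betw[OF this, of "\<lambda>l. \<bar>qJ l (2 - m)\<bar>"] pos[of "2 - m"] False
    show ?thesis by (subst qJ_reflect) simp
  qed (rule pos)
qed

text \<open>The candidate for F_q at q^m u, available for every \<open>m\<close> because it is built
  from the coefficients; \<open>Fq_eq_Phi\<close> confirms it for \<open>u\<close> other than
  -1.\<close>

definition Phi :: "int \<Rightarrow> complex \<Rightarrow> complex" where
  "Phi m u = (\<Sum>\<^sub>\<infinity>l. of_real (qJ l m) * u powi l)"

lemma Phi_has_sum:
  assumes "norm u = 1"
  shows "((\<lambda>l. of_real (qJ l m) * u powi l) has_sum Phi m u) UNIV"
proof -
  have "(\<lambda>l. of_real (qJ l m) * u powi l) summable_on UNIV"
    unfolding summable_on_iff_abs_summable_on_complex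
    using summable_qJ assms by (simp add: norm_mult norm_power_int)
  then show ?thesis unfolding Phi_def by (rule has_sum_infsum)
qed

text \<open>In the coefficient of u^l both sides equal q^l \<open>qJ l (m + 1)\<close>, by one
  contiguity relation each. This is the functional equation of F_q under z -> q^2 z, and it
  continues statements from \<open>m + 2\<close> down to \<open>m\<close>.\<close>

lemma Phi_recurrence:
  assumes u: "norm u = 1"
  shows "(1 + of_real (q powi m) * u) * Phi m u = (1 + of_real (q powi m) * cnj u) * Phi (m + 2) u"
proof -
  have u0: "u \<noteq> 0" using u by auto
  have shift: "((\<lambda>l. of_real (qJ (l - d) m) * u powi l) has_sum u powi d * Phi m u) UNIV" for d m
  proof -
    have "bij (\<lambda>l :: int. l - d)"
      by (rule bij_betwI[of _ _ _ "\<lambda>l. l + d"]) auto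
    from has_sum_reindex_bij_betw[OF this, of "\<lambda>l. u powi d * (of_real (qJ l m) * u powi l)"]
    have "((\<lambda>l. u powi d * (of_real (qJ (l - d) m) * u powi (l - d))) has_sum u powi d * Phi m u) UNIV"
      using has_sum_cmult_right[OF Phi_has_sum[OF u]] by blast
    moreover have "u powi d * (c * u powi (l - d)) = c * u powi l" for c l
      using u0 by (simp add: power_int_diff)
    ultimately show ?thesis by (simp only:)
  qed
  have "((\<lambda>l. of_real (qJ l m) * u powi l + of_real (q powi m) * (of_real (qJ (l - 1) m) * u powi l)) has_sum
      Phi m u + of_real (q powi m) * (u powi 1 * Phi m u)) UNIV"
    by (intro has_sum_add has_sum_cmult_right Phi_has_sum[OF u] shift)
  moreover have "((\<lambda>l. of_real (qJ l (m + 2)) * u powi l + of_real (q powi m) * (of_real (qJ (l - (-1)) (m + 2)) * u powi l)) has_sum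
      Phi (m + 2) u + of_real (q powi m) * (u powi (-1) * Phi (m + 2) u)) UNIV"
    by (intro has_sum_add has_sum_cmult_right Phi_has_sum[OF u] shift)
  moreover have "of_real (qJ l m) * u powi l + of_real (q powi m) * (of_real (qJ (l - 1) m) * u powi l) =
      of_real (qJ l (m + 2)) * u powi l + of_real (q powi m) * (of_real (qJ (l - (-1)) (m + 2)) * u powi l)" for l
  proof -
    have "qJ l m + q powi m * qJ (l - 1) m = qJ l (m + 2) + q powi m * qJ (l + 1) (m + 2)"
      using qJ_contig_pred[of l m] qJ_contig_succ[of l "m + 2"] by (simp add: algebra_simps)
    then have "of_real (qJ l m + q powi m * qJ (l - 1) m) * u powi l =
        of_real (qJ l (m + 2) + q powi m * qJ (l + 1) (m + 2)) * u powi l" by simp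
    then show ?thesis by (simp add: algebra_simps)
  qed
  ultimately have "Phi m u + of_real (q powi m) * (u powi 1 * Phi m u) =
      Phi (m + 2) u + of_real (q powi m) * (u powi (-1) * Phi (m + 2) u)"
    using has_sum_unique by (metis (no_types, lifting) ext)
  then show ?thesis
    using cnj_unit_powi[OF u, of 1] by (simp add: algebra_simps)
qed

section \<open>Identification of the Fourier series with F_q off the negative axis\<close>

lemma q_power_double: "q ^ (2 * k) = q powi (2 * int k)"
  by (metis of_nat_mult of_nat_numeral power_int_of_nat)

lemma q_power_double_polar:
  "complex_of_real (q ^ (2 * k)) * (of_real (q powi m) * v) = of_real (q powi (m + 2 * int k)) * v"
  unfolding q_power_double q_powi_add by (simp only: of_real_mult mult_ac)

definition Fq_factor :: "int \<Rightarrow> complex \<Rightarrow> nat \<Rightarrow> complex" where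
  "Fq_factor m u k = (1 + of_real (q powi (m + 2 * int k)) * cnj u) / (1 + of_real (q powi (m + 2 * int k)) * u)"

lemma one_plus_nonzero:
  fixes u :: complex
  assumes "norm u = 1" "u \<noteq> - 1"
  shows "1 + of_real (q powi m) * u \<noteq> 0"
proof
  assume "1 + of_real (q powi m) * u = 0"
  then have e: "of_real (q powi m) * u = - 1"
    by (simp add: eq_neg_iff_add_eq_0 add.commute)
  then have "norm (of_real (q powi m) * u) = 1" by simp
  then have "q powi m = 1"
    using assms q_pos by (simp add: norm_mult norm_power_int)
  with e assms show False by simp
qed

lemma norm_Fq_factor:
  assumes "norm u = 1" "u \<noteq> - 1"
  shows "norm (Fq_factor m u k) = 1"
proof -
  have "1 + of_real (q powi (m + 2 * int k)) * cnj u = cnj (1 + of_real (q powi (m + 2 * int k)) * u)"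
    by simp
  then have "norm (1 + of_real (q powi (m + 2 * int k)) * cnj u) = norm (1 + of_real (q powi (m + 2 * int k)) * u)"
    by (metis complex_mod_cnj)
  then show ?thesis
    using one_plus_nonzero[OF assms] by (simp add: Fq_factor_def norm_divide)
qed

text \<open>For \<open>m >= 1\<close> the functional equations of \<open>qExp\<close> and
  \<open>qexp\<close> split the factors off G(z) = qExp(conj z) qexp(-z) one at a time, and G tends
  to 1 at 0. Smaller \<open>m\<close> follow from \<open>m + 2\<close> by adjoining one further
  factor at the front.\<close>

lemma Fq_factor_prod_tendsto:
  assumes u: "norm u = 1" "u \<noteq> - 1"
  shows "(\<lambda>n. \<Prod>k<n. Fq_factor m u k) \<longlonglongrightarrow> Phi m u"
proof -
  have pos: "(\<lambda>n. \<Prod>k<n. Fq_factor m u k) \<longlonglongrightarrow> Phi m u" if m: "1 \<le> m" for m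
  proof -
    define z where "z = of_real (q powi m) * u"
    define G where "G w = qExp (cnj w) * qexp (- w)" for w
    have z: "norm z < 1"
      using m u power_int_strict_decreasing[of 0 m q] q_pos q_less_1
      by (simp add: z_def norm_mult norm_power_int)
    have G: "G z = Phi m u"
      using has_sum_unique[OF qExp_mult_qexp_has_sum[OF m u(1)] Phi_has_sum[OF u(1)]]
      by (simp add: G_def z_def)
    have eqn: "G z = (\<Prod>k<n. Fq_factor m u k) * G (of_real (q ^ (2 * n)) * z)" for n
    proof (induction n)
      case (Suc n)
      define w where "w = of_real (q ^ (2 * n)) * z"
      have w_eq: "w = of_real (q powi (m + 2 * int n)) * u"
        unfolding w_def z_def by (rule q_power_double_polar)
      have w: "norm w < 1"
      proof -
        have "q ^ (2 * n) * norm z \<le> 1 * norm z"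
          using q_pos q_less_1 by (intro mult_right_mono power_le_one) auto
        then show ?thesis
          using z q_pos by (simp add: w_def norm_mult norm_power)
      qed
      have fac: "Fq_factor m u n = (1 + cnj w) / (1 + w)"
        by (simp add: Fq_factor_def w_eq)
      have nz: "1 + w \<noteq> 0"
        unfolding w_eq by (rule one_plus_nonzero[OF u])
      have "G w = Fq_factor m u n * G (of_real (q\<^sup>2) * w)"
      proof -
        have "qExp (cnj w) = (1 + cnj w) * qExp (cnj (of_real (q\<^sup>2) * w))"
          by (subst qExp_functional) simp
        moreover have "qexp (- w) = qexp (- (of_real (q\<^sup>2) * w)) / (1 + w)"
          using qexp_functional[of "- w"] w nz by (simp add: field_simps)
        ultimately show ?thesis
          unfolding G_def fac by (simp add: divide_simps)
      qed
      moreover have e: "of_real (q ^ (2 * Suc n)) * z = of_real (q\<^sup>2) * w"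
        by (simp add: w_def power2_eq_square mult_ac)
      moreover have "G z = (\<Prod>k<n. Fq_factor m u k) * G w"
        using Suc by (simp only: w_def)
      ultimately show ?case
        unfolding e prod.lessThan_Suc by (simp only: mult_ac)
    qed simp
    have "(\<lambda>n. of_real (q ^ (2 * n)) * z) \<longlonglongrightarrow> of_real 0 * z"
      by (intro tendsto_intros q_power_double_tendsto_0)
    then have lim: "(\<lambda>n. of_real (q ^ (2 * n)) * z) \<longlonglongrightarrow> 0" by simp
    have "(\<lambda>n. qExp (cnj (of_real (q ^ (2 * n)) * z))) \<longlonglongrightarrow> qExp 0"
      using tendsto_cnj[OF lim] by (intro isCont_tendsto_compose[OF isCont_qExp_0]) simp
    moreover have "(\<lambda>n. qexp (- (of_real (q ^ (2 * n)) * z))) \<longlonglongrightarrow> qexp 0"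
      using tendsto_minus[OF lim] by (intro isCont_tendsto_compose[OF isCont_qexp_0]) simp
    ultimately have lim1: "(\<lambda>n. G (of_real (q ^ (2 * n)) * z)) \<longlonglongrightarrow> 1"
      unfolding G_def using tendsto_mult by fastforce
    then have "(\<lambda>n. G z / G (of_real (q ^ (2 * n)) * z)) \<longlonglongrightarrow> G z / 1"
      by (intro tendsto_intros) auto
    moreover have "eventually (\<lambda>n. G (of_real (q ^ (2 * n)) * z) \<noteq> 0) sequentially"
      using lim1 by (rule tendsto_imp_eventually_ne) simp
    then have "eventually (\<lambda>n. G z / G (of_real (q ^ (2 * n)) * z) = (\<Prod>k<n. Fq_factor m u k)) sequentially"
      by eventually_elim (use eqn in \<open>simp add: divide_simps\<close>)
    ultimately show ?thesis
      using G by (auto intro: Lim_transform_eventually)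
  qed
  \<comment> \<open>Each unit of \<open>N\<close> lowers the bound on \<open>m\<close> by one. The
    induction step uses the claim at \<open>m + 2\<close>, which satisfies the previous
    bound.\<close>
  have "(\<lambda>n. \<Prod>k<n. Fq_factor m u k) \<longlonglongrightarrow> Phi m u" if "1 - int N \<le> m" for N m
    using that
  proof (induction N arbitrary: m)
    case (Suc N)
    have "(\<lambda>n. \<Prod>k<n. Fq_factor (m + 2) u k) \<longlonglongrightarrow> Phi (m + 2) u"
      using Suc by simp
    then have "(\<lambda>n. Fq_factor m u 0 * (\<Prod>k<n. Fq_factor (m + 2) u k)) \<longlonglongrightarrow> Fq_factor m u 0 * Phi (m + 2) u"
      by (intro tendsto_intros)
    moreover have "Fq_factor (m + 2) u k = Fq_factor m u (Suc k)" for k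
      by (simp add: Fq_factor_def algebra_simps)
    moreover have "Fq_factor m u 0 * Phi (m + 2) u = Phi m u"
      using Phi_recurrence[OF u(1), of m] one_plus_nonzero[OF u, of m]
      by (simp add: Fq_factor_def field_simps)
    ultimately have "(\<lambda>n. \<Prod>k<Suc n. Fq_factor m u k) \<longlonglongrightarrow> Phi m u"
      unfolding prod.lessThan_Suc_shift by simp
    then show ?case by (rule LIMSEQ_imp_Suc)
  qed (use pos in simp)
  from this[of "nat (1 - m)" m] show ?thesis by linarith
qed

lemma norm_Phi:
  assumes u: "norm u = 1" "u \<noteq> - 1"
  shows "norm (Phi m u) = 1"
proof -
  have "(\<lambda>n. norm (\<Prod>k<n. Fq_factor m u k)) \<longlonglongrightarrow> norm (Phi m u)"
    by (intro tendsto_norm Fq_factor_prod_tendsto u)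
  then show ?thesis
    using LIMSEQ_unique[OF _ tendsto_const] by (simp add: prod_norm[symmetric] norm_Fq_factor[OF u] LIMSEQ_const_iff)
qed

text \<open>All zeros of the denominators have \<open>u = -1\<close>, so the limit in the definition
  of \<open>Fq\<close> does not enter. One point per circle is lost, which is a null set.\<close>

lemma Fq_eq_Phi:
  assumes u: "norm u = 1" "u \<noteq> - 1"
  shows "Fq q (of_real (q powi m) * u) = Phi m u"
proof -
  \<comment> \<open>Convergence in the sense of \<open>has_prod\<close> demands a nonzero
    limit.\<close>
  have nz: "Phi m u \<noteq> 0"
    using norm_Phi[OF u, of m] by auto
  have "(\<lambda>n. \<Prod>k\<le>n. Fq_factor m u k) \<longlonglongrightarrow> Phi m u"
    using LIMSEQ_Suc[OF Fq_factor_prod_tendsto[OF u, of m]] by (simp add: lessThan_Suc_atMost)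
  then have "Fq_factor m u has_prod Phi m u"
    using nz by (simp add: has_prod_def raw_has_prod_def)
  moreover have "Fq_factor m u = (\<lambda>k. (1 + of_real (q ^ (2 * k)) * cnj (of_real (q powi m) * u)) /
      (1 + of_real (q ^ (2 * k)) * (of_real (q powi m) * u)))"
    by (rule ext) (simp only: Fq_factor_def complex_cnj_mult complex_cnj_complex_of_real q_power_double_polar)
  ultimately have "Fq_prod q (of_real (q powi m) * u) = Phi m u"
    unfolding Fq_prod_def using has_prod_unique by metis
  moreover have "of_real (q powi m) * u \<noteq> - of_real (1 / q ^ (2 * k))" for k
  proof
    assume *: "of_real (q powi m) * u = - complex_of_real (1 / q ^ (2 * k))"
    from arg_cong[OF this, of norm] have "q powi m = 1 / q ^ (2 * k)"
      using q_pos u by (simp add: norm_mult norm_power_int norm_power norm_divide)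
    with * have "of_real (q powi m) * u = of_real (q powi m) * (- 1)" by simp
    with u show False by (subst (asm) mult_left_cancel) auto
  qed
  ultimately show ?thesis by (simp add: Fq_def)
qed

lemma Fq_0 [simp]: "Fq q 0 = 1"
  using q_pos by (simp add: Fq_def Fq_prod_def)

end

section \<open>Integration with respect to \<open>\<mu>\<close>\<close>

lemma integrable_count_space_iff:
  fixes f :: "'a \<Rightarrow> 'b :: {banach, second_countable_topology}"
  shows "integrable (count_space A) f \<longleftrightarrow> (\<lambda>x. norm (f x)) summable_on A"
  using abs_summable_equivalent[of f A] by (simp add: Infinite_Set_Sum.abs_summable_on_def)

lemma integral_count_space_has_sum:
  fixes f :: "'a \<Rightarrow> 'b :: {banach, second_countable_topology}"
  assumes "integrable (count_space A) f"
  shows "(f has_sum (\<integral>x. f x \<partial>count_space A)) A"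
proof -
  have "f summable_on A"
    using assms unfolding integrable_count_space_iff by (rule abs_summable_summable)
  moreover have "(\<integral>x. f x \<partial>count_space A) = infsum f A"
    using infsetsum_infsum[of f A] assms
    by (simp add: Infinite_Set_Sum.abs_summable_on_def infsetsum_def)
  ultimately show ?thesis by simp
qed

text \<open>Fubini's theorem for the product of counting measure with \<open>M\<close>; the summable
  bounds \<open>B\<close> give integrability on the product.\<close>

lemma has_sum_integral:
  fixes f :: "'i :: countable \<Rightarrow> 'a \<Rightarrow> complex"
  assumes M: "finite_measure M" and f: "\<And>j. f j \<in> borel_measurable M"
    and B: "\<And>j x. x \<in> space M \<Longrightarrow> norm (f j x) \<le> B j" "B summable_on UNIV"
  shows "((\<lambda>j. \<integral>x. f j x \<partial>M) has_sum (\<integral>x. (\<Sum>\<^sub>\<infinity>j. f j x) \<partial>M)) UNIV"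
proof -
  interpret M: finite_measure M by fact
  interpret P: pair_sigma_finite "count_space (UNIV :: 'i set)" M
    by (intro pair_sigma_finite.intro sigma_finite_measure_count_space_countable
        M.sigma_finite_measure_axioms) auto
  have meas: "(\<lambda>(j, x). f j x) \<in> borel_measurable (count_space UNIV \<Otimes>\<^sub>M M)"
    by (rule measurable_pair_measure_countable1) (use f in auto)
  have int: "integrable M (f j)" for j
    by (rule M.integrable_const_bound[of _ "B j"]) (use B(1) f in \<open>auto intro!: AE_I2\<close>)
  have "(\<lambda>j. norm (\<integral>x. norm (f j x) \<partial>M)) summable_on UNIV"
  proof (rule abs_summable_on_le)
    show "(\<lambda>j. B j * measure M (space M)) summable_on UNIV"
      by (rule summable_on_cmult_left[OF B(2)])
    have "(\<integral>x. norm (f j x) \<partial>M) \<le> (\<integral>x. B j \<partial>M)" for j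
      by (rule integral_mono) (use B(1) int in auto)
    then show "norm (\<integral>x. norm (f j x) \<partial>M) \<le> B j * measure M (space M)" for j
      by (simp add: mult.commute)
  qed
  then have P: "integrable (count_space UNIV \<Otimes>\<^sub>M M) (\<lambda>(j, x). f j x)"
    using int by (intro P.Fubini_integrable meas) (auto simp: integrable_count_space_iff)
  have "((\<lambda>j. \<integral>x. f j x \<partial>M) has_sum (\<integral>j. (\<integral>x. f j x \<partial>M) \<partial>count_space UNIV)) UNIV"
    using P.integrable_fst'[OF P] by (intro integral_count_space_has_sum) simp
  also have "(\<integral>j. (\<integral>x. f j x \<partial>M) \<partial>count_space UNIV) = (\<integral>x. (\<integral>j. f j x \<partial>count_space UNIV) \<partial>M)"
    using P.Fubini_integral[OF P] by simp
  also have "\<dots> = (\<integral>x. (\<Sum>\<^sub>\<infinity>j. f j x) \<partial>M)"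
  proof (rule Bochner_Integration.integral_cong[OF refl])
    fix x assume "x \<in> space M"
    then have "(\<lambda>j. norm (f j x)) summable_on UNIV"
      using abs_summable_on_le[of B UNIV "\<lambda>j. f j x"] B by simp
    then show "(\<integral>j. f j x \<partial>count_space UNIV) = (\<Sum>\<^sub>\<infinity>j. f j x)"
      using integral_count_space_has_sum[of UNIV "\<lambda>j. f j x"]
      by (simp add: integrable_count_space_iff infsumI)
  qed
  finally show ?thesis .
qed

abbreviation circ :: "real measure" where
  "circ \<equiv> uniform_measure lborel {0..2 * pi}"

lemma circ_finite_measure: "finite_measure circ"
  by (rule finite_measureI) (simp add: emeasure_uniform_measure ennreal_divide_eq_top_iff)

interpretation circ: finite_measure circ
  by (rule circ_finite_measure)

lemma measure_circ_UNIV [simp]: "measure circ UNIV = 1"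
  by (simp add: measure_uniform_measure)

lemma integral_cis_powi_circ: "(\<integral>\<phi>. cis \<phi> powi l \<partial>circ) = (if l = 0 then 1 else 0)"
proof (cases "l = 0")
  case False
  have "1 / ennreal (2 * pi) = ennreal (1 / (2 * pi))"
    using divide_ennreal[of 1 "2 * pi"] by simp
  then have d: "circ = density lborel (\<lambda>x. ennreal (indicator {0..2 * pi} x / (2 * pi)))"
    unfolding uniform_measure_def
    by (intro arg_cong2[where f = density] refl ext) (auto split: split_indicator)
  have "(\<integral>\<phi>. cis \<phi> powi l \<partial>circ) = (\<integral>x. (indicator {0..2 * pi} x / (2 * pi)) *\<^sub>R cis (l * x) \<partial>lborel)"
    unfolding d cis_power_int
    by (subst integral_density) (auto intro!: borel_measurable_continuous_onI continuous_intros)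
  also have "\<dots> = (1 / (2 * pi)) *\<^sub>R (cis (l * (2 * pi)) / (\<i> * l) - cis (real_of_int l * 0) / (\<i> * l))"
  proof (rule has_bochner_integral_integral_eq)
    have "((\<lambda>x. cis (l * x) / (\<i> * l)) has_vector_derivative cis (l * x)) (at x within {0..2 * pi})" for x :: real
    proof -
      have "((\<lambda>x. cis (l * x)) has_vector_derivative (l *\<^sub>R (\<i> * cis (l * x)))) (at x within {0..2 * pi})"
        unfolding has_vector_derivative_def
        by (auto intro!: derivative_eq_intros simp: scaleR_conv_of_real mult_ac)
      from has_vector_derivative_divide[OF this, of "\<i> * l"] show ?thesis
        using False by (simp add: scaleR_conv_of_real)
    qed
    then have "has_bochner_integral lborel (\<lambda>x. indicator {0..2 * pi} x *\<^sub>R cis (l * x))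
        (cis (l * (2 * pi)) / (\<i> * l) - cis (real_of_int l * 0) / (\<i> * l))"
      by (intro has_bochner_integral_FTC_Icc[where F = "\<lambda>x. cis (l * x) / (\<i> * l)"])
        (auto intro!: continuous_intros)
    from has_bochner_integral_scaleR_right[OF this, of "1 / (2 * pi)"]
    show "has_bochner_integral lborel (\<lambda>x. (indicator {0..2 * pi} x / (2 * pi)) *\<^sub>R cis (l * x))
        ((1 / (2 * pi)) *\<^sub>R (cis (l * (2 * pi)) / (\<i> * l) - cis (real_of_int l * 0) / (\<i> * l)))"
      by simp
  qed
  also have "cis (l * (2 * pi)) = 1"
    using cis_power_int[of "2 * pi" l] by simp
  finally show ?thesis using False by simp
qed (use circ.finite_measure_axioms in \<open>simp add: measure_def\<close>)

text \<open>The exceptional angles form at most one coset of 2 pi Z. This is how the point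
  \<open>u = -1\<close> is discarded under integrals.\<close>

lemma AE_cis_neq: "AE \<phi> in circ. v * cis \<phi> \<noteq> - 1"
proof -
  have "AE \<phi> in lborel. v * cis \<phi> \<noteq> - 1"
  proof (cases "\<exists>a. v * cis a = - 1")
    case True
    then obtain a where a: "v * cis a = - 1" by blast
    have "AE \<phi> in lborel. \<phi> \<notin> range (\<lambda>n::int. a + 2 * pi * n)"
      by (intro AE_not_in countable_imp_null_set_lborel) auto
    then show ?thesis
    proof eventually_elim
      case (elim \<phi>)
      show ?case
      proof
        assume "v * cis \<phi> = - 1"
        with a have "v * cis \<phi> = v * cis a" "v \<noteq> 0" by auto
        then have "cis \<phi> = cis a" by simp
        then have "sin \<phi> = sin a \<and> cos \<phi> = cos a"
          by (simp add: complex_eq_iff)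
        then obtain n :: int where "\<phi> = a + 2 * pi * n"
          using sin_cos_eq_iff by blast
        with elim show False by auto
      qed
    qed
  qed auto
  then show ?thesis
    by (intro AE_uniform_measureI) auto
qed

context q_parameter
begin

section \<open>The measure mu in polar coordinates\<close>

lemma norm_polar [simp]: "norm (of_real (q powi n) * cis \<phi>) = q powi n"
  using q_pos by (simp add: norm_mult norm_power_int)

lemma Gam_polar: "norm u = 1 \<Longrightarrow> of_real (q powi n) * u \<in> Gam q"
  using q_pos by (auto simp: Gam_def norm_mult norm_power_int)

lemma Gam_polarE:
  assumes "z \<in> Gam q"
  obtains n u where "norm u = 1" "z = of_real (q powi n) * u" "norm z = q powi n"
proof -
  from assms obtain n where n: "norm z = q powi n" by (auto simp: Gam_def)
  have "z = of_real (q powi n) * (z / of_real (q powi n))"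
    by simp
  moreover have "norm (z / of_real (q powi n)) = 1"
    using n q_pos by (simp add: norm_divide norm_power_int)
  ultimately show ?thesis using n that by blast
qed

lemma zero_notin_Gam [simp]: "0 \<notin> Gam q"
  using q_powi_pos by (auto simp: Gam_def)

lemma Gam_subset: "Gam q \<subseteq> Gam_bar q"
  by (auto simp: Gam_bar_def)

lemma space_mu [simp]: "space (mu q) = Gam_bar q"
  by (simp add: mu_def space_restrict_space)

lemma measurable_mu: "measurable (mu q) N = measurable (restrict_space borel (Gam_bar q)) N"
  by (rule measurable_cong_sets) (auto simp: mu_def)

abbreviation weights :: "int measure" where
  "weights \<equiv> density (count_space UNIV) (\<lambda>k. ennreal (q powi (2 * k)))"

lemma polar_measurable:
  "(\<lambda>(k, \<phi>). of_real (q powi k) * cis \<phi>) \<in> measurable (weights \<Otimes>\<^sub>M circ) (restrict_space borel (Gam_bar q))"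
proof (rule measurable_restrict_space2)
  have "sets (weights \<Otimes>\<^sub>M circ) = sets (count_space UNIV \<Otimes>\<^sub>M (borel :: real measure))"
    by (rule sets_pair_measure_cong) auto
  moreover have "(\<lambda>(k, \<phi>). of_real (q powi k) * cis \<phi>) \<in>
      borel_measurable (count_space UNIV \<Otimes>\<^sub>M (borel :: real measure))"
    by (rule measurable_pair_measure_countable1)
      (auto intro!: borel_measurable_continuous_onI continuous_intros)
  ultimately show "(\<lambda>(k, \<phi>). of_real (q powi k) * cis \<phi>) \<in> borel_measurable (weights \<Otimes>\<^sub>M circ)"
    using measurable_cong_sets by blast
qed (use Gam_polar Gam_subset in auto)

lemma weights_sigma_finite: "sigma_finite_measure weights"
proof -
  interpret sigma_finite_measure "count_space (UNIV :: int set)"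
    by (rule sigma_finite_measure_count_space_countable) auto
  show ?thesis
    by (subst sigma_finite_iff_density_finite) auto
qed

sublocale weights_circ: pair_sigma_finite weights circ
  by (intro pair_sigma_finite.intro weights_sigma_finite circ.sigma_finite_measure_axioms)

lemma polar_measurable_section:
  assumes "f \<in> borel_measurable (mu q)"
  shows "(\<lambda>\<phi>. f (of_real (q powi k) * cis \<phi>)) \<in> borel_measurable circ"
proof -
  have "(\<lambda>\<phi>. of_real (q powi k) * cis \<phi>) \<in> measurable circ (restrict_space borel (Gam_bar q))"
  proof (rule measurable_restrict_space2)
    have "(\<lambda>\<phi>. of_real (q powi k) * cis \<phi>) \<in> borel_measurable borel"
      by (auto intro!: borel_measurable_continuous_onI continuous_intros)
    then show "(\<lambda>\<phi>. of_real (q powi k) * cis \<phi>) \<in> borel_measurable circ"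
      using measurable_cong_sets[of circ borel] by auto
  qed (use Gam_polar Gam_subset in auto)
  then show ?thesis
    using assms unfolding measurable_mu by (rule measurable_compose)
qed

lemma integrable_weights_iff:
  fixes f :: "int \<Rightarrow> 'b :: {banach, second_countable_topology}"
  shows "integrable weights f \<longleftrightarrow> (\<lambda>k. norm (q powi (2 * k) *\<^sub>R f k)) summable_on UNIV"
  by (subst integrable_density) (auto simp: less_imp_le integrable_count_space_iff)

lemma integral_mu_has_sum:
  fixes f :: "complex \<Rightarrow> 'b :: {banach, second_countable_topology}"
  assumes f: "integrable (mu q) f"
  shows "((\<lambda>k. q powi (2 * k) *\<^sub>R (\<integral>\<phi>. f (of_real (q powi k) * cis \<phi>) \<partial>circ)) has_sum (\<integral>z. f z \<partial>mu q)) UNIV"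
proof -
  define g where "g x = f (case x of (k, \<phi>) \<Rightarrow> of_real (q powi k) * cis \<phi>)" for x :: "int \<times> real"
  have fm: "f \<in> borel_measurable (restrict_space borel (Gam_bar q))"
    using borel_measurable_integrable[OF f] by (simp add: measurable_mu)
  have g: "integrable (weights \<Otimes>\<^sub>M circ) g"
    using f unfolding mu_def g_def by (subst (asm) integrable_distr_eq[OF polar_measurable fm])
  have "(\<integral>z. f z \<partial>mu q) = (\<integral>x. g x \<partial>(weights \<Otimes>\<^sub>M circ))"
    unfolding mu_def g_def by (rule integral_distr[OF polar_measurable fm])
  also have "\<dots> = (\<integral>k. (\<integral>\<phi>. g (k, \<phi>) \<partial>circ) \<partial>weights)"
    by (rule weights_circ.integral_fst'[OF g, symmetric])
  also have "\<dots> = (\<integral>k. q powi (2 * k) *\<^sub>R (\<integral>\<phi>. g (k, \<phi>) \<partial>circ) \<partial>count_space UNIV)"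
    by (rule integral_density) (auto simp: less_imp_le)
  finally have e: "(\<integral>z. f z \<partial>mu q) = \<dots>" .
  have "integrable weights (\<lambda>k. \<integral>\<phi>. g (k, \<phi>) \<partial>circ)"
    by (rule weights_circ.integrable_fst'[OF g])
  then have "integrable (count_space UNIV) (\<lambda>k. q powi (2 * k) *\<^sub>R (\<integral>\<phi>. g (k, \<phi>) \<partial>circ))"
    by (simp add: integrable_weights_iff integrable_count_space_iff)
  from integral_count_space_has_sum[OF this] show ?thesis
    unfolding e by (simp add: g_def)
qed

text \<open>Fubini's theorem on the product of the integers with the circle. The bound is asked only
  for almost every angle because F_q is controlled only off \<open>u = -1\<close>.\<close>

lemma integrable_muI:
  fixes f :: "complex \<Rightarrow> 'b :: {banach, second_countable_topology}"
  assumes f: "f \<in> borel_measurable (mu q)"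
    and B: "\<And>k. AE \<phi> in circ. norm (f (of_real (q powi k) * cis \<phi>)) \<le> B k"
    and sum: "(\<lambda>k. q powi (2 * k) * B k) summable_on UNIV"
  shows "integrable (mu q) f"
proof -
  define g where "g x = f (case x of (k, \<phi>) \<Rightarrow> of_real (q powi k) * cis \<phi>)" for x :: "int \<times> real"
  have fm: "f \<in> borel_measurable (restrict_space borel (Gam_bar q))"
    using f by (simp add: measurable_mu)
  have gm: "g \<in> borel_measurable (weights \<Otimes>\<^sub>M circ)"
    unfolding g_def by (rule measurable_compose[OF polar_measurable fm])
  have int: "integrable circ (\<lambda>\<phi>. g (k, \<phi>))" for k
    using polar_measurable_section[OF f, of k] B[of k]
    by (intro circ.integrable_const_bound[of _ "B k"]) (auto simp: g_def)
  have bound: "(\<integral>\<phi>. norm (g (k, \<phi>)) \<partial>circ) \<le> B k" for k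
  proof -
    have "(\<integral>\<phi>. norm (g (k, \<phi>)) \<partial>circ) \<le> (\<integral>\<phi>. B k \<partial>circ)"
      using B[of k] by (intro integral_mono_AE integrable_norm int) (auto simp: g_def)
    then show ?thesis by simp
  qed
  have "integrable (weights \<Otimes>\<^sub>M circ) g"
  proof (rule weights_circ.Fubini_integrable[OF gm])
    have "(\<lambda>k. norm (q powi (2 * k) *\<^sub>R (\<integral>\<phi>. norm (g (k, \<phi>)) \<partial>circ))) summable_on UNIV"
      using sum by (rule abs_summable_on_le)
        (simp add: abs_mult abs_of_pos abs_of_nonneg bound mult_left_mono less_imp_le)
    then show "integrable weights (\<lambda>k. \<integral>\<phi>. norm (g (k, \<phi>)) \<partial>circ)"
      unfolding integrable_weights_iff .
  qed (use int in auto)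
  then show ?thesis
    unfolding mu_def g_def by (subst integrable_distr_eq[OF polar_measurable fm])
qed

text \<open>A single angular frequency with a real radial profile. The g_kl and their transforms
  have this form, shifts keep it and the derivatives move the frequency by one, so that analysis on
  Gamma becomes a computation with real sequences. The value at 0 is left open and is supplied where
  continuity is at stake.\<close>

definition angular :: "int \<Rightarrow> (int \<Rightarrow> real) \<Rightarrow> (complex \<Rightarrow> complex) \<Rightarrow> bool" where
  "angular l c f \<longleftrightarrow> (\<forall>n u. norm u = 1 \<longrightarrow> f (of_real (q powi n) * u) = of_real (c n) * u powi l)"

lemma angularD: "angular l c f \<Longrightarrow> norm u = 1 \<Longrightarrow> f (of_real (q powi n) * u) = of_real (c n) * u powi l"
  by (auto simp: angular_def)

text \<open>The radii q^n accumulate only at 0, so each circle is open in the closure of Gamma.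
  Continuity then splits into continuity on every circle and one limit at 0.\<close>

lemma circle_neighbourhood:
  assumes "norm z = q powi n"
  shows "eventually (\<lambda>w. norm w = q powi n) (at z within Gam_bar q)"
proof -
  have "eventually (\<lambda>w. norm w > q powi (n + 1)) (at z within Gam_bar q)"
    using assms power_int_strict_decreasing[of n "n + 1" q] q_pos q_less_1
    by (intro order_tendstoD(1)[of _ "norm z"] tendsto_intros) auto
  moreover have "eventually (\<lambda>w. norm w < q powi (n - 1)) (at z within Gam_bar q)"
    using assms power_int_strict_decreasing[of "n - 1" n q] q_pos q_less_1
    by (intro order_tendstoD(2)[of _ "norm z"] tendsto_intros) auto
  moreover have "eventually (\<lambda>w. w \<in> Gam_bar q) (at z within Gam_bar q)"
    by (auto simp: eventually_at_filter)
  ultimately show ?thesis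
  proof eventually_elim
    case (elim w)
    then have "w \<noteq> 0" using q_powi_pos[of "n + 1"] by (metis less_asym norm_zero)
    with elim obtain m where m: "norm w = q powi m"
      by (auto simp: Gam_bar_def Gam_def)
    have "m < n + 1" "n - 1 < m"
      using elim m power_int_decreasing[of "n + 1" m q] power_int_decreasing[of m "n - 1" q] q_pos q_less_1
      by (auto simp: not_less[symmetric])
    then have "m = n" by simp
    with m show ?case by simp
  qed
qed

lemma continuous_on_Gam_bar_iff:
  fixes f :: "complex \<Rightarrow> complex"
  shows "continuous_on (Gam_bar q) f \<longleftrightarrow>
    (f \<longlongrightarrow> f 0) (at 0 within Gam q) \<and> (\<forall>n. continuous_on {z. norm z = q powi n} f)"
proof (intro iffI conjI allI)
  assume f: "continuous_on (Gam_bar q) f"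
  then have "(f \<longlongrightarrow> f 0) (at 0 within Gam_bar q)"
    by (auto simp: continuous_on_def Gam_bar_def)
  then show "(f \<longlongrightarrow> f 0) (at 0 within Gam q)"
    using Gam_subset by (rule tendsto_within_subset)
  show "continuous_on {z. norm z = q powi n} f" for n
    using f by (rule continuous_on_subset) (auto simp: Gam_bar_def Gam_def)
next
  assume f: "(f \<longlongrightarrow> f 0) (at 0 within Gam q) \<and> (\<forall>n. continuous_on {z. norm z = q powi n} f)"
  show "continuous_on (Gam_bar q) f"
    unfolding continuous_on_def
  proof
    fix z assume z: "z \<in> Gam_bar q"
    show "(f \<longlongrightarrow> f z) (at z within Gam_bar q)"
    proof (cases "z = 0")
      case True
      then show ?thesis
        using f by (simp add: Gam_bar_def at_within_def)
    next
      case False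
      with z obtain n where n: "norm z = q powi n"
        by (auto simp: Gam_bar_def Gam_def)
      have lim: "(f \<longlongrightarrow> f z) (at z within {w. norm w = q powi n})"
        using f n by (auto simp: continuous_on_def)
      have ev: "eventually (\<lambda>w. w \<in> {w. norm w = q powi n} \<longleftrightarrow> w \<in> Gam_bar q) (at z)"
        using circle_neighbourhood[OF n] unfolding eventually_at_filter
        by eventually_elim (auto simp: Gam_bar_def Gam_def)
      show ?thesis
        by (rule Lim_transform_within_set[OF lim ev])
    qed
  qed
qed

text \<open>A nonzero frequency has a limit at 0 only if its profile tends to 0, whence the two
  cases.\<close>

lemma angular_tendsto_0:
  assumes f: "angular l c f" and c: "(\<lambda>n. c (int n)) \<longlonglongrightarrow> (if l = 0 then a else 0)"
  shows "(f \<longlongrightarrow> of_real (if l = 0 then a else 0)) (at 0 within Gam q)"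
proof (rule tendstoI)
  fix e :: real assume "0 < e"
  with c obtain N where N: "\<And>n. n \<ge> N \<Longrightarrow> dist (c (int n)) (if l = 0 then a else 0) < e"
    using tendstoD[OF c] by (auto simp: eventually_sequentially)
  have "eventually (\<lambda>z. norm z < q ^ N) (at 0 within Gam q)"
    using q_pos by (intro order_tendstoD(2)[of _ "norm (0 :: complex)"] tendsto_intros) auto
  moreover have "eventually (\<lambda>w. w \<in> Gam q) (at 0 within Gam q)"
    by (auto simp: eventually_at_filter)
  ultimately show "eventually (\<lambda>z. dist (f z) (of_real (if l = 0 then a else 0)) < e) (at 0 within Gam q)"
  proof eventually_elim
    case (elim z)
    obtain n u where u: "norm u = 1" "z = of_real (q powi n) * u" "norm z = q powi n"
      using Gam_polarE[OF elim(2)] .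
    have n: "int N < n"
      using elim u power_int_decreasing[of n "int N" q] q_pos q_less_1
      by (auto simp: not_less[symmetric])
    have "norm (of_real (c n) - complex_of_real (if l = 0 then a else 0)) = dist (c n) (if l = 0 then a else 0)"
      by (metis dist_norm norm_of_real of_real_diff real_norm_def)
    moreover have "dist (c n) (if l = 0 then a else 0) < e"
      using N[of "nat n"] n by simp
    moreover have "dist (f z) (of_real (if l = 0 then a else 0)) =
        norm (of_real (c n) - complex_of_real (if l = 0 then a else 0))"
      using angularD[OF f u(1), of n] u by (simp add: dist_norm norm_mult norm_power_int)
    ultimately show ?case by simp
  qed
qed

lemma angular_continuous_circle:
  assumes "angular l c f"
  shows "continuous_on {z. norm z = q powi n} f"
proof -
  have "continuous_on {z. norm z = q powi n} (\<lambda>z. complex_of_real (c n) * (z / of_real (q powi n)) powi l)"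
    by (intro continuous_intros) (use q_powi_pos[of n] in auto)
  moreover have "f z = of_real (c n) * (z / of_real (q powi n)) powi l" if "norm z = q powi n" for z
    using angularD[OF assms, of "z / of_real (q powi n)" n] that q_pos
    by (simp add: norm_divide norm_power_int)
  ultimately show ?thesis by (auto elim!: continuous_on_eq)
qed

lemma angular_continuous:
  assumes "angular l c f" "(\<lambda>n. c (int n)) \<longlonglongrightarrow> (if l = 0 then a else 0)"
    and "f 0 = of_real (if l = 0 then a else 0)"
  shows "continuous_on (Gam_bar q) f"
  unfolding continuous_on_Gam_bar_iff assms(3)
  using angular_tendsto_0[OF assms(1,2)] angular_continuous_circle[OF assms(1)] by blast

lemma continuous_on_measurable_mu:
  "continuous_on (Gam_bar q) f \<Longrightarrow> f \<in> borel_measurable (mu q)"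
  unfolding measurable_mu by (rule borel_measurable_continuous_on_restrict)

lemma angular_gkl: "angular l (\<lambda>n. if n = k then 1 else 0) (gkl q k l)"
  unfolding angular_def
proof (intro allI impI)
  fix n and u :: complex assume u: "norm u = 1"
  have "u \<noteq> 0" using u by auto
  then have "of_real (q powi n) * u \<noteq> 0" using q_pos by simp
  then have "cis (Arg (of_real (q powi n) * u)) = u"
    using u q_pos by (subst cis_Arg) (auto simp: sgn_eq norm_mult norm_power_int)
  then have "cis (of_int l * Arg (of_real (q powi n) * u)) = u powi l"
    by (metis cis_power_int)
  moreover have "norm (of_real (q powi n) * u) = q powi n"
    using u q_pos by (simp add: norm_mult norm_power_int)
  ultimately show "gkl q k l (of_real (q powi n) * u) = of_real (if n = k then 1 else 0) * u powi l"
    by (cases "n = k") (simp_all add: gkl_def)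
qed

lemma gkl_0 [simp]: "gkl q k l 0 = 0"
  using q_powi_pos[of k] by (simp add: gkl_def)

lemma continuous_on_gkl: "continuous_on (Gam_bar q) (gkl q k l)"
proof (rule angular_continuous[OF angular_gkl, of _ _ 0])
  have "eventually (\<lambda>n. (if int n = k then 1 else 0) = (0 :: real)) sequentially"
    by (rule eventually_sequentiallyI[of "nat k + 1"]) auto
  then show "(\<lambda>n. if int n = k then 1 else 0 :: real) \<longlonglongrightarrow> (if l = 0 then 0 else 0)"
    using tendsto_eventually by auto
qed simp

text \<open>Off the countably many points -q^m, F_q is the pointwise limit of its partial products,
  and a change at countably many points preserves measurability. The values assigned by continuity
  are covered in this way.\<close>

lemma Fq_measurable: "Fq q \<in> borel_measurable (mu q)"
proof -
  define P where "P n z = (\<Prod>k<n. (1 + of_real (q ^ (2 * k)) * cnj z) / (1 + of_real (q ^ (2 * k)) * z))"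
    for n and z :: complex
  have P: "P n \<in> borel_measurable borel" for n
    unfolding P_def
    by (intro borel_measurable_prod borel_measurable_divide borel_measurable_continuous_onI continuous_intros)
  have "(\<lambda>z. lim (\<lambda>n. P n z)) \<in> borel_measurable borel"
    by (rule borel_measurable_lim_metric) (rule P)
  then have L: "(\<lambda>z. lim (\<lambda>n. P n z)) \<in> borel_measurable (restrict_space borel (Gam_bar q))"
    by (rule measurable_restrict_space1)
  show ?thesis
    unfolding measurable_mu
  proof (rule measurable_discrete_difference[OF L])
    define X where "X = range (\<lambda>m::int. - complex_of_real (q powi m))"
    show "countable X" by (simp add: X_def)
    show "{x} \<in> sets (restrict_space borel (Gam_bar q))" if "x \<in> X" for x
    proof -
      have "x \<in> Gam_bar q"
        using that Gam_polar[of "-1"] Gam_subset by (auto simp: X_def)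
      then have "{x} = Gam_bar q \<inter> {x}" by auto
      then show ?thesis
        by (auto simp: sets_restrict_space)
    qed
    fix z assume z: "z \<in> space (restrict_space borel (Gam_bar q))" "z \<notin> X"
    have "(\<lambda>n. P n z) \<longlonglongrightarrow> Fq q z"
    proof (cases "z = 0")
      case True
      then show ?thesis by (simp add: P_def)
    next
      case False
      with z have "z \<in> Gam q" by (auto simp: space_restrict_space Gam_bar_def)
      then obtain n u where u: "norm u = 1" "z = of_real (q powi n) * u"
        using Gam_polarE by blast
      with z have u1: "u \<noteq> - 1" by (auto simp: X_def)
      have "P m z = (\<Prod>k<m. Fq_factor n u k)" for m
        unfolding P_def u(2) Fq_factor_def
        by (simp only: complex_cnj_mult complex_cnj_complex_of_real q_power_double_polar)
      then show ?thesis
        using Fq_factor_prod_tendsto[OF u(1) u1, of n] Fq_eq_Phi[OF u(1) u1, of n] u by simp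
    qed
    then show "lim (\<lambda>n. P n z) = Fq q z" by (rule limI)
  qed auto
qed

section \<open>The kernel on a single circle\<close>

lemma Gam_bar_mult:
  assumes "\<zeta> \<in> Gam_bar q" "z \<in> Gam_bar q"
  shows "\<zeta> * z \<in> Gam_bar q"
proof (cases "\<zeta> = 0 \<or> z = 0")
  case True
  then show ?thesis by (auto simp: Gam_bar_def)
next
  case False
  with assms obtain m n where "norm \<zeta> = q powi m" "norm z = q powi n"
    by (auto simp: Gam_bar_def Gam_def)
  then have "norm (\<zeta> * z) = q powi (m + n)"
    by (simp add: norm_mult q_powi_add)
  then show ?thesis by (auto simp: Gam_bar_def Gam_def)
qed

lemma Fq_kernel_measurable:
  assumes "\<zeta> \<in> Gam_bar q"
  shows "(\<lambda>z. Fq q (\<zeta> * z)) \<in> borel_measurable (mu q)"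
proof -
  have "(\<lambda>z. \<zeta> * z) \<in> measurable (restrict_space borel (Gam_bar q)) (restrict_space borel (Gam_bar q))"
  proof (rule measurable_restrict_space2)
    have "(\<lambda>z. \<zeta> * z) \<in> borel_measurable borel"
      by (auto intro!: borel_measurable_continuous_onI continuous_intros)
    then show "(\<lambda>z. \<zeta> * z) \<in> borel_measurable (restrict_space borel (Gam_bar q))"
      by (rule measurable_restrict_space1)
  qed (use Gam_bar_mult assms in \<open>auto simp: space_restrict_space\<close>)
  from measurable_compose[OF this] show ?thesis
    using Fq_measurable unfolding measurable_mu by blast
qed

lemma AE_Fq_eq_Phi:
  assumes "norm v = 1"
  shows "AE \<phi> in circ. Fq q (of_real (q powi m) * (v * cis \<phi>)) = Phi m (v * cis \<phi>) \<and>
    norm (Fq q (of_real (q powi m) * (v * cis \<phi>))) = 1"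
  using AE_cis_neq[of v]
proof eventually_elim
  case (elim \<phi>)
  have "norm (v * cis \<phi>) = 1" using assms by (simp add: norm_mult)
  with elim show ?case using Fq_eq_Phi norm_Phi by simp
qed

lemma Fq_section_measurable:
  assumes "norm v = 1"
  shows "(\<lambda>\<phi>. Fq q (of_real (q powi m) * (v * cis \<phi>))) \<in> borel_measurable circ"
proof -
  have "v \<in> Gam_bar q"
    using Gam_polar[OF assms, of 0] Gam_subset by auto
  from polar_measurable_section[OF Fq_kernel_measurable[OF this], of m]
  show ?thesis by (simp add: mult.left_commute)
qed

lemma cis_powi_measurable: "(\<lambda>\<phi>. cis \<phi> powi l) \<in> borel_measurable circ"
proof -
  have "(\<lambda>\<phi>. cis \<phi> powi l) \<in> borel_measurable borel"
    by (intro borel_measurable_continuous_onI continuous_intros) auto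
  then show ?thesis
    using measurable_cong_sets[of circ borel] by auto
qed

text \<open>The Fourier series is integrated term by term under the bounds |\<open>qJ j m\<close>|,
  and only \<open>j = - l\<close> survives. For measurability the series is written as a limit of
  partial sums along an enumeration of the integers.\<close>

lemma
  assumes v: "norm v = 1"
  shows integral_Phi_circ:
      "(\<integral>\<phi>. Phi m (v * cis \<phi>) * cis \<phi> powi l \<partial>circ) = of_real (qJ (- l) m) * v powi (- l)"
    and Phi_section_measurable: "(\<lambda>\<phi>. Phi m (v * cis \<phi>)) \<in> borel_measurable circ"
proof -
  define f where "f l j \<phi> = of_real (qJ j m) * v powi j * cis \<phi> powi (j + l)" for l j \<phi>
  have f: "f l j \<in> borel_measurable circ" for l j
    unfolding f_def by (intro borel_measurable_times cis_powi_measurable) auto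
  have sum: "((\<lambda>j. f l j \<phi>) has_sum Phi m (v * cis \<phi>) * cis \<phi> powi l) UNIV" for l \<phi>
  proof -
    have "((\<lambda>j. of_real (qJ j m) * (v * cis \<phi>) powi j * cis \<phi> powi l) has_sum Phi m (v * cis \<phi>) * cis \<phi> powi l) UNIV"
      using v by (intro has_sum_cmult_left Phi_has_sum) (simp add: norm_mult)
    then show ?thesis
      by (simp add: f_def power_int_mult_distrib power_int_add mult_ac)
  qed
  have "((\<lambda>j. \<integral>\<phi>. f l j \<phi> \<partial>circ) has_sum (\<integral>\<phi>. (\<Sum>\<^sub>\<infinity>j. f l j \<phi>) \<partial>circ)) UNIV"
    using summable_qJ[of m] v
    by (intro has_sum_integral[where B = "\<lambda>j. \<bar>qJ j m\<bar>"] circ_finite_measure f)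
      (auto simp: f_def norm_mult norm_power_int)
  moreover have "(\<integral>\<phi>. f l j \<phi> \<partial>circ) = (if j = - l then of_real (qJ (- l) m) * v powi (- l) else 0)" for j
    unfolding f_def by (simp add: integral_cis_powi_circ add_eq_0_iff2)
  ultimately have "((\<lambda>j. if j = - l then of_real (qJ (- l) m) * v powi (- l) else 0) has_sum
      (\<integral>\<phi>. (\<Sum>\<^sub>\<infinity>j. f l j \<phi>) \<partial>circ)) UNIV"
    by simp
  moreover have "((\<lambda>j. if j = - l then of_real (qJ (- l) m) * v powi (- l) else 0) has_sum
      of_real (qJ (- l) m) * v powi (- l)) UNIV"
    by (rule has_sum_finite_neutralI[of "{- l}"]) auto
  ultimately have "(\<integral>\<phi>. (\<Sum>\<^sub>\<infinity>j. f l j \<phi>) \<partial>circ) = of_real (qJ (- l) m) * v powi (- l)"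
    by (rule has_sum_unique)
  then show "(\<integral>\<phi>. Phi m (v * cis \<phi>) * cis \<phi> powi l \<partial>circ) = of_real (qJ (- l) m) * v powi (- l)"
    unfolding infsumI[OF sum] .
  have "(\<lambda>\<phi>. lim (\<lambda>n. \<Sum>j<n. f 0 (int_decode j) \<phi>)) \<in> borel_measurable circ"
    by (rule borel_measurable_lim_metric) (intro borel_measurable_sum f)
  moreover have "lim (\<lambda>n. \<Sum>j<n. f 0 (int_decode j) \<phi>) = Phi m (v * cis \<phi>)" for \<phi>
  proof -
    have "((\<lambda>n. f 0 (int_decode n) \<phi>) has_sum Phi m (v * cis \<phi>)) UNIV"
      using has_sum_reindex_bij_betw[OF bij_int_decode, of "\<lambda>j. f 0 j \<phi>"] sum[of 0 \<phi>] by simp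
    then show ?thesis
      by (rule limI[OF has_sum_imp_sums[unfolded sums_def]])
  qed
  ultimately show "(\<lambda>\<phi>. Phi m (v * cis \<phi>)) \<in> borel_measurable circ" by simp
qed

lemma integral_Fq_circ:
  assumes v: "norm v = 1"
  shows "(\<integral>\<phi>. Fq q (of_real (q powi m) * (v * cis \<phi>)) * cis \<phi> powi l \<partial>circ) = of_real (qJ (- l) m) * v powi (- l)"
  unfolding integral_Phi_circ[OF v, symmetric]
proof (rule integral_cong_AE)
  show "AE \<phi> in circ. Fq q (of_real (q powi m) * (v * cis \<phi>)) * cis \<phi> powi l = Phi m (v * cis \<phi>) * cis \<phi> powi l"
    using AE_Fq_eq_Phi[OF v, of m] by eventually_elim simp
qed (intro borel_measurable_times Fq_section_measurable Phi_section_measurable v cis_powi_measurable)+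

end

context q_parameter
begin

section \<open>The functions \<open>\<F> g\<^sub>k\<^sub>l\<close>\<close>

lemma AE_norm_Fq:
  assumes "norm v = 1"
  shows "AE \<phi> in circ. norm (Fq q (of_real (q powi m) * (v * cis \<phi>))) = 1"
  using AE_Fq_eq_Phi[OF assms, of m] by (rule eventually_mono) blast

lemma Phi_tendsto_1:
  assumes u: "norm u = 1"
  shows "(\<lambda>n. Phi (int n) u) \<longlonglongrightarrow> 1"
proof -
  have lim: "(\<lambda>n. of_real (q powi int n) * u) \<longlonglongrightarrow> 0"
  proof -
    have "(\<lambda>n. of_real (q ^ n) * u) \<longlonglongrightarrow> of_real 0 * u"
      by (intro tendsto_intros q_power_tendsto_0)
    then show ?thesis by simp
  qed
  have "(\<lambda>n. qExp (cnj (of_real (q powi int n) * u))) \<longlonglongrightarrow> qExp 0"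
    using tendsto_cnj[OF lim] by (intro isCont_tendsto_compose[OF isCont_qExp_0]) simp
  moreover have "(\<lambda>n. qexp (- (of_real (q powi int n) * u))) \<longlonglongrightarrow> qexp 0"
    using tendsto_minus[OF lim] by (intro isCont_tendsto_compose[OF isCont_qexp_0]) simp
  ultimately have "(\<lambda>n. qExp (cnj (of_real (q powi int n) * u)) * qexp (- (of_real (q powi int n) * u))) \<longlonglongrightarrow> 1"
    using tendsto_mult by fastforce
  moreover have "eventually (\<lambda>n. qExp (cnj (of_real (q powi int n) * u)) * qexp (- (of_real (q powi int n) * u))
      = Phi (int n) u) sequentially"
    by (rule eventually_sequentiallyI[of 1], rule has_sum_unique[OF qExp_mult_qexp_has_sum Phi_has_sum])
      (use u in auto)
  ultimately show ?thesis by (rule Lim_transform_eventually)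
qed

text \<open>These are Fourier coefficients on shrinking circles, where \<open>Phi\<close> tends to 1
  pointwise; |Phi| = 1 almost everywhere provides the dominating function.\<close>

lemma qJ_tendsto_nat: "(\<lambda>n. qJ l (int n)) \<longlonglongrightarrow> (if l = 0 then 1 else 0)"
proof -
  have "(\<lambda>n. \<integral>\<phi>. Phi (int n) (1 * cis \<phi>) * cis \<phi> powi (- l) \<partial>circ) \<longlonglongrightarrow> (\<integral>\<phi>. cis \<phi> powi (- l) \<partial>circ)"
  proof (rule integral_dominated_convergence[where w = "\<lambda>_. 1"])
    show "AE \<phi> in circ. (\<lambda>n. Phi (int n) (1 * cis \<phi>) * cis \<phi> powi (- l)) \<longlonglongrightarrow> cis \<phi> powi (- l)"
    proof (rule AE_I2)
      fix \<phi> show "(\<lambda>n. Phi (int n) (1 * cis \<phi>) * cis \<phi> powi (- l)) \<longlonglongrightarrow> cis \<phi> powi (- l)"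
        using tendsto_mult_right[OF Phi_tendsto_1[of "cis \<phi>"], of "cis \<phi> powi (- l)"] by simp
    qed
    show "AE \<phi> in circ. norm (Phi (int n) (1 * cis \<phi>) * cis \<phi> powi (- l)) \<le> 1" for n
      using AE_cis_neq[of 1] by eventually_elim (simp add: norm_mult norm_power_int norm_Phi)
  qed (use Phi_section_measurable[of 1] in \<open>auto intro!: borel_measurable_times cis_powi_measurable\<close>)
  then have "(\<lambda>n. complex_of_real (qJ l (int n))) \<longlonglongrightarrow> of_real (if l = 0 then 1 else 0)"
    by (subst (asm) integral_Phi_circ) (auto simp: integral_cis_powi_circ)
  then show ?thesis by (rule tendsto_of_real_iff[THEN iffD1])
qed

lemma qJ_tendsto: "(\<lambda>n. qJ l (int n + k)) \<longlonglongrightarrow> (if l = 0 then 1 else 0)"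
proof (cases "0 \<le> k")
  case True
  then show ?thesis
    using LIMSEQ_ignore_initial_segment[OF qJ_tendsto_nat, of l "nat k"] by simp
next
  case False
  have "(\<lambda>n. qJ l (int (n + nat (- k)) + k)) \<longlonglongrightarrow> (if l = 0 then 1 else 0)"
    using qJ_tendsto_nat[of l] False by simp
  then show ?thesis by (rule LIMSEQ_offset)
qed

text \<open>The Fourier coefficients of |Phi|^2, which is 1 almost everywhere: the conjugated factor
  is expanded into its series, and each term integrates to a product of two coefficients.\<close>

lemma qJ_orthogonal_shift: "((\<lambda>j. qJ j m * qJ (j + r) m) has_sum (if r = 0 then 1 else 0)) UNIV"
proof -
  define C where "C = (\<Sum>\<^sub>\<infinity>l. \<bar>qJ l m\<bar>)"
  have C: "norm (Phi m (cis \<phi>)) \<le> C" for \<phi>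
  proof -
    have "(\<lambda>l. norm (of_real (qJ l m) * cis \<phi> powi l)) summable_on UNIV"
      using summable_qJ by (simp add: norm_mult norm_power_int)
    from norm_infsum_bound[OF this] show ?thesis
      by (simp add: Phi_def C_def norm_mult norm_power_int)
  qed
  define f where "f j \<phi> = of_real (qJ j m) * (Phi m (1 * cis \<phi>) * cis \<phi> powi (- (j + r)))" for j \<phi>
  have "((\<lambda>j. \<integral>\<phi>. f j \<phi> \<partial>circ) has_sum (\<integral>\<phi>. (\<Sum>\<^sub>\<infinity>j. f j \<phi>) \<partial>circ)) UNIV"
  proof (rule has_sum_integral[OF circ_finite_measure])
    show "f j \<in> borel_measurable circ" for j
      unfolding f_def by (intro borel_measurable_times Phi_section_measurable cis_powi_measurable) auto
    show "norm (f j \<phi>) \<le> \<bar>qJ j m\<bar> * C" for j \<phi>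
      unfolding f_def using C[of \<phi>] by (simp add: norm_mult norm_power_int mult_left_mono)
    show "(\<lambda>j. \<bar>qJ j m\<bar> * C) summable_on UNIV"
      by (rule summable_on_cmult_left[OF summable_qJ])
  qed
  moreover have "(\<integral>\<phi>. f j \<phi> \<partial>circ) = of_real (qJ j m * qJ (j + r) m)" for j
    unfolding f_def using integral_Phi_circ[of 1 m "- (j + r)"] by (simp add: add.commute)
  moreover have "(\<integral>\<phi>. (\<Sum>\<^sub>\<infinity>j. f j \<phi>) \<partial>circ) = of_real (if r = 0 then 1 else 0)"
  proof -
    have sum: "(\<Sum>\<^sub>\<infinity>j. f j \<phi>) = Phi m (1 * cis \<phi>) * cnj (Phi m (1 * cis \<phi>)) * cis \<phi> powi (- r)" for \<phi>
    proof (rule infsumI)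
      have "((\<lambda>j. cnj (of_real (qJ j m) * (1 * cis \<phi>) powi j)) has_sum cnj (Phi m (1 * cis \<phi>))) UNIV"
        by (subst has_sum_cnj_iff) (rule Phi_has_sum, simp)
      then have "((\<lambda>j. Phi m (1 * cis \<phi>) * cnj (of_real (qJ j m) * (1 * cis \<phi>) powi j) * cis \<phi> powi (- r))
          has_sum Phi m (1 * cis \<phi>) * cnj (Phi m (1 * cis \<phi>)) * cis \<phi> powi (- r)) UNIV"
        by (intro has_sum_cmult_left has_sum_cmult_right)
      moreover have "Phi m (1 * cis \<phi>) * cnj (of_real (qJ j m) * (1 * cis \<phi>) powi j) * cis \<phi> powi (- r) = f j \<phi>" for j
        using cnj_unit_powi[of "cis \<phi>" j] by (simp add: f_def power_int_add power_int_diff power_int_minus field_simps)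
      ultimately show "((\<lambda>j. f j \<phi>) has_sum Phi m (1 * cis \<phi>) * cnj (Phi m (1 * cis \<phi>)) * cis \<phi> powi (- r)) UNIV"
        by simp
    qed
    have "(\<integral>\<phi>. (\<Sum>\<^sub>\<infinity>j. f j \<phi>) \<partial>circ) = (\<integral>\<phi>. cis \<phi> powi (- r) \<partial>circ)"
      unfolding sum
    proof (rule integral_cong_AE)
      show "AE \<phi> in circ. Phi m (1 * cis \<phi>) * cnj (Phi m (1 * cis \<phi>)) * cis \<phi> powi (- r) = cis \<phi> powi (- r)"
        using AE_cis_neq[of 1]
      proof eventually_elim
        case (elim \<phi>)
        then have "Phi m (1 * cis \<phi>) * cnj (Phi m (1 * cis \<phi>)) = 1"
          using norm_Phi[of "1 * cis \<phi>" m] by (simp flip: complex_norm_square)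
        then show ?case by simp
      qed
      have P: "(\<lambda>\<phi>. Phi m (1 * cis \<phi>)) \<in> borel_measurable circ"
        by (rule Phi_section_measurable) simp
      have "(\<lambda>\<phi>. cnj (Phi m (1 * cis \<phi>))) \<in> borel_measurable circ"
        by (rule measurable_compose[OF P]) (intro borel_measurable_continuous_onI continuous_intros)
      then show "(\<lambda>\<phi>. Phi m (1 * cis \<phi>) * cnj (Phi m (1 * cis \<phi>)) * cis \<phi> powi (- r)) \<in> borel_measurable circ"
        by (intro borel_measurable_times P cis_powi_measurable)
    qed (rule cis_powi_measurable)
    then show ?thesis by (simp add: integral_cis_powi_circ)
  qed
  ultimately have "((\<lambda>j. complex_of_real (qJ j m * qJ (j + r) m)) has_sum of_real (if r = 0 then 1 else 0)) UNIV"
    by simp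
  then show ?thesis
    by (rule has_sum_of_real_iff[THEN iffD1])
qed

text \<open>The matrix coefficients of \<open>q\<^sup>-\<^sup>1 \<F> \<sigma>\<^sub>i\<close>: with \<open>e\<^sub>k\<^sub>l = q\<^sup>-\<^sup>k g\<^sub>k\<^sub>l\<close>, it maps \<open>e\<^sub>k\<^sub>l\<close> to the sum over \<open>n\<close> of
  \<open>hankel l (n + k) e\<^sub>n\<^sub>,\<^sub>-\<^sub>l\<close>.\<close>

definition hankel :: "int \<Rightarrow> int \<Rightarrow> real" where
  "hankel l j = q powi (l - 1 + j) * qJ (- l) j"

text \<open>The symmetry moves the running index \<open>j\<close> from the radius into the order,
  and the weight in the definition of \<open>hankel\<close> is the one that cancels the power of q
  arising there.\<close>

lemma hankel_eq: "hankel l j = (-1) powi (l + 1 + j) * qJ (j - 1) (1 - l)"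
proof -
  have "hankel l j = (-1) powi (- l + 1 + j) * (q powi (l - 1 + j) * q powi (- l + 1 - j)) * qJ (j - 1) (1 - l)"
    unfolding hankel_def by (subst qJ_symmetric) (simp add: mult_ac add.commute)
  also have "q powi (l - 1 + j) * q powi (- l + 1 - j) = 1"
    unfolding q_powi_add[symmetric] by simp
  also have "(-1) powi (- l + 1 + j) = ((-1) powi (l + 1 + j) :: real)"
    by (auto simp: minus_one_powi)
  finally show ?thesis by simp
qed

section \<open>Orthogonality and summability along the radius\<close>

lemma bij_add_int: "bij (\<lambda>n :: int. n + k)"
  by (rule bij_betwI[of _ _ _ "\<lambda>n. n - k"]) auto

lemma summable_on_shift_iff:
  "(\<lambda>n. f (n + k)) summable_on UNIV \<longleftrightarrow> f summable_on (UNIV :: int set)"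
  by (rule summable_on_reindex_bij_betw[OF bij_add_int])

lemma has_sum_shift_iff:
  "((\<lambda>n. f (n + k)) has_sum s) UNIV \<longleftrightarrow> (f has_sum s) (UNIV :: int set)"
  by (rule has_sum_reindex_bij_betw[OF bij_add_int])

lemma summable_hankel: "(\<lambda>j. \<bar>hankel l j\<bar>) summable_on UNIV"
  using summable_qJ[of "1 - l"] summable_on_shift_iff[of "\<lambda>j. \<bar>qJ j (1 - l)\<bar>" "- 1"]
  by (simp add: hankel_eq abs_mult)

text \<open>By \<open>hankel_eq\<close> this is \<open>qJ_orthogonal_shift\<close> on the fixed
  circle of index \<open>1 - l\<close>, with shift \<open>m - k\<close>. The signs combine to
  (-1)^(k + m), which is 1 in the one nonzero case.\<close>

lemma hankel_orthogonal:
  "((\<lambda>n. hankel l (n + k) * hankel l (n + m)) has_sum (if k = m then 1 else 0)) UNIV"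
proof -
  have "((\<lambda>n. qJ (n + (k - 1)) (1 - l) * qJ (n + (k - 1) + (m - k)) (1 - l)) has_sum (if m - k = 0 then 1 else 0)) UNIV"
    unfolding has_sum_shift_iff[of "\<lambda>n. qJ n (1 - l) * qJ (n + (m - k)) (1 - l)"]
    by (rule qJ_orthogonal_shift)
  then have "((\<lambda>n. (-1) powi (k + m) * (qJ (n + (k - 1)) (1 - l) * qJ (n + (k - 1) + (m - k)) (1 - l)))
      has_sum (-1) powi (k + m) * (if m - k = 0 then 1 else 0)) UNIV"
    by (rule has_sum_cmult_right)
  moreover have "(-1) powi (k + m) * (qJ (n + (k - 1)) (1 - l) * qJ (n + (k - 1) + (m - k)) (1 - l)) =
      hankel l (n + k) * hankel l (n + m)" for n
  proof -
    have "(-1) powi (k + m) = ((-1) powi (l + 1 + (n + k)) * (-1) powi (l + 1 + (n + m)) :: real)"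
      by (auto simp: minus_one_powi)
    moreover have "n + (k - 1) = n + k - 1" "n + (k - 1) + (m - k) = n + m - 1"
      by auto
    ultimately show ?thesis
      unfolding hankel_eq by (simp only: mult_ac)
  qed
  moreover have "(-1) powi (k + m) * (if m - k = 0 then 1 else 0) = (if k = m then 1 else 0 :: real)"
    by (auto simp: minus_one_powi)
  ultimately show ?thesis by simp
qed

lemma summable_powi_qJ: "(\<lambda>m. q powi m * qJ l m) summable_on UNIV"
proof -
  have "q powi m * qJ l m = q powi (l + 1) * hankel (- l) m" for m
  proof -
    have "q powi m = q powi (l + 1) * q powi (- l - 1 + m)"
      unfolding q_powi_add[symmetric] by simp
    then show ?thesis by (simp add: hankel_def)
  qed
  moreover have "(\<lambda>m. q powi (l + 1) * hankel (- l) m) summable_on UNIV"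
    by (intro summable_on_cmult_right) (rule abs_summable_summable, simp add: summable_hankel)
  ultimately show ?thesis by simp
qed

text \<open>The weight q^(2m) is large as \<open>m\<close> tends to -infinity, and the Hankel rows
  only yield summability against q^m. Contiguity trades the other power q^m for a higher
  order.\<close>

lemma powi_double_qJ:
  "q powi (2 * m) * qJ l m = q powi l * (q powi (m + 1) * qJ (l + 1) (m + 1)) - q powi m * qJ (l + 1) m"
proof -
  have "q powi (2 * m) * qJ l m = q powi m * (q powi m * qJ (l + 1 - 1) m)"
  proof -
    have "q powi (2 * m) = q powi m * q powi m"
      unfolding q_powi_add[symmetric] by simp
    then show ?thesis by simp
  qed
  also have "\<dots> = q powi m * (q powi (l + 1) * qJ (l + 1) (m + 1) - qJ (l + 1) m)"
    by (simp only: qJ_contig_pred)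
  also have "\<dots> = (q powi m * q powi (l + 1)) * qJ (l + 1) (m + 1) - q powi m * qJ (l + 1) m"
    by (simp add: algebra_simps)
  also have "q powi m * q powi (l + 1) = q powi l * q powi (m + 1)"
    unfolding q_powi_add[symmetric] by (simp add: algebra_simps)
  finally show ?thesis by simp
qed

lemma summable_powi_double_qJ: "(\<lambda>m. q powi (2 * m) * qJ l m) summable_on UNIV"
proof -
  have "(\<lambda>m. q powi (m + 1) * qJ (l + 1) (m + 1)) summable_on UNIV"
    using summable_powi_qJ[of "l + 1"] summable_on_shift_iff[of "\<lambda>m. q powi m * qJ (l + 1) m" 1] by blast
  then have "(\<lambda>m. q powi l * (q powi (m + 1) * qJ (l + 1) (m + 1)) + - (q powi m * qJ (l + 1) m)) summable_on UNIV"
    by (intro summable_on_add summable_on_cmult_right summable_on_uminus[THEN iffD2] summable_powi_qJ)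
  then show ?thesis unfolding powi_double_qJ by simp
qed

text \<open>The sum telescopes by the contiguity relation.\<close>

lemma powi_double_qJ_has_sum_0: "((\<lambda>m. q powi (2 * m) * qJ 0 m) has_sum 0) UNIV"
proof -
  define S where "S = (\<Sum>\<^sub>\<infinity>m. q powi m * qJ 1 m)"
  have S: "((\<lambda>m. q powi m * qJ 1 m) has_sum S) UNIV"
    unfolding S_def by (rule has_sum_infsum[OF summable_powi_qJ])
  then have "((\<lambda>m. q powi (m + 1) * qJ 1 (m + 1)) has_sum S) UNIV"
    using has_sum_shift_iff[of "\<lambda>m. q powi m * qJ 1 m" 1] by blast
  from has_sum_minus[OF this S] show ?thesis
    unfolding powi_double_qJ by simp
qed

section \<open>Transforms of the functions g_kl\<close>

lemma integrable_mu_angular: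
  assumes f: "angular l c f" "f \<in> borel_measurable (mu q)"
    and c: "(\<lambda>n. q powi (2 * n) * c n) summable_on UNIV"
  shows "integrable (mu q) f"
proof (rule integrable_muI[OF f(2), of "\<lambda>n. \<bar>c n\<bar>"])
  show "AE \<phi> in circ. norm (f (of_real (q powi k) * cis \<phi>)) \<le> \<bar>c k\<bar>" for k
    using angularD[OF f(1)] by (simp add: norm_mult norm_power_int)
  show "(\<lambda>k. q powi (2 * k) * \<bar>c k\<bar>) summable_on UNIV"
    using c summable_on_iff_abs_summable_on_real[of "\<lambda>n. q powi (2 * n) * c n"]
    by (simp add: abs_mult abs_of_pos)
qed

lemma gkl_measurable: "gkl q k l \<in> borel_measurable (mu q)"
  by (rule continuous_on_measurable_mu[OF continuous_on_gkl])

lemma integral_angular_mu: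
  assumes f: "angular l c f" "integrable (mu q) f"
  shows "((\<lambda>n. of_real (q powi (2 * n)) * of_real (c n) * (if l = 0 then 1 else 0)) has_sum (\<integral>z. f z \<partial>mu q)) UNIV"
proof -
  have "q powi (2 * n) *\<^sub>R (\<integral>\<phi>. f (of_real (q powi n) * cis \<phi>) \<partial>circ) =
      of_real (q powi (2 * n)) * of_real (c n) * (if l = 0 then 1 else 0)" for n
    using angularD[OF f(1)] by (simp add: integral_cis_powi_circ scaleR_conv_of_real)
  then show ?thesis
    using integral_mu_has_sum[OF f(2)] by simp
qed

lemma Fq_gkl_section:
  assumes u: "norm u = 1"
  shows "Fq q (of_real (q powi n) * u * (of_real (q powi j) * cis \<phi>)) * gkl q k l (of_real (q powi j) * cis \<phi>) =
    (if j = k then Fq q (of_real (q powi (n + k)) * (u * cis \<phi>)) * cis \<phi> powi l else 0)"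
  using angularD[OF angular_gkl, of "cis \<phi>" k l j] by (simp add: q_powi_add mult_ac)

lemma integrable_gkl: "integrable (mu q) (gkl q k l)"
  by (rule integrable_mu_angular[OF angular_gkl gkl_measurable])
    (rule finite_nonzero_values_imp_summable_on, auto)

lemma integrable_Fq_gkl:
  assumes \<zeta>: "\<zeta> \<in> Gam_bar q"
  shows "integrable (mu q) (\<lambda>z. Fq q (\<zeta> * z) * gkl q k l z)"
proof (cases "\<zeta> = 0")
  case False
  with \<zeta> obtain n u where u: "norm u = 1" "\<zeta> = of_real (q powi n) * u"
    using Gam_polarE unfolding Gam_bar_def by blast
  show ?thesis
  proof (rule integrable_muI[where B = "\<lambda>j. if j = k then 1 else 0"])
    show "(\<lambda>z. Fq q (\<zeta> * z) * gkl q k l z) \<in> borel_measurable (mu q)"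
      by (intro borel_measurable_times Fq_kernel_measurable \<zeta> gkl_measurable)
    show "AE \<phi> in circ. norm (Fq q (\<zeta> * (of_real (q powi j) * cis \<phi>)) * gkl q k l (of_real (q powi j) * cis \<phi>))
        \<le> (if j = k then 1 else 0)" for j
      unfolding u(2) Fq_gkl_section[OF u(1)] using AE_norm_Fq[OF u(1), of "n + k"]
      by eventually_elim (simp add: norm_mult norm_power_int)
    show "(\<lambda>j. q powi (2 * j) * (if j = k then 1 else 0)) summable_on UNIV"
      by (rule finite_nonzero_values_imp_summable_on) auto
  qed
qed (simp add: integrable_gkl)

text \<open>Only the circle |z| = q^k contributes, with mass q^(2k); the angular integral extracts
  the coefficient of order \<open>- l\<close> of F_q on the circle of radius q^(n + k).\<close>

lemma fourier_gkl_angular: "angular (- l) (\<lambda>n. q powi (2 * k) * qJ (- l) (n + k)) (fourier q (gkl q k l))"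
  unfolding angular_def
proof (intro allI impI)
  fix n and u :: complex assume u: "norm u = 1"
  define \<zeta> where "\<zeta> = of_real (q powi n) * u"
  have \<zeta>: "\<zeta> \<in> Gam_bar q"
    using Gam_polar[OF u] Gam_subset by (auto simp: \<zeta>_def)
  define f where "f z = Fq q (\<zeta> * z) * gkl q k l z" for z
  have sect: "f (of_real (q powi j) * cis \<phi>) =
      (if j = k then Fq q (of_real (q powi (n + k)) * (u * cis \<phi>)) * cis \<phi> powi l else 0)" for j \<phi>
    unfolding f_def \<zeta>_def by (rule Fq_gkl_section[OF u])
  from integral_mu_has_sum[OF integrable_Fq_gkl[OF \<zeta>]]
  have "((\<lambda>j. q powi (2 * j) *\<^sub>R (\<integral>\<phi>. f (of_real (q powi j) * cis \<phi>) \<partial>circ)) has_sum fourier q (gkl q k l) \<zeta>) UNIV"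
    by (simp add: fourier_def f_def)
  moreover have "((\<lambda>j. q powi (2 * j) *\<^sub>R (\<integral>\<phi>. f (of_real (q powi j) * cis \<phi>) \<partial>circ)) has_sum
      q powi (2 * k) *\<^sub>R (\<integral>\<phi>. f (of_real (q powi k) * cis \<phi>) \<partial>circ)) UNIV"
  proof -
    have "(\<integral>\<phi>. f (of_real (q powi j) * cis \<phi>) \<partial>circ) = 0" if "j \<noteq> k" for j
      unfolding sect using that by simp
    then show ?thesis
      by (intro has_sum_finite_neutralI[of "{k}"]) (simp_all del: of_real_power_int)
  qed
  ultimately have "fourier q (gkl q k l) \<zeta> = q powi (2 * k) *\<^sub>R (\<integral>\<phi>. f (of_real (q powi k) * cis \<phi>) \<partial>circ)"
    by (rule has_sum_unique)
  also have "(\<integral>\<phi>. f (of_real (q powi k) * cis \<phi>) \<partial>circ) = of_real (qJ (- l) (n + k)) * u powi (- l)"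
    unfolding sect using integral_Fq_circ[OF u, of "n + k" l] by simp
  finally show "fourier q (gkl q k l) (of_real (q powi n) * u) =
      of_real (q powi (2 * k) * qJ (- l) (n + k)) * u powi (- l)"
    by (simp add: \<zeta>_def scaleR_conv_of_real)
qed

lemma fourier_gkl_0: "fourier q (gkl q k l) 0 = of_real (if - l = 0 then q powi (2 * k) else 0)"
proof -
  from integral_angular_mu[OF angular_gkl integrable_gkl]
  have "((\<lambda>n. of_real (q powi (2 * n)) * of_real (if n = k then 1 else 0) * (if l = 0 then 1 else 0)) has_sum
      fourier q (gkl q k l) 0) UNIV"
    by (simp add: fourier_def)
  moreover have "((\<lambda>n. of_real (q powi (2 * n)) * of_real (if n = k then 1 else 0) * (if l = 0 then 1 else 0 :: complex)) has_sum
      of_real (if - l = 0 then q powi (2 * k) else 0)) UNIV"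
    by (rule has_sum_finite_neutralI[of "{k}"]) auto
  ultimately show ?thesis by (rule has_sum_unique)
qed

lemma fourier_gkl_coeff_tendsto:
  "(\<lambda>n. q powi (2 * k) * qJ (- l) (int n + k)) \<longlonglongrightarrow> (if - l = 0 then q powi (2 * k) else 0)"
  using tendsto_mult_left[OF qJ_tendsto[of "- l" k], of "q powi (2 * k)"] by (simp add: if_distrib cong: if_cong)

lemma continuous_on_fourier_gkl: "continuous_on (Gam_bar q) (fourier q (gkl q k l))"
  by (rule angular_continuous[OF fourier_gkl_angular fourier_gkl_coeff_tendsto fourier_gkl_0])

lemma fourier_gkl_measurable: "fourier q (gkl q k l) \<in> borel_measurable (mu q)"
  by (rule continuous_on_measurable_mu[OF continuous_on_fourier_gkl])

lemma summable_fourier_gkl_coeff: "(\<lambda>n. q powi (2 * n) * (q powi (2 * k) * qJ (- l) (n + k))) summable_on UNIV"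
proof -
  have e: "q powi (2 * n) * (q powi (2 * k) * qJ (- l) (n + k)) = q powi (2 * (n + k)) * qJ (- l) (n + k)" for n
    by (simp add: q_powi_add distrib_left)
  show ?thesis
    unfolding e summable_on_shift_iff[of "\<lambda>m. q powi (2 * m) * qJ (- l) m" k]
    by (rule summable_powi_double_qJ)
qed

lemma integrable_fourier_gkl: "integrable (mu q) (fourier q (gkl q k l))"
  by (rule integrable_mu_angular[OF fourier_gkl_angular fourier_gkl_measurable summable_fourier_gkl_coeff])

section \<open>Analytic continuation from circles and the four derivatives\<close>

lemma circle_extension_eq:
  assumes G: "is_circle_extension q f n G" and z: "z \<noteq> 0"
  shows "circle_extension q f n z = G z"
proof -
  define F where "F = circle_extension q f n"
  have F: "is_circle_extension q f n F"
    unfolding F_def circle_extension_def using someI[of "is_circle_extension q f n" G] G by simp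
  have hol: "(\<lambda>w. F w - G w) holomorphic_on (UNIV - {0})"
    using F G by (auto simp: is_circle_extension_def intro!: holomorphic_intros)
  have "F z - G z = 0"
  proof (rule analytic_continuation[OF hol])
    show "open (UNIV - {0 :: complex})" by (simp add: open_delete)
    show "connected (UNIV - {0 :: complex})"
      using connected_punctured_universe[of "0 :: complex"] by (simp add: Compl_eq_Diff_UNIV)
    show "sphere 0 (q powi n) \<subseteq> UNIV - {0 :: complex}"
      using q_powi_pos[of n] by auto
    show "of_real (q powi n) \<in> UNIV - {0 :: complex}" by simp
    \<comment> \<open>The identity theorem needs an accumulation point. Every point of the circle is
      one, as the circle is connected and has more than one point.\<close>
    show "complex_of_real (q powi n) islimpt sphere 0 (q powi n)"
    proof (rule connected_imp_perfect)
      show "connected (sphere (0 :: complex) (q powi n))" by (rule connected_sphere) simp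
      show "complex_of_real (q powi n) \<in> sphere 0 (q powi n)"
        using q_pos by (simp add: norm_power_int)
      show "sphere 0 (q powi n) \<noteq> {x}" for x :: complex
      proof
        assume "sphere 0 (q powi n) = {x}"
        moreover have "complex_of_real (q powi n) \<in> sphere 0 (q powi n)" "- complex_of_real (q powi n) \<in> sphere 0 (q powi n)"
          using q_pos by (simp_all add: norm_power_int)
        ultimately have "complex_of_real (q powi n) = - of_real (q powi n)" by auto
        then show False by simp
      qed
    qed
    show "F w - G w = 0" if "w \<in> sphere 0 (q powi n)" for w
      using F G that by (auto simp: is_circle_extension_def)
  qed (use z in auto)
  then show ?thesis by (simp add: F_def)
qed

lemma angular_is_circle_extension:
  assumes "angular l c f"
  shows "is_circle_extension q f n (\<lambda>z. of_real (c n) * (z / of_real (q powi n)) powi l)"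
  unfolding is_circle_extension_def
proof (intro conjI allI impI)
  fix z :: complex assume z: "norm z = q powi n"
  show "of_real (c n) * (z / of_real (q powi n)) powi l = f z"
    using angularD[OF assms, of "z / of_real (q powi n)" n] z q_pos
    by (simp add: norm_divide norm_power_int)
qed (intro holomorphic_intros, auto)

lemma circle_index: "norm u = 1 \<Longrightarrow> (THE m::int. norm (of_real (q powi n) * u :: complex) = q powi m) = n"
  by (rule the_equality) (use q_pos in \<open>auto simp: norm_mult norm_power_int\<close>)

lemma shift_eq_circle_extension:
  assumes u: "norm u = 1" and G: "is_circle_extension q f n G" and r: "r \<noteq> 0"
  shows "shift q f r (of_real (q powi n) * u) = G (of_real r * (of_real (q powi n) * u))"
proof -
  have "u \<noteq> 0" using u by auto
  then show ?thesis
    using r circle_extension_eq[OF G, of "of_real r * (of_real (q powi n) * u)"] circle_index[OF u, of n]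
    by (simp add: shift_def)
qed

lemma shift_angular:
  assumes f: "angular l c f" and u: "norm u = 1" and r: "r \<noteq> 0"
  shows "shift q f r (of_real (q powi n) * u) = of_real (c n * r powi l) * u powi l"
  unfolding shift_eq_circle_extension[OF u angular_is_circle_extension[OF f] r]
  by (simp add: power_int_mult_distrib)

lemma angular_shift: "angular l c f \<Longrightarrow> r \<noteq> 0 \<Longrightarrow> angular l (\<lambda>n. c n * r powi l) (shift q f r)"
  unfolding angular_def[of _ _ "shift q f r"] using shift_angular by blast

lemma angular_cong:
  assumes "angular l c f" "\<And>n. c n = c' n" "l = l'"
  shows "angular l' c' f"
  using assms by (simp add: angular_def)

lemma inverse_q_neq_0: "1 / q \<noteq> 0"
  by simp

text \<open>The shift is evaluated at z / q, hence with the profile at \<open>n - 1\<close>, and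
  contributes (1/q)^l; division by z lowers the frequency. For the conjugate derivatives it rises
  instead, because 1 / conj(u) = u.\<close>

lemma angular_dR:
  assumes f: "angular l c f"
  shows "angular (l - 1) (\<lambda>n. (q powi (- l) * c (n - 1) - c n) / ((q powi (-2) - 1) * q powi n)) (dR q f)"
  unfolding angular_def
proof (intro allI impI)
  fix n and u :: complex assume u: "norm u = 1"
  then have u0: "u \<noteq> 0" by auto
  have e: "of_real (q powi n) * u / of_real q = of_real (q powi (n - 1)) * u"
    by (simp add: power_int_diff)
  have "dR q f (of_real (q powi n) * u) =
      (of_real (c (n - 1) * (1 / q) powi l) * u powi l - of_real (c n) * u powi l) /
      (of_real (q powi (-2) - 1) * (of_real (q powi n) * u))"
    unfolding dR_def e angularD[OF f u] shift_angular[OF f u inverse_q_neq_0] ..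
  also have "\<dots> = of_real ((q powi (- l) * c (n - 1) - c n) / ((q powi (-2) - 1) * q powi n)) * u powi (l - 1)"
    using u0 by (simp add: power_int_one_over power_int_minus power_int_diff divide_simps) (simp add: algebra_simps)
  finally show "dR q f (of_real (q powi n) * u) = \<dots>" .
qed

lemma angular_dL:
  assumes f: "angular l c f"
  shows "angular (l - 1) (\<lambda>n. (c n - q powi l * c (n + 1)) / ((1 - q\<^sup>2) * q powi n)) (dL q f)"
  unfolding angular_def
proof (intro allI impI)
  fix n and u :: complex assume u: "norm u = 1"
  then have u0: "u \<noteq> 0" by auto
  have e: "of_real q * (of_real (q powi n) * u) = of_real (q powi (n + 1)) * u"
    by (simp add: power_int_add)
  have "dL q f (of_real (q powi n) * u) =
      (of_real (c n) * u powi l - of_real (c (n + 1) * q powi l) * u powi l) /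
      (of_real (1 - q\<^sup>2) * (of_real (q powi n) * u))"
    unfolding dL_def e angularD[OF f u] shift_angular[OF f u q_neq_0(1)] ..
  also have "\<dots> = of_real ((c n - q powi l * c (n + 1)) / ((1 - q\<^sup>2) * q powi n)) * u powi (l - 1)"
    using u0 by (simp add: power_int_diff divide_simps) (simp add: algebra_simps)
  finally show "dL q f (of_real (q powi n) * u) = \<dots>" .
qed

lemma angular_dL_bar:
  assumes f: "angular l c f"
  shows "angular (l + 1) (\<lambda>n. (q powi l * c (n - 1) - c n) / ((q powi (-2) - 1) * q powi n)) (dL_bar q f)"
  unfolding angular_def
proof (intro allI impI)
  fix n and u :: complex assume u: "norm u = 1"
  then have u0: "u \<noteq> 0" by auto
  have cu: "cnj u = 1 / u"
    using cnj_unit_powi[OF u, of 1] by (simp add: divide_inverse)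
  have e: "of_real (q powi n) * u / of_real q = of_real (q powi (n - 1)) * u"
    by (simp add: power_int_diff)
  have "dL_bar q f (of_real (q powi n) * u) =
      (of_real (c (n - 1) * q powi l) * u powi l - of_real (c n) * u powi l) /
      (of_real (q powi (-2) - 1) * (of_real (q powi n) * (1 / u)))"
    unfolding dL_bar_def e angularD[OF f u] shift_angular[OF f u q_neq_0(1)]
      complex_cnj_mult complex_cnj_complex_of_real cu ..
  also have "\<dots> = of_real ((q powi l * c (n - 1) - c n) / ((q powi (-2) - 1) * q powi n)) * u powi (l + 1)"
    using u0 by (simp add: power_int_add divide_simps) (simp add: algebra_simps)
  finally show "dL_bar q f (of_real (q powi n) * u) = \<dots>" .
qed

lemma angular_dR_bar:
  assumes f: "angular l c f"
  shows "angular (l + 1) (\<lambda>n. (c n - q powi (- l) * c (n + 1)) / ((1 - q\<^sup>2) * q powi n)) (dR_bar q f)"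
  unfolding angular_def
proof (intro allI impI)
  fix n and u :: complex assume u: "norm u = 1"
  then have u0: "u \<noteq> 0" by auto
  have cu: "cnj u = 1 / u"
    using cnj_unit_powi[OF u, of 1] by (simp add: divide_inverse)
  have e: "of_real q * (of_real (q powi n) * u) = of_real (q powi (n + 1)) * u"
    by (simp add: power_int_add)
  have "dR_bar q f (of_real (q powi n) * u) =
      (of_real (c n) * u powi l - of_real (c (n + 1) * (1 / q) powi l) * u powi l) /
      (of_real (1 - q\<^sup>2) * (of_real (q powi n) * (1 / u)))"
    unfolding dR_bar_def e angularD[OF f u] shift_angular[OF f u inverse_q_neq_0]
      complex_cnj_mult complex_cnj_complex_of_real cu ..
  also have "\<dots> = of_real ((c n - q powi (- l) * c (n + 1)) / ((1 - q\<^sup>2) * q powi n)) * u powi (l + 1)"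
    using u0 by (simp add: power_int_one_over power_int_minus power_int_add divide_simps) (simp add: algebra_simps)
  finally show "dR_bar q f (of_real (q powi n) * u) = \<dots>" .
qed

text \<open>A class that contains all transforms and is mapped into itself by the four operators, so
  that one limit statement covers every product of derivatives. Only the values on Gamma enter,
  since the limits are taken along Gamma.\<close>

definition qJ_like :: "(complex \<Rightarrow> complex) \<Rightarrow> bool" where
  "qJ_like f \<longleftrightarrow> (\<exists>C k l. angular l (\<lambda>n. C * qJ l (n + k)) f)"

lemma qJ_like_tendsto: "qJ_like f \<Longrightarrow> \<exists>L. (f \<longlongrightarrow> L) (at 0 within Gam q)"
proof -
  assume "qJ_like f"
  then obtain C k l where f: "angular l (\<lambda>n. C * qJ l (n + k)) f"
    by (auto simp: qJ_like_def)
  have "(\<lambda>n. C * qJ l (int n + k)) \<longlonglongrightarrow> (if l = 0 then C else 0)"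
    using tendsto_mult_left[OF qJ_tendsto[of l k], of C] by (simp add: if_distrib cong: if_cong)
  from angular_tendsto_0[OF f this] show ?thesis by blast
qed

text \<open>The four operators act on the coefficients \<open>qJ l (n + k)\<close> by the two contiguity relations.\<close>

lemma qJ_like_derivatives:
  assumes "qJ_like f" and D: "D \<in> {dR q, dL q, dR_bar q, dL_bar q}"
  shows "qJ_like (D f)"
proof -
  obtain C k l where f: "angular l (\<lambda>n. C * qJ l (n + k)) f"
    using assms(1) by (auto simp: qJ_like_def)
  have n0: "q powi n \<noteq> 0" for n by simp
  consider "D = dR q" | "D = dL q" | "D = dR_bar q" | "D = dL_bar q"
    using D by blast
  then show ?thesis
  proof cases
    case 1
    have "(q powi (- l) * (C * qJ l (n - 1 + k)) - C * qJ l (n + k)) / ((q powi (-2) - 1) * q powi n) =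
        - C * q powi (- l) * q powi (k - 1) / (q powi (-2) - 1) * qJ (l - 1) (n + (k - 1))" for n
    proof -
      have "q powi l * qJ l (n + k) - qJ l (n - 1 + k) = q powi n * q powi (k - 1) * qJ (l - 1) (n + (k - 1))"
      proof -
        have i: "n - 1 + k + 1 = n + k" "n + (k - 1) = n - 1 + k" by auto
        show ?thesis
          using qJ_contig_pred[of l "n - 1 + k"] unfolding q_powi_add[symmetric] i .
      qed
      moreover have "q powi (- l) * q powi l = 1"
        by (simp flip: q_powi_add)
      ultimately have "q powi (- l) * qJ l (n - 1 + k) - qJ l (n + k) =
          - (q powi (- l)) * (q powi n * q powi (k - 1) * qJ (l - 1) (n + (k - 1)))"
        by algebra
      then have "q powi (- l) * (C * qJ l (n - 1 + k)) - C * qJ l (n + k) =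
          C * (- (q powi (- l)) * (q powi n * q powi (k - 1) * qJ (l - 1) (n + (k - 1))))"
        by algebra
      then show ?thesis by simp
    qed
    from angular_cong[OF angular_dR[OF f] this refl] show ?thesis
      unfolding qJ_like_def 1 by blast
  next
    case 2
    have "(C * qJ l (n + k) - q powi l * (C * qJ l (n + 1 + k))) / ((1 - q\<^sup>2) * q powi n) =
        - C * q powi k / (1 - q\<^sup>2) * qJ (l - 1) (n + k)" for n
    proof -
      have "q powi l * qJ l (n + 1 + k) - qJ l (n + k) = q powi n * q powi k * qJ (l - 1) (n + k)"
      proof -
        have i: "n + k + 1 = n + 1 + k" by simp
        show ?thesis
          using qJ_contig_pred[of l "n + k"] unfolding q_powi_add[symmetric] i .
      qed
      then have "C * qJ l (n + k) - q powi l * (C * qJ l (n + 1 + k)) =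
          - C * (q powi n * q powi k * qJ (l - 1) (n + k))"
        by algebra
      then show ?thesis by simp
    qed
    from angular_cong[OF angular_dL[OF f] this refl] show ?thesis
      unfolding qJ_like_def 2 by blast
  next
    case 3
    have "(C * qJ l (n + k) - q powi (- l) * (C * qJ l (n + 1 + k))) / ((1 - q\<^sup>2) * q powi n) =
        C * q powi (- l) * q powi (k - 1) / (1 - q\<^sup>2) * qJ (l + 1) (n + (k + 1))" for n
    proof -
      have "q powi l * qJ l (n + k) - qJ l (n + 1 + k) = q powi n * q powi (k - 1) * qJ (l + 1) (n + (k + 1))"
      proof -
        have i: "n + 1 + k - 1 = n + k" "n + 1 + k - 2 = n + (k - 1)" "n + (k + 1) = n + 1 + k" by auto
        show ?thesis
          using qJ_contig_succ[of l "n + 1 + k"] unfolding q_powi_add[symmetric] i .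
      qed
      moreover have "q powi (- l) * q powi l = 1"
        by (simp flip: q_powi_add)
      ultimately have "qJ l (n + k) - q powi (- l) * qJ l (n + 1 + k) =
          q powi (- l) * (q powi n * q powi (k - 1) * qJ (l + 1) (n + (k + 1)))"
        by algebra
      then have "C * qJ l (n + k) - q powi (- l) * (C * qJ l (n + 1 + k)) =
          C * (q powi (- l) * (q powi n * q powi (k - 1) * qJ (l + 1) (n + (k + 1))))"
        by algebra
      then show ?thesis by simp
    qed
    from angular_cong[OF angular_dR_bar[OF f] this refl] show ?thesis
      unfolding qJ_like_def 3 by blast
  next
    case 4
    have "(q powi l * (C * qJ l (n - 1 + k)) - C * qJ l (n + k)) / ((q powi (-2) - 1) * q powi n) =
        C * q powi (k - 2) / (q powi (-2) - 1) * qJ (l + 1) (n + k)" for n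
    proof -
      have "q powi l * qJ l (n - 1 + k) - qJ l (n + k) = q powi n * q powi (k - 2) * qJ (l + 1) (n + k)"
      proof -
        have i: "n + k - 1 = n - 1 + k" "n + k - 2 = n + (k - 2)" by auto
        show ?thesis
          using qJ_contig_succ[of l "n + k"] unfolding q_powi_add[symmetric] i .
      qed
      then have "q powi l * (C * qJ l (n - 1 + k)) - C * qJ l (n + k) =
          C * (q powi n * q powi (k - 2) * qJ (l + 1) (n + k))"
        by algebra
      then show ?thesis by simp
    qed
    from angular_cong[OF angular_dL_bar[OF f] this refl] show ?thesis
      unfolding qJ_like_def 4 by blast
  qed
qed

lemma qJ_like_fourier_gkl: "qJ_like (fourier q (gkl q k l))"
  unfolding qJ_like_def using fourier_gkl_angular by blast

lemma fourier_gkl_Cq_inf: "fourier q (gkl q k l) \<in> Cq_inf q"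
proof -
  have "qJ_like (foldr (\<circ>) Ds id (fourier q (gkl q k l)))" if "Ds \<in> lists {dR q, dL q, dR_bar q, dL_bar q}" for Ds
    using that
  proof induction
    case (Cons D Ds)
    then show ?case using qJ_like_derivatives by simp
  qed (simp add: qJ_like_fourier_gkl)
  then have "\<forall>Ds \<in> lists {dR q, dL q, dR_bar q, dL_bar q}.
       \<exists>L. (foldr (\<circ>) Ds id (fourier q (gkl q k l)) \<longlongrightarrow> L) (at 0 within Gam q)"
    using qJ_like_tendsto by blast
  moreover have "fourier q (gkl q k l) \<in> alg_B q"
    unfolding alg_B_def
    using continuous_on_fourier_gkl angular_is_circle_extension[OF fourier_gkl_angular] by blast
  ultimately show ?thesis by (simp add: Cq_inf_def)
qed

section \<open>The adjoint transform\<close>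

lemma fourier_adj_angular:
  assumes h: "angular l c h" "h \<in> borel_measurable (mu q)" and u: "norm u = 1"
    and c: "(\<lambda>n. q powi (2 * n) * c n) summable_on UNIV"
  shows "((\<lambda>n. of_real (q powi (2 * n) * c n * qJ l (n + m)) * u powi (- l)) has_sum
    fourier_adj q h (of_real (q powi m) * u)) UNIV"
proof -
  define z where "z = of_real (q powi m) * u"
  have z: "z \<in> Gam_bar q"
    using Gam_polar[OF u] Gam_subset by (auto simp: z_def)
  define f where "f \<zeta> = cnj (Fq q (\<zeta> * z)) * h \<zeta>" for \<zeta>
  have sect: "f (of_real (q powi n) * cis \<phi>) =
      of_real (c n) * cnj (Fq q (of_real (q powi (n + m)) * (u * cis \<phi>)) * cis \<phi> powi (- l))" for n \<phi>
    using angularD[OF h(1), of "cis \<phi>" n] cnj_unit_powi[of "cis \<phi>" "- l"]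
    by (simp add: f_def z_def q_powi_add mult_ac)
  have "integrable (mu q) f"
  proof (rule integrable_muI[where B = "\<lambda>n. \<bar>c n\<bar>"])
    have "(\<lambda>\<zeta>. Fq q (\<zeta> * z)) \<in> borel_measurable (mu q)"
      using Fq_kernel_measurable[OF z] by (simp add: mult.commute)
    then have "(\<lambda>\<zeta>. cnj (Fq q (\<zeta> * z))) \<in> borel_measurable (mu q)"
      by (rule measurable_compose) (intro borel_measurable_continuous_onI continuous_intros)
    then show "f \<in> borel_measurable (mu q)"
      unfolding f_def by (intro borel_measurable_times h)
    show "AE \<phi> in circ. norm (f (of_real (q powi n) * cis \<phi>)) \<le> \<bar>c n\<bar>" for n
      using AE_norm_Fq[OF u, of "n + m"]
      by eventually_elim (simp only: sect, simp add: norm_mult norm_power_int)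
    show "(\<lambda>k. q powi (2 * k) * \<bar>c k\<bar>) summable_on UNIV"
      using c summable_on_iff_abs_summable_on_real[of "\<lambda>n. q powi (2 * n) * c n"]
      by (simp add: abs_mult abs_of_pos)
  qed
  from integral_mu_has_sum[OF this]
  have "((\<lambda>n. q powi (2 * n) *\<^sub>R (\<integral>\<phi>. f (of_real (q powi n) * cis \<phi>) \<partial>circ)) has_sum fourier_adj q h z) UNIV"
    by (simp add: fourier_adj_def f_def)
  moreover have "q powi (2 * n) *\<^sub>R (\<integral>\<phi>. f (of_real (q powi n) * cis \<phi>) \<partial>circ) =
      of_real (q powi (2 * n) * c n * qJ l (n + m)) * u powi (- l)" for n
  proof -
    have "(\<integral>\<phi>. f (of_real (q powi n) * cis \<phi>) \<partial>circ) =
        of_real (c n) * (\<integral>\<phi>. cnj (Fq q (of_real (q powi (n + m)) * (u * cis \<phi>)) * cis \<phi> powi (- l)) \<partial>circ)"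
      unfolding sect by (rule integral_mult_right_zero)
    also have "(\<integral>\<phi>. cnj (Fq q (of_real (q powi (n + m)) * (u * cis \<phi>)) * cis \<phi> powi (- l)) \<partial>circ) =
        cnj (of_real (qJ (- (- l)) (n + m)) * u powi (- (- l)))"
      by (simp only: Bochner_Integration.integral_cnj integral_Fq_circ[OF u])
    also have "\<dots> = of_real (qJ l (n + m)) * u powi (- l)"
      using cnj_unit_powi[OF u, of l] by simp
    finally show ?thesis by (simp add: scaleR_conv_of_real)
  qed
  ultimately show ?thesis by (simp add: z_def)
qed

text \<open>The weight q^(2n + 2k) is q^(2 - 2l + k - m) times the two Hankel weights. Orthogonality
  leaves only \<open>m = k\<close>, where the constant becomes q^(2 - 2l).\<close>

lemma fourier_adj_fourier_gkl_Gam: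
  assumes u: "norm u = 1"
  shows "fourier_adj q (fourier q (gkl q k l)) (of_real (q powi m) * u) =
    of_real (if m = k then q powi (2 - 2 * l) else 0) * u powi l"
proof -
  have "((\<lambda>n. of_real (q powi (2 * n) * (q powi (2 * k) * qJ (- l) (n + k)) * qJ (- l) (n + m)) * u powi (- (- l)))
      has_sum fourier_adj q (fourier q (gkl q k l)) (of_real (q powi m) * u)) UNIV"
    by (rule fourier_adj_angular[OF fourier_gkl_angular fourier_gkl_measurable u summable_fourier_gkl_coeff])
  moreover have "q powi (2 * n) * (q powi (2 * k) * qJ (- l) (n + k)) * qJ (- l) (n + m) =
      q powi (2 - 2 * l + k - m) * (hankel l (n + k) * hankel l (n + m))" for n
  proof -
    have "q powi (2 * n) * q powi (2 * k) =
        q powi (2 - 2 * l + k - m) * (q powi (l - 1 + (n + k)) * q powi (l - 1 + (n + m)))"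
      unfolding q_powi_add[symmetric] by (simp add: algebra_simps)
    then show ?thesis unfolding hankel_def by (simp add: mult_ac)
  qed
  ultimately have "((\<lambda>n. of_real (q powi (2 - 2 * l + k - m) * (hankel l (n + k) * hankel l (n + m))) * u powi l)
      has_sum fourier_adj q (fourier q (gkl q k l)) (of_real (q powi m) * u)) UNIV"
    by simp
  moreover have "((\<lambda>n. of_real (q powi (2 - 2 * l + k - m) * (hankel l (n + k) * hankel l (n + m))) * u powi l)
      has_sum of_real (q powi (2 - 2 * l + k - m) * (if k = m then 1 else 0)) * u powi l) UNIV"
    by (intro has_sum_cmult_left has_sum_of_real has_sum_cmult_right hankel_orthogonal)
  ultimately have "fourier_adj q (fourier q (gkl q k l)) (of_real (q powi m) * u) =
      of_real (q powi (2 - 2 * l + k - m) * (if k = m then 1 else 0)) * u powi l"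
    by (rule has_sum_unique)
  then show ?thesis by auto
qed

text \<open>At 0 the kernel is 1, so the value is the integral of the transform. For nonzero
  \<open>l\<close> the angular integral vanishes; for \<open>l = 0\<close> the radial sum telescopes
  to 0.\<close>

lemma fourier_adj_fourier_gkl_0: "fourier_adj q (fourier q (gkl q k l)) 0 = 0"
proof -
  have "fourier_adj q (fourier q (gkl q k l)) 0 = (\<integral>z. fourier q (gkl q k l) z \<partial>mu q)"
    by (simp add: fourier_adj_def)
  also have "\<dots> = 0"
  proof (rule has_sum_unique)
    show "((\<lambda>n. of_real (q powi (2 * n)) * of_real (q powi (2 * k) * qJ (- l) (n + k)) * (if - l = 0 then 1 else 0))
      has_sum (\<integral>z. fourier q (gkl q k l) z \<partial>mu q)) UNIV"
    by (rule integral_angular_mu[OF fourier_gkl_angular integrable_fourier_gkl])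
    show "((\<lambda>n. of_real (q powi (2 * n)) * of_real (q powi (2 * k) * qJ (- l) (n + k)) * (if - l = 0 then 1 else 0 :: complex))
      has_sum 0) UNIV"
  proof (cases "l = 0")
    case True
    have "((\<lambda>n. complex_of_real (q powi (2 * (n + k)) * qJ 0 (n + k))) has_sum of_real 0) UNIV"
      by (rule has_sum_shift_iff[of "\<lambda>n. complex_of_real (q powi (2 * n) * qJ 0 n)" k, THEN iffD2])
        (rule has_sum_of_real[OF powi_double_qJ_has_sum_0])
    then show ?thesis
      using True by (simp add: q_powi_add distrib_left mult.assoc)
  qed simp
  qed
  finally show ?thesis .
qed

lemma sigma_minus_i_squared_gkl:
  assumes u: "norm u = 1"
  shows "((\<lambda>h w. of_real q * sigma_minus_i q h w) ^^ 2) (gkl q k l) (of_real (q powi m) * u) =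
    of_real (if m = k then q powi (2 - 2 * l) else 0) * u powi l"
proof -
  have step: "angular l (\<lambda>n. q * (c n * (1 / q) powi l)) (\<lambda>w. of_real q * sigma_minus_i q h w)"
    if "angular l c h" for c h
    using angular_shift[OF that, of "1 / q"] by (simp add: angular_def sigma_minus_i_def mult.assoc)
  have "q * (q * ((if n = k then 1 else 0) * (1 / q) powi l) * (1 / q) powi l) = (if n = k then q powi (2 - 2 * l) else 0)" for n
  proof -
    have "q * (q * (1 / q) powi l * (1 / q) powi l) = q powi (1 + 1 + - l + - l)"
      unfolding q_powi_add by (simp add: power_int_inverse power_int_minus divide_inverse)
    then show ?thesis by (simp add: mult.assoc)
  qed
  from angular_cong[OF step[OF step[OF angular_gkl[of l k]]] _ refl, of "\<lambda>n. if n = k then q powi (2 - 2 * l) else 0"] this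
  have "angular l (\<lambda>n. if n = k then q powi (2 - 2 * l) else 0)
      (((\<lambda>h w. of_real q * sigma_minus_i q h w) ^^ 2) (gkl q k l))"
    by (simp add: numeral_2_eq_2 mult.assoc)
  from angularD[OF this u] show ?thesis .
qed

lemma fourier_adj_fourier_gkl:
  assumes "z \<in> Gam_bar q"
  shows "fourier_adj q (fourier q (gkl q k l)) z = ((\<lambda>h w. of_real q * sigma_minus_i q h w) ^^ 2) (gkl q k l) z"
proof (cases "z = 0")
  case True
  then show ?thesis
    by (simp add: fourier_adj_fourier_gkl_0 numeral_2_eq_2 sigma_minus_i_def shift_def)
next
  case False
  with assms obtain n u where "norm u = 1" "z = of_real (q powi n) * u"
    using Gam_polarE unfolding Gam_bar_def by blast
  then show ?thesis
    using fourier_adj_fourier_gkl_Gam sigma_minus_i_squared_gkl by simp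
qed

end

section \<open>Orthonormal bases of \<open>L\<^sup>2\<close>\<close>

abbreviation sqnorm :: "'a measure \<Rightarrow> ('a \<Rightarrow> complex) \<Rightarrow> real" where
  "sqnorm M f \<equiv> (\<integral>x. (norm (f x))\<^sup>2 \<partial>M)"

lemma L2_measurable: "f \<in> L2 M \<Longrightarrow> f \<in> borel_measurable M"
  by (simp add: L2_def)

lemma L2_integrable_sq: "f \<in> L2 M \<Longrightarrow> integrable M (\<lambda>x. (norm (f x))\<^sup>2)"
  by (simp add: L2_def)

lemma L2I_bound:
  assumes "f \<in> borel_measurable M" "integrable M g" "\<And>x. (norm (f x))\<^sup>2 \<le> g x"
  shows "f \<in> L2 M"
proof -
  have "integrable M (\<lambda>x. (norm (f x))\<^sup>2)"
  proof (rule Bochner_Integration.integrable_bound[OF assms(2)])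
    show "(\<lambda>x. (norm (f x))\<^sup>2) \<in> borel_measurable M"
      using assms(1) by measurable
    show "AE x in M. norm ((norm (f x))\<^sup>2) \<le> norm (g x)"
    proof (rule AE_I2)
      show "norm ((norm (f x))\<^sup>2) \<le> norm (g x)" for x
        using assms(3)[of x] abs_ge_self[of "g x"] by (simp del: abs_ge_self)
    qed
  qed
  with assms(1) show ?thesis by (simp add: L2_def)
qed

lemma L2_zero [simp]: "(\<lambda>x. 0) \<in> L2 M"
  by (simp add: L2_def)

lemma L2_cmult: "f \<in> L2 M \<Longrightarrow> (\<lambda>x. c * f x) \<in> L2 M"
  by (auto simp: L2_def norm_mult power_mult_distrib)

lemma L2_add:
  assumes "f \<in> L2 M" "g \<in> L2 M"
  shows "(\<lambda>x. f x + g x) \<in> L2 M"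
proof (rule L2I_bound)
  show "integrable M (\<lambda>x. 2 * (norm (f x))\<^sup>2 + 2 * (norm (g x))\<^sup>2)"
    using assms[THEN L2_integrable_sq] by auto
  show "(\<lambda>x. f x + g x) \<in> borel_measurable M"
    using assms[THEN L2_measurable] by auto
  fix x
  have "(norm (f x + g x))\<^sup>2 \<le> (norm (f x) + norm (g x))\<^sup>2"
    by (intro power_mono norm_triangle_ineq) auto
  also have "\<dots> \<le> 2 * (norm (f x))\<^sup>2 + 2 * (norm (g x))\<^sup>2"
    using zero_le_power2[of "norm (f x) - norm (g x)"] by (simp add: power2_eq_square algebra_simps)
  finally show "(norm (f x + g x))\<^sup>2 \<le> 2 * (norm (f x))\<^sup>2 + 2 * (norm (g x))\<^sup>2" .
qed

lemma L2_diff: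
  assumes "f \<in> L2 M" "g \<in> L2 M"
  shows "(\<lambda>x. f x - g x) \<in> L2 M"
proof -
  have "(\<lambda>x. f x + - 1 * g x) \<in> L2 M"
    by (rule L2_add[OF assms(1) L2_cmult[OF assms(2)]])
  then show ?thesis by simp
qed

lemma L2_sum: "(\<And>i. i \<in> I \<Longrightarrow> f i \<in> L2 M) \<Longrightarrow> (\<lambda>x. \<Sum>i\<in>I. f i x) \<in> L2 M"
proof (induction I rule: infinite_finite_induct)
  case (insert i I)
  have "(\<lambda>x. f i x + (\<Sum>i\<in>I. f i x)) \<in> L2 M"
    by (rule L2_add) (simp_all add: insert)
  then show ?case using insert.hyps by simp
qed simp_all

lemma L2_product_integrable:
  assumes "f \<in> L2 M" "g \<in> L2 M"
  shows "integrable M (\<lambda>x. f x * cnj (g x))"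
proof (rule Bochner_Integration.integrable_bound)
  show "integrable M (\<lambda>x. (norm (f x))\<^sup>2 + (norm (g x))\<^sup>2)"
    using assms[THEN L2_integrable_sq] by auto
  have "(\<lambda>x. cnj (g x)) \<in> borel_measurable M"
    by (rule measurable_compose[OF L2_measurable[OF assms(2)]])
      (intro borel_measurable_continuous_onI continuous_intros)
  then show "(\<lambda>x. f x * cnj (g x)) \<in> borel_measurable M"
    using L2_measurable[OF assms(1)] by auto
  have "norm (f x * cnj (g x)) \<le> (norm (f x))\<^sup>2 + (norm (g x))\<^sup>2" for x
  proof -
    have "0 \<le> norm (f x) * norm (g x)" by simp
    then show ?thesis
      using sum_squares_bound[of "norm (f x)" "norm (g x)"] unfolding norm_mult complex_mod_cnj by linarith
  qed
  then show "AE x in M. norm (f x * cnj (g x)) \<le> norm ((norm (f x))\<^sup>2 + (norm (g x))\<^sup>2)"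
    by (intro AE_I2) simp
qed

lemma L2_inner_add_left:
  "f \<in> L2 M \<Longrightarrow> g \<in> L2 M \<Longrightarrow> h \<in> L2 M \<Longrightarrow>
    L2_inner M (\<lambda>x. f x + g x) h = L2_inner M f h + L2_inner M g h"
  unfolding L2_inner_def distrib_right
  by (intro Bochner_Integration.integral_add L2_product_integrable)

lemma L2_inner_diff_left:
  "f \<in> L2 M \<Longrightarrow> g \<in> L2 M \<Longrightarrow> h \<in> L2 M \<Longrightarrow>
    L2_inner M (\<lambda>x. f x - g x) h = L2_inner M f h - L2_inner M g h"
  unfolding L2_inner_def left_diff_distrib
  by (intro Bochner_Integration.integral_diff L2_product_integrable)

lemma L2_inner_cmult_left: "L2_inner M (\<lambda>x. c * f x) h = c * L2_inner M f h"
  by (simp add: L2_inner_def mult.assoc)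

lemma L2_inner_commute: "L2_inner M g f = cnj (L2_inner M f g)"
  by (simp add: L2_inner_def mult.commute flip: Bochner_Integration.integral_cnj)

lemma L2_inner_sum_left:
  assumes "\<And>i. i \<in> I \<Longrightarrow> f i \<in> L2 M" "h \<in> L2 M"
  shows "L2_inner M (\<lambda>x. \<Sum>i\<in>I. f i x) h = (\<Sum>i\<in>I. L2_inner M (f i) h)"
  unfolding L2_inner_def sum_distrib_right
  by (intro Bochner_Integration.integral_sum L2_product_integrable assms)

lemma L2_inner_self: "L2_inner M f f = of_real (sqnorm M f)"
  by (simp add: L2_inner_def complex_norm_square[symmetric] flip: of_real_power integral_complex_of_real)

lemma L2_inner_cong_AE:
  assumes "f \<in> L2 M" "g \<in> L2 M" "h \<in> L2 M" "AE x in M. f x = g x"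
  shows "L2_inner M f h = L2_inner M g h"
  unfolding L2_inner_def
proof (rule integral_cong_AE)
  show "AE x in M. f x * cnj (h x) = g x * cnj (h x)"
    using assms(4) by eventually_elim simp
qed (use L2_product_integrable assms in \<open>auto intro: borel_measurable_integrable\<close>)

lemma sqnorm_cong_AE:
  assumes "f \<in> L2 M" "g \<in> L2 M" "AE x in M. f x = g x"
  shows "sqnorm M f = sqnorm M g"
proof (rule integral_cong_AE)
  show "AE x in M. (norm (f x))\<^sup>2 = (norm (g x))\<^sup>2"
    using assms(3) by eventually_elim simp
qed (use L2_integrable_sq assms in \<open>auto intro: borel_measurable_integrable\<close>)

lemma sqnorm_diff:
  assumes f: "f \<in> L2 M" and g: "g \<in> L2 M"
  shows "sqnorm M (\<lambda>x. f x - g x) = sqnorm M f + sqnorm M g - 2 * Re (L2_inner M f g)"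
proof -
  have e: "(norm (f x - g x))\<^sup>2 = (norm (f x))\<^sup>2 + (norm (g x))\<^sup>2 - 2 * Re (f x * cnj (g x))" for x
    unfolding cmod_power2 by (simp add: power2_eq_square algebra_simps)
  have "sqnorm M (\<lambda>x. f x - g x) = sqnorm M f + sqnorm M g - 2 * (\<integral>x. Re (f x * cnj (g x)) \<partial>M)"
    unfolding e
    using L2_integrable_sq[OF f] L2_integrable_sq[OF g] integrable_Re[OF L2_product_integrable[OF f g]]
    by (simp del: times_complex.sel)
  also have "(\<integral>x. Re (f x * cnj (g x)) \<partial>M) = Re (L2_inner M f g)"
    unfolding L2_inner_def using L2_product_integrable[OF f g] by (rule integral_Re)
  finally show ?thesis .
qed

lemma L2_Cauchy_Schwarz:
  assumes f: "f \<in> L2 M" and g: "g \<in> L2 M" and "sqnorm M g = 1"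
  shows "(norm (L2_inner M f g))\<^sup>2 \<le> sqnorm M f"
proof -
  define c where "c = L2_inner M f g"
  have "0 \<le> sqnorm M (\<lambda>x. f x - c * g x)" by simp
  also have "\<dots> = sqnorm M f + sqnorm M (\<lambda>x. c * g x) - 2 * Re (L2_inner M f (\<lambda>x. c * g x))"
    by (intro sqnorm_diff f L2_cmult g)
  also have "sqnorm M (\<lambda>x. c * g x) = (norm c)\<^sup>2"
    using assms(3) by (simp add: norm_mult power_mult_distrib)
  also have "L2_inner M f (\<lambda>x. c * g x) = of_real ((norm c)\<^sup>2)"
    by (subst L2_inner_commute) (simp add: L2_inner_cmult_left L2_inner_commute[of M g f] c_def[symmetric]
        complex_norm_square[symmetric] mult.commute)
  finally show ?thesis by (simp add: c_def)
qed

section \<open>Completeness along rapidly converging sequences\<close>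

lemma power_swap_square: "((a :: real) ^ k)\<^sup>2 = (a\<^sup>2) ^ k"
  by (simp only: power_mult[symmetric] mult.commute)

lemma sum_quarter_le: "n \<le> m \<Longrightarrow> (\<Sum>k=n..<m. (1/4::real) ^ k) \<le> 2 * (1/4) ^ n"
proof -
  assume "n \<le> m"
  then have "(\<Sum>k=n..<m. (1/4::real) ^ k) \<le> 4/3 * (1/4) ^ n - 4/3 * (1/4) ^ m"
    by (induction m rule: dec_induct) auto
  also have "\<dots> \<le> 2 * (1/4) ^ n"
    using zero_le_power[of "1/4 :: real" n] zero_le_power[of "1/4 :: real" m] by linarith
  finally show ?thesis .
qed

text \<open>By the Cauchy--Schwarz inequality with weights \<open>4\<^sup>k\<close>, all tails of the sequence are dominated by the
  single integrable function \<open>W\<close>.\<close>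

lemma L2_complete_rapid:
  assumes s: "\<And>n. s n \<in> L2 M"
    and d: "\<And>n. sqnorm M (\<lambda>x. s (Suc n) x - s n x) \<le> (1/8) ^ n"
  obtains f where "f \<in> L2 M" "(\<lambda>n. sqnorm M (\<lambda>x. f x - s n x)) \<longlonglongrightarrow> 0"
proof -
  \<comment> \<open>The weight 4^k lies between 1 and the inverse 8^k of the decay: the integrals of
    \<open>D k\<close> stay below 2^-k, while the dual weights 4^-k in the Cauchy-Schwarz inequality
    have tails of order 4^-n.\<close>
  define D where "D k x = 4 ^ k * (norm (s (Suc k) x - s k x))\<^sup>2" for k x
  have D0: "0 \<le> D k x" for k x by (simp add: D_def)
  define W where "W x = (\<Sum>k. ennreal (D k x))" for x
  have sm [measurable]: "s n \<in> borel_measurable M" for n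
    by (rule L2_measurable[OF s])
  have Dm [measurable]: "D k \<in> borel_measurable M" for k
    unfolding D_def by measurable
  have Wm [measurable]: "W \<in> borel_measurable M"
    unfolding W_def by measurable
  have Dint: "integrable M (D k)" for k
    unfolding D_def using L2_integrable_sq[OF L2_diff[OF s s]] by auto
  have W2: "(\<integral>\<^sup>+x. W x \<partial>M) \<le> 2"
  proof -
    have "(\<integral>\<^sup>+x. W x \<partial>M) = (\<Sum>k. \<integral>\<^sup>+x. ennreal (D k x) \<partial>M)"
      unfolding W_def by (rule nn_integral_suminf) measurable
    also have "\<dots> \<le> (\<Sum>k. ennreal ((1/2) ^ k))"
    proof (rule suminf_le)
      fix k
      have "(\<integral>\<^sup>+x. ennreal (D k x) \<partial>M) = ennreal (\<integral>x. D k x \<partial>M)"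
        using Dint D0 by (intro nn_integral_eq_integral) auto
      also have "(\<integral>x. D k x \<partial>M) = 4 ^ k * sqnorm M (\<lambda>x. s (Suc k) x - s k x)"
        unfolding D_def by simp
      also have "\<dots> \<le> 4 ^ k * (1/8) ^ k"
        using d by (intro mult_left_mono) auto
      also have "4 ^ k * (1/8) ^ k = (1/2 :: real) ^ k"
        unfolding power_mult_distrib[symmetric] by simp
      finally show "(\<integral>\<^sup>+x. ennreal (D k x) \<partial>M) \<le> ennreal ((1/2) ^ k)"
        by (simp add: ennreal_leI)
    qed (rule summableI)+
    also have "\<dots> = ennreal (\<Sum>k. (1/2) ^ k)"
      by (rule suminf_ennreal2) (simp, rule summable_geometric, simp)
    also have "(\<Sum>k. (1/2 :: real) ^ k) = 2"
      by (subst suminf_geometric) simp_all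
    finally show ?thesis by simp
  qed
  have half: "((1/2 :: real) ^ k)\<^sup>2 = (1/4) ^ k" for k
    unfolding power_swap_square by (simp add: power2_eq_square)
  have two: "((2 :: real) ^ k)\<^sup>2 = 4 ^ k" for k
    unfolding power_swap_square by simp
  have tail: "ennreal ((norm (s m x - s n x))\<^sup>2) \<le> ennreal (2 * (1/4) ^ n) * W x" if "n \<le> m" for n m x
  proof -
    have "s m x - s n x = (\<Sum>k=n..<m. s (Suc k) x - s k x)"
      using sum_Suc_diff'[OF that, of "\<lambda>k. s k x"] by simp
    then have "norm (s m x - s n x) \<le> (\<Sum>k=n..<m. norm (s (Suc k) x - s k x))"
      by (simp add: sum_norm_le)
    also have "\<dots> = (\<Sum>k=n..<m. (1/2) ^ k * (2 ^ k * norm (s (Suc k) x - s k x)))"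
      by (intro sum.cong refl) (simp add: power_divide)
    finally have "(norm (s m x - s n x))\<^sup>2 \<le> (\<Sum>k=n..<m. (1/2) ^ k * (2 ^ k * norm (s (Suc k) x - s k x)))\<^sup>2"
      by (intro power_mono) auto
    also have "\<dots> \<le> (\<Sum>k=n..<m. ((1/2) ^ k)\<^sup>2) * (\<Sum>k=n..<m. (2 ^ k * norm (s (Suc k) x - s k x))\<^sup>2)"
      by (rule Cauchy_Schwarz_ineq_sum)
    also have "(\<Sum>k=n..<m. ((1/2) ^ k)\<^sup>2) = (\<Sum>k=n..<m. (1/4 :: real) ^ k)"
      by (simp only: half)
    also have "(\<Sum>k=n..<m. (2 ^ k * norm (s (Suc k) x - s k x))\<^sup>2) = (\<Sum>k=n..<m. D k x)"
      unfolding D_def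
      by (simp only: power_mult_distrib two)
    also have "(\<Sum>k=n..<m. (1/4 :: real) ^ k) * (\<Sum>k=n..<m. D k x) \<le> 2 * (1/4) ^ n * (\<Sum>k=n..<m. D k x)"
      using that D0 by (intro mult_right_mono sum_quarter_le sum_nonneg) auto
    finally have "ennreal ((norm (s m x - s n x))\<^sup>2) \<le> ennreal (2 * (1/4) ^ n * (\<Sum>k=n..<m. D k x))"
      by (rule ennreal_leI)
    also have "\<dots> = ennreal (2 * (1/4) ^ n) * (\<Sum>k=n..<m. ennreal (D k x))"
      unfolding sum_ennreal[OF D0] by (rule ennreal_mult) (simp_all add: sum_nonneg D0)
    also have "(\<Sum>k=n..<m. ennreal (D k x)) \<le> W x"
      unfolding W_def by (intro sum_le_suminf) auto
    finally show ?thesis by (simp add: mult_left_mono)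
  qed
  define f where "f x = lim (\<lambda>n. s n x)" for x
  have fm [measurable]: "f \<in> borel_measurable M"
    unfolding f_def by (rule borel_measurable_lim_metric) measurable
  have "AE x in M. W x \<noteq> \<infinity>"
  proof (rule nn_integral_noteq_infinite)
    show "(\<integral>\<^sup>+x. W x \<partial>M) \<noteq> \<infinity>"
      using W2 by (auto simp: top_unique)
  qed measurable
  then have bound: "AE x in M. \<forall>n. ennreal ((norm (f x - s n x))\<^sup>2) \<le> ennreal (2 * (1/4) ^ n) * W x"
  proof eventually_elim
    case (elim x)
    then obtain w where w: "W x = ennreal w" "0 \<le> w"
      by (cases "W x") auto
    have mult: "ennreal (2 * (1/4) ^ n) * ennreal w = ennreal (2 * (1/4) ^ n * w)" for n
      by (rule ennreal_mult[symmetric]) (simp_all add: w)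
    have le: "(norm (s m x - s n x))\<^sup>2 \<le> 2 * (1/4) ^ n * w" if "n \<le> m" for n m
      using tail[OF that, of x] unfolding w(1) mult
      by (rule ennreal_le_iff[THEN iffD1, rotated]) (simp add: w)
    have "Cauchy (\<lambda>n. s n x)"
    proof (rule metric_CauchyI)
      fix e :: real assume e: "0 < e"
      have "(\<lambda>n. 2 * (1/4) ^ n * w) \<longlonglongrightarrow> 2 * 0 * w"
        by (intro tendsto_intros LIMSEQ_realpow_zero) auto
      then have "eventually (\<lambda>n. 2 * (1/4) ^ n * w < (e/2)\<^sup>2) sequentially"
        using e by (intro order_tendstoD(2)) auto
      then obtain N where N: "2 * (1/4) ^ N * w < (e/2)\<^sup>2"
        unfolding eventually_sequentially by blast
      have lt: "dist (s m x) (s N x) < e/2" if "N \<le> m" for m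
      proof -
        have "(norm (s m x - s N x))\<^sup>2 < (e/2)\<^sup>2"
          by (rule le_less_trans[OF le[OF that] N])
        then show ?thesis
          unfolding dist_norm by (rule power_less_imp_less_base) (use e in simp)
      qed
      have "dist (s m x) (s n x) < e" if "N \<le> m" "N \<le> n" for m n
        by (rule dist_triangle_half_l[OF lt[OF that(1)] lt[OF that(2)]])
      then show "\<exists>N. \<forall>m\<ge>N. \<forall>n\<ge>N. dist (s m x) (s n x) < e" by blast
    qed
    then have lim: "(\<lambda>n. s n x) \<longlonglongrightarrow> f x"
      unfolding f_def by (simp add: Cauchy_convergent_iff convergent_LIMSEQ_iff)
    show ?case
    proof
      fix n
      have "(\<lambda>m. (norm (s m x - s n x))\<^sup>2) \<longlonglongrightarrow> (norm (f x - s n x))\<^sup>2"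
        by (intro tendsto_intros lim)
      then have "(norm (f x - s n x))\<^sup>2 \<le> 2 * (1/4) ^ n * w"
        by (rule LIMSEQ_le_const2) (use le in blast)
      then show "ennreal ((norm (f x - s n x))\<^sup>2) \<le> ennreal (2 * (1/4) ^ n) * W x"
        unfolding w(1) mult by (rule ennreal_leI)
    qed
  qed
  have nn: "(\<integral>\<^sup>+x. ennreal ((norm (f x - s n x))\<^sup>2) \<partial>M) \<le> ennreal (4 * (1/4) ^ n)" for n
  proof -
    have "(\<integral>\<^sup>+x. ennreal ((norm (f x - s n x))\<^sup>2) \<partial>M) \<le> (\<integral>\<^sup>+x. ennreal (2 * (1/4) ^ n) * W x \<partial>M)"
      using bound by (intro nn_integral_mono_AE) auto
    also have "\<dots> = ennreal (2 * (1/4) ^ n) * (\<integral>\<^sup>+x. W x \<partial>M)"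
      by (rule nn_integral_cmult) measurable
    also have "\<dots> \<le> ennreal (2 * (1/4) ^ n) * ennreal 2"
      using W2 by (intro mult_left_mono) auto
    also have "\<dots> = ennreal (2 * (1/4) ^ n * 2)"
      by (rule ennreal_mult''[symmetric]) simp
    also have "2 * (1/4) ^ n * 2 = 4 * (1/4 :: real) ^ n" by simp
    finally show ?thesis .
  qed
  have fs: "(\<lambda>x. f x - s n x) \<in> L2 M" for n
  proof -
    have "integrable M (\<lambda>x. (norm (f x - s n x))\<^sup>2)"
    proof (rule integrableI_nonneg)
      show "(\<integral>\<^sup>+x. ennreal ((norm (f x - s n x))\<^sup>2) \<partial>M) < \<infinity>"
        using nn[of n] by (auto simp: less_top[symmetric] top_unique)
    qed auto
    then show ?thesis by (simp add: L2_def)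
  qed
  have "f \<in> L2 M"
    using L2_add[OF fs[of 0] s[of 0]] by simp
  moreover have "(\<lambda>n. sqnorm M (\<lambda>x. f x - s n x)) \<longlonglongrightarrow> 0"
  proof (rule tendsto_sandwich[of "\<lambda>_. 0" _ _ "\<lambda>n. 4 * (1/4) ^ n"])
    have "sqnorm M (\<lambda>x. f x - s n x) \<le> 4 * (1/4) ^ n" for n
    proof -
      have "ennreal (sqnorm M (\<lambda>x. f x - s n x)) = (\<integral>\<^sup>+x. ennreal ((norm (f x - s n x))\<^sup>2) \<partial>M)"
        using L2_integrable_sq[OF fs[of n]] by (intro nn_integral_eq_integral[symmetric]) auto
      with nn[of n] have "ennreal (sqnorm M (\<lambda>x. f x - s n x)) \<le> ennreal (4 * (1/4) ^ n)"
        by (simp only:)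
      then show ?thesis by (rule ennreal_le_iff[THEN iffD1, rotated]) simp
    qed
    then show "eventually (\<lambda>n. sqnorm M (\<lambda>x. f x - s n x) \<le> 4 * (1/4) ^ n) sequentially" by simp
    have "(\<lambda>n. 4 * (1/4) ^ n :: real) \<longlonglongrightarrow> 4 * 0"
      by (intro tendsto_intros LIMSEQ_realpow_zero) auto
    then show "(\<lambda>n. 4 * (1/4) ^ n :: real) \<longlonglongrightarrow> 0" by simp
  qed auto
  ultimately show ?thesis by (rule that)
qed

section \<open>Orthonormal systems and bases\<close>

locale orthonormal_L2 =
  fixes M :: "'a measure" and e :: "nat \<Rightarrow> 'a \<Rightarrow> complex"
  assumes e_L2: "e i \<in> L2 M"
    and e_orthonormal: "L2_inner M (e i) (e j) = (if i = j then 1 else 0)"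
begin

lemma sqnorm_e: "sqnorm M (e i) = 1"
  using L2_inner_self[of M "e i"] e_orthonormal[of i i] by (metis of_real_eq_1_iff)

definition comb :: "(nat \<Rightarrow> complex) \<Rightarrow> nat set \<Rightarrow> 'a \<Rightarrow> complex" where
  "comb c I x = (\<Sum>i\<in>I. c i * e i x)"

lemma comb_L2: "comb c I \<in> L2 M"
  unfolding comb_def[abs_def] by (intro L2_sum L2_cmult e_L2)

lemma L2_inner_comb_left:
  assumes "f \<in> L2 M"
  shows "L2_inner M (comb c I) f = (\<Sum>i\<in>I. c i * L2_inner M (e i) f)"
  unfolding comb_def[abs_def]
  using assms by (subst L2_inner_sum_left) (auto simp: L2_inner_cmult_left intro: L2_cmult e_L2)

lemma L2_inner_comb_e:
  assumes "finite I"
  shows "L2_inner M (comb c I) (e j) = (if j \<in> I then c j else 0)"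
  using assms by (simp add: L2_inner_comb_left e_L2 e_orthonormal if_distrib cong: if_cong)

lemma sqnorm_comb:
  assumes "finite I"
  shows "sqnorm M (comb c I) = (\<Sum>i\<in>I. (norm (c i))\<^sup>2)"
proof -
  have "complex_of_real (sqnorm M (comb c I)) = (\<Sum>i\<in>I. c i * cnj (L2_inner M (comb c I) (e i)))"
    unfolding L2_inner_self[symmetric] L2_inner_comb_left[OF comb_L2] by (simp only: L2_inner_commute[of M "e _"])
  also have "\<dots> = (\<Sum>i\<in>I. of_real ((norm (c i))\<^sup>2))"
    using assms by (intro sum.cong refl) (simp add: L2_inner_comb_e complex_norm_square[symmetric])
  finally show ?thesis
    by (simp only: of_real_sum[symmetric] of_real_eq_iff)
qed

lemma sqnorm_diff_comb:
  assumes f: "f \<in> L2 M" and I: "finite I"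
  shows "sqnorm M (\<lambda>x. f x - comb (\<lambda>i. L2_inner M f (e i)) I x) =
    sqnorm M f - (\<Sum>i\<in>I. (norm (L2_inner M f (e i)))\<^sup>2)"
proof -
  define c where "c i = L2_inner M f (e i)" for i
  have "L2_inner M f (comb c I) = cnj (\<Sum>i\<in>I. c i * cnj (c i))"
    unfolding L2_inner_commute[of M f] L2_inner_comb_left[OF f] by (simp add: L2_inner_commute[of M "e _" f] c_def)
  then have "Re (L2_inner M f (comb c I)) = (\<Sum>i\<in>I. (norm (c i))\<^sup>2)"
    by (simp add: complex_norm_square[symmetric] flip: of_real_power)
  then show ?thesis
    using sqnorm_diff[OF f comb_L2[of c I]] sqnorm_comb[OF I, of c] unfolding c_def by simp
qed

lemma Bessel_summable:
  assumes f: "f \<in> L2 M"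
  shows "summable (\<lambda>i. (norm (L2_inner M f (e i)))\<^sup>2)"
proof (rule bounded_imp_summable)
  fix n
  have "0 \<le> sqnorm M f - (\<Sum>i\<in>{..n}. (norm (L2_inner M f (e i)))\<^sup>2)"
    unfolding sqnorm_diff_comb[OF f finite_atMost, symmetric] by simp
  then show "(\<Sum>i\<le>n. (norm (L2_inner M f (e i)))\<^sup>2) \<le> sqnorm M f" by simp
qed simp

text \<open>Partial sums are taken along a subsequence whose blocks have squared norm below 8^-j, as
  \<open>L2_complete_rapid\<close> requires. The coefficients of the limit are found by the
  Cauchy-Schwarz inequality, its norm from \<open>sqnorm_diff_comb\<close>.\<close>

lemma Riesz_Fischer:
  assumes c: "summable (\<lambda>i. (norm (c i))\<^sup>2)"
  obtains f where "f \<in> L2 M" "\<And>i. L2_inner M f (e i) = c i" "sqnorm M f = (\<Sum>i. (norm (c i))\<^sup>2)"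
proof -
  have "\<exists>N. \<forall>m\<ge>N. \<forall>n. norm (\<Sum>i=m..<n. (norm (c i))\<^sup>2) < (1/8) ^ j" for j
    using c unfolding summable_Cauchy by (metis zero_less_divide_1_iff zero_less_numeral zero_less_power)
  then obtain N where N: "\<And>j m n. N j \<le> m \<Longrightarrow> norm (\<Sum>i=m..<n. (norm (c i))\<^sup>2) < (1/8) ^ j"
    by metis
  \<comment> \<open>The cumulative sum makes \<open>r\<close> monotone and at least
    \<open>N j\<close>; the summand \<open>j\<close> makes it tend to infinity.\<close>
  define r where "r j = (\<Sum>i\<le>j. N i) + j" for j
  have rN: "N j \<le> r j" for j
    unfolding r_def by (rule trans_le_add1[OF member_le_sum]) auto
  have rS: "r j \<le> r (Suc j)" for j by (simp add: r_def)
  have rj: "j \<le> r j" for j by (simp add: r_def)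
  define s where "s j = comb c {..<r j}" for j
  have s: "s j \<in> L2 M" for j
    unfolding s_def by (rule comb_L2)
  have "sqnorm M (\<lambda>x. s (Suc j) x - s j x) \<le> (1/8) ^ j" for j
  proof -
    have "s (Suc j) x - s j x = comb c {r j..<r (Suc j)} x" for x
    proof -
      have "{..<r (Suc j)} = {..<r j} \<union> {r j..<r (Suc j)}" using rS[of j] by auto
      moreover have "{..<r j} \<inter> {r j..<r (Suc j)} = {}" by auto
      ultimately show ?thesis
        unfolding s_def comb_def
        using sum.union_disjoint[of "{..<r j}" "{r j..<r (Suc j)}" "\<lambda>i. c i * e i x"] by simp
    qed
    then have "sqnorm M (\<lambda>x. s (Suc j) x - s j x) = (\<Sum>i=r j..<r (Suc j). (norm (c i))\<^sup>2)"
      using sqnorm_comb[of "{r j..<r (Suc j)}" c] by simp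
    then show ?thesis
      using N[OF rN, of j "r (Suc j)"] by simp
  qed
  then obtain f where f: "f \<in> L2 M" "(\<lambda>j. sqnorm M (\<lambda>x. f x - s j x)) \<longlonglongrightarrow> 0"
    using L2_complete_rapid[of s M] s by blast
  have coeff: "L2_inner M f (e i) = c i" for i
  proof -
    have "eventually (\<lambda>j. (norm (L2_inner M f (e i) - c i))\<^sup>2 \<le> sqnorm M (\<lambda>x. f x - s j x)) sequentially"
    proof (rule eventually_sequentiallyI)
      fix j assume "Suc i \<le> j"
      then have i: "i < r j" using rj[of j] by simp
      have "L2_inner M (\<lambda>x. f x - s j x) (e i) = L2_inner M f (e i) - c i"
        using i by (subst L2_inner_diff_left[OF f(1) s e_L2]) (simp add: s_def L2_inner_comb_e)
      then show "(norm (L2_inner M f (e i) - c i))\<^sup>2 \<le> sqnorm M (\<lambda>x. f x - s j x)"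
        using L2_Cauchy_Schwarz[OF L2_diff[OF f(1) s] e_L2 sqnorm_e, of j i] by simp
    qed
    then have "(norm (L2_inner M f (e i) - c i))\<^sup>2 \<le> 0"
      using f(2) by (intro tendsto_le[OF _ f(2) tendsto_const]) auto
    then show ?thesis by simp
  qed
  have "(\<lambda>j. sqnorm M f - (\<Sum>i<r j. (norm (c i))\<^sup>2)) \<longlonglongrightarrow> 0"
    using f(2) sqnorm_diff_comb[OF f(1) finite_lessThan] unfolding s_def coeff by simp
  moreover have "(\<lambda>j. sqnorm M f - (\<Sum>i<r j. (norm (c i))\<^sup>2)) \<longlonglongrightarrow> sqnorm M f - (\<Sum>i. (norm (c i))\<^sup>2)"
  proof (intro tendsto_intros filterlim_compose[OF summable_LIMSEQ[OF c]])
    show "filterlim r at_top sequentially"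
      by (rule filterlim_at_top_mono[OF filterlim_ident]) (use rj in auto)
  qed
  ultimately have "sqnorm M f = (\<Sum>i. (norm (c i))\<^sup>2)"
    using LIMSEQ_unique by fastforce
  with f(1) coeff show ?thesis by (rule that)
qed

end

locale orthonormal_basis_L2 = orthonormal_L2 +
  assumes total: "f \<in> L2 M \<Longrightarrow> (\<And>i. L2_inner M f (e i) = 0) \<Longrightarrow> AE x in M. f x = 0"
begin

lemma coeff_unique:
  assumes "f \<in> L2 M" "g \<in> L2 M" "\<And>i. L2_inner M f (e i) = L2_inner M g (e i)"
  shows "AE x in M. f x = g x"
proof -
  have "AE x in M. f x - g x = 0"
    using assms by (intro total L2_diff) (simp_all add: L2_inner_diff_left e_L2)
  then show ?thesis by simp
qed

text \<open>Riesz-Fischer builds a function with the same coefficients for which the equality holds,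
  and totality identifies it with \<open>f\<close> almost everywhere.\<close>

lemma Parseval:
  assumes f: "f \<in> L2 M"
  shows "sqnorm M f = (\<Sum>i. (norm (L2_inner M f (e i)))\<^sup>2)"
proof -
  obtain g where g: "g \<in> L2 M" "\<And>i. L2_inner M g (e i) = L2_inner M f (e i)"
      "sqnorm M g = (\<Sum>i. (norm (L2_inner M f (e i)))\<^sup>2)"
    using Riesz_Fischer[OF Bessel_summable[OF f]] by blast
  then show ?thesis
    using sqnorm_cong_AE[OF f g(1) coeff_unique[OF f g(1)]] by simp
qed

end

lemma Re_L2_inner_polarization:
  assumes "f \<in> L2 M" "g \<in> L2 M"
  shows "2 * Re (L2_inner M f g) = sqnorm M (\<lambda>x. f x + g x) - sqnorm M f - sqnorm M g"
proof -
  have "sqnorm M (\<lambda>x. f x - (- 1) * g x) = sqnorm M f + sqnorm M (\<lambda>x. (- 1) * g x) - 2 * Re (L2_inner M f (\<lambda>x. (- 1) * g x))"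
    using assms by (intro sqnorm_diff L2_cmult)
  moreover have "L2_inner M f (\<lambda>x. (- 1) * g x) = - L2_inner M f g"
    by (simp add: L2_inner_def)
  ultimately show ?thesis by simp
qed

text \<open>\<open>U\<close> is chosen by matching coefficients, so each linear law holds almost
  everywhere by uniqueness of coefficients in the second basis. Parseval's equality preserves norms;
  polarization gives the real part of inner products, and applied to i f the imaginary part.\<close>

theorem unitary_L2_of_bases:
  assumes "orthonormal_basis_L2 M e" "orthonormal_basis_L2 M e'"
  obtains U where "unitary_L2 M U"
    "\<And>f i. f \<in> L2 M \<Longrightarrow> L2_inner M (U f) (e' i) = L2_inner M f (e i)"
proof -
  interpret e: orthonormal_basis_L2 M e by fact
  interpret e': orthonormal_basis_L2 M e' by fact
  define U where "U f = (SOME h. h \<in> L2 M \<and> (\<forall>i. L2_inner M h (e' i) = L2_inner M f (e i)))" for f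
  have U: "U f \<in> L2 M \<and> (\<forall>i. L2_inner M (U f) (e' i) = L2_inner M f (e i))" if "f \<in> L2 M" for f
  proof -
    have "\<exists>h. h \<in> L2 M \<and> (\<forall>i. L2_inner M h (e' i) = L2_inner M f (e i))"
      using e'.Riesz_Fischer[OF e.Bessel_summable[OF that]] by blast
    then show ?thesis unfolding U_def by (rule someI_ex)
  qed
  have U_L2: "U f \<in> L2 M" if "f \<in> L2 M" for f
    using U[OF that] by simp
  have U_coeff: "L2_inner M (U f) (e' i) = L2_inner M f (e i)" if "f \<in> L2 M" for f i
    using U[OF that] by simp
  have U_AE: "AE x in M. U f x = U g x" if "f \<in> L2 M" "g \<in> L2 M" "AE x in M. f x = g x" for f g
  proof (rule e'.coeff_unique[OF U_L2[OF that(1)] U_L2[OF that(2)]])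
    show "L2_inner M (U f) (e' i) = L2_inner M (U g) (e' i)" for i
      unfolding U_coeff[OF that(1)] U_coeff[OF that(2)] by (rule L2_inner_cong_AE[OF that(1,2) e.e_L2 that(3)])
  qed
  have U_add: "AE x in M. U (\<lambda>y. f y + g y) x = U f x + U g x" if "f \<in> L2 M" "g \<in> L2 M" for f g
  proof (rule e'.coeff_unique[OF U_L2[OF L2_add[OF that]] L2_add[OF U_L2[OF that(1)] U_L2[OF that(2)]]])
    show "L2_inner M (U (\<lambda>y. f y + g y)) (e' i) = L2_inner M (\<lambda>x. U f x + U g x) (e' i)" for i
      unfolding U_coeff[OF L2_add[OF that]] L2_inner_add_left[OF U_L2[OF that(1)] U_L2[OF that(2)] e'.e_L2]
        U_coeff[OF that(1)] U_coeff[OF that(2)]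
      by (rule L2_inner_add_left[OF that e.e_L2])
  qed
  have U_cmult: "AE x in M. U (\<lambda>y. c * f y) x = c * U f x" if "f \<in> L2 M" for f c
  proof (rule e'.coeff_unique[OF U_L2[OF L2_cmult[OF that]] L2_cmult[OF U_L2[OF that]]])
    show "L2_inner M (U (\<lambda>y. c * f y)) (e' i) = L2_inner M (\<lambda>x. c * U f x) (e' i)" for i
      unfolding U_coeff[OF L2_cmult[OF that]] L2_inner_cmult_left U_coeff[OF that] ..
  qed
  have U_norm: "sqnorm M (U f) = sqnorm M f" if "f \<in> L2 M" for f
    using e.Parseval[OF that] e'.Parseval[OF U_L2[OF that]] U_coeff[OF that] by simp
  have U_Re: "Re (L2_inner M (U f) (U g)) = Re (L2_inner M f g)" if "f \<in> L2 M" "g \<in> L2 M" for f g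
  proof -
    have "sqnorm M (\<lambda>x. U f x + U g x) = sqnorm M (U (\<lambda>x. f x + g x))"
    proof (rule sqnorm_cong_AE[OF L2_add[OF U_L2[OF that(1)] U_L2[OF that(2)]] U_L2[OF L2_add[OF that]]])
      show "AE x in M. U f x + U g x = U (\<lambda>x. f x + g x) x"
        using U_add[OF that] by eventually_elim simp
    qed
    then show ?thesis
      using Re_L2_inner_polarization[OF that] Re_L2_inner_polarization[OF U_L2[OF that(1)] U_L2[OF that(2)]] that
      by (simp add: U_norm L2_add)
  qed
  have U_inner: "L2_inner M (U f) (U g) = L2_inner M f g" if f: "f \<in> L2 M" and g: "g \<in> L2 M" for f g
  proof (rule complex_eqI)
    show "Re (L2_inner M (U f) (U g)) = Re (L2_inner M f g)"
      by (rule U_Re[OF f g])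
    have "L2_inner M (U (\<lambda>x. \<i> * f x)) (U g) = L2_inner M (\<lambda>x. \<i> * U f x) (U g)"
      by (rule L2_inner_cong_AE[OF U_L2[OF L2_cmult[OF f]] L2_cmult[OF U_L2[OF f]] U_L2[OF g] U_cmult[OF f]])
    then have "Re (\<i> * L2_inner M (U f) (U g)) = Re (\<i> * L2_inner M f g)"
      using U_Re[OF L2_cmult[OF f, of \<i>] g] by (simp only: L2_inner_cmult_left)
    then show "Im (L2_inner M (U f) (U g)) = Im (L2_inner M f g)" by simp
  qed
  have U_surj: "\<exists>f \<in> L2 M. AE x in M. U f x = h x" if h: "h \<in> L2 M" for h
  proof -
    obtain f where f: "f \<in> L2 M" "\<And>i. L2_inner M f (e i) = L2_inner M h (e' i)"
      using e.Riesz_Fischer[OF e'.Bessel_summable[OF h]] by blast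
    then have "AE x in M. U f x = h x"
      by (intro e'.coeff_unique[OF U_L2[OF f(1)] h]) (simp add: U_coeff)
    with f(1) show ?thesis by blast
  qed
  have "unitary_L2 M U"
    unfolding unitary_L2_def by (intro conjI ballI allI impI U_L2 U_AE U_add U_cmult U_inner U_surj)
  then show ?thesis using U_coeff by (rule that)
qed

section \<open>Completeness of the trigonometric system\<close>

text \<open>To be used on mu itself, with \<open>u\<close> the angular variable of one circle, which
  avoids transporting functions to a standard circle. The aim is that a function orthogonal to all
  powers of \<open>u\<close> has integral 0 over the preimage under \<open>u\<close> of every Borel
  set.\<close>

locale trig_orthogonal =
  fixes M :: "'a measure" and u :: "'a \<Rightarrow> complex"
  assumes u_measurable: "u \<in> borel_measurable M" and norm_u: "norm (u x) = 1"
begin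

definition orth :: "('a \<Rightarrow> complex) \<Rightarrow> bool" where
  "orth g \<longleftrightarrow> integrable M g \<and> (\<forall>l::int. (\<integral>x. g x * u x powi l \<partial>M) = 0)"

lemma u_nonzero: "u x \<noteq> 0"
  using norm_u[of x] by auto

lemma integrable_mult_continuous:
  fixes g :: "'a \<Rightarrow> complex" and p :: "complex \<Rightarrow> real"
  assumes g: "integrable M g" and p: "continuous_on UNIV p"
  shows "integrable M (\<lambda>x. g x * of_real (p (u x)))"
proof -
  have "bounded (p ` sphere 0 1)"
    using p by (intro compact_imp_bounded compact_continuous_image) (auto intro: continuous_on_subset)
  then obtain K where K: "\<forall>z \<in> sphere 0 1. norm (p z) \<le> K"
    by (auto simp: bounded_iff)
  show ?thesis
  proof (rule Bochner_Integration.integrable_bound)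
    show "integrable M (\<lambda>x. K * norm (g x))"
      using g by auto
    have "(\<lambda>x. p (u x)) \<in> borel_measurable M"
      by (rule measurable_compose[OF u_measurable]) (rule borel_measurable_continuous_onI[OF p])
    then show "(\<lambda>x. g x * of_real (p (u x))) \<in> borel_measurable M"
      using borel_measurable_integrable[OF g] by measurable
    show "AE x in M. norm (g x * of_real (p (u x))) \<le> norm (K * norm (g x))"
    proof (rule AE_I2)
      fix x
      have "norm (p (u x)) \<le> K" using norm_u K by simp
      then have "norm (p (u x)) * norm (g x) \<le> K * norm (g x)"
        by (rule mult_right_mono) simp
      also have "\<dots> \<le> norm (K * norm (g x))" by simp
      finally show "norm (g x * of_real (p (u x))) \<le> norm (K * norm (g x))"
        by (simp only: norm_mult norm_of_real real_norm_def mult.commute)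
    qed
  qed
qed

lemma integrable_mult_u_powi:
  assumes "integrable M g"
  shows "integrable M (\<lambda>x. g x * u x powi l)"
proof (rule Bochner_Integration.integrable_bound[OF assms])
  have "(\<lambda>x. u x powi l) \<in> borel_measurable M"
  proof (cases "0 \<le> l")
    case True
    then show ?thesis
      using u_measurable unfolding power_int_def by simp
  next
    case False
    then show ?thesis
      using u_measurable unfolding power_int_def by simp
  qed
  then show "(\<lambda>x. g x * u x powi l) \<in> borel_measurable M"
    using borel_measurable_integrable[OF assms] by measurable
qed (simp add: norm_mult norm_power_int norm_u)

text \<open>On the unit circle a real-linear functional is a combination of \<open>u\<close> and its
  inverse conj(u), so multiplication by it only shifts exponents.\<close>

lemma orth_linear:
  assumes p: "bounded_linear p" and g: "orth g"
  shows "orth (\<lambda>x. g x * of_real (p (u x)))"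
proof -
  interpret p: bounded_linear p by fact
  define a b where "a = (of_real (p 1) - \<i> * of_real (p \<i>)) / 2" and "b = (of_real (p 1) + \<i> * of_real (p \<i>)) / 2"
  have int: "integrable M g" using g by (simp add: orth_def)
  have pu: "of_real (p (u x)) = a * u x powi 1 + b * u x powi (- 1)" for x
  proof -
    have inv: "u x powi (- 1) = cnj (u x)"
      using cnj_unit_powi[OF norm_u, of x 1] by simp
    have "u x = Re (u x) *\<^sub>R 1 + Im (u x) *\<^sub>R \<i>"
      by (simp add: complex_eq_iff)
    then have "p (u x) = Re (u x) * p 1 + Im (u x) * p \<i>"
      by (metis p.add p.scaleR real_scaleR_def)
    then show ?thesis
      unfolding inv a_def b_def by (simp add: complex_eq_iff field_simps)
  qed
  have int': "integrable M (\<lambda>x. a * (g x * u x powi (l + 1)) + b * (g x * u x powi (l - 1)))" for l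
    by (intro Bochner_Integration.integrable_add integrable_mult_right integrable_mult_u_powi int)
  have eq: "g x * of_real (p (u x)) * u x powi l = a * (g x * u x powi (l + 1)) + b * (g x * u x powi (l - 1))" for l x
    unfolding pu using u_nonzero[of x]
    by (simp add: power_int_add power_int_diff power_int_minus divide_inverse algebra_simps)
  have "(\<integral>x. g x * of_real (p (u x)) * u x powi l \<partial>M) = 0" for l
  proof -
    have "(\<integral>x. g x * of_real (p (u x)) * u x powi l \<partial>M) =
        (\<integral>x. a * (g x * u x powi (l + 1)) \<partial>M) + (\<integral>x. b * (g x * u x powi (l - 1)) \<partial>M)"
      unfolding eq
      by (intro Bochner_Integration.integral_add integrable_mult_right integrable_mult_u_powi int)
    then show ?thesis using g by (simp add: orth_def)
  qed
  moreover have "integrable M (\<lambda>x. g x * of_real (p (u x)))"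
    by (rule integrable_mult_continuous[OF int]) (rule p.continuous_on[OF continuous_on_id])
  ultimately show ?thesis by (simp add: orth_def)
qed

text \<open>The functions \<open>p\<close> for which multiplication by \<open>p(u)\<close> preserves orthogonality form an algebra.\<close>

lemma orth_polynomial:
  assumes "real_polynomial_function p" "orth g"
  shows "orth (\<lambda>x. g x * of_real (p (u x)))"
  using assms
proof (induction arbitrary: g)
  case (linear p)
  then show ?case by (rule orth_linear)
next
  case (const c)
  then show ?case
    by (simp add: orth_def mult.assoc mult.left_commute[of _ "of_real c"] mult.commute[of _ "of_real c"])
next
  case (add p1 p2)
  have 1: "orth (\<lambda>x. g x * of_real (p1 (u x)))" and 2: "orth (\<lambda>x. g x * of_real (p2 (u x)))"
    using add by auto
  have "(\<integral>x. g x * of_real (p1 (u x)) * u x powi l + g x * of_real (p2 (u x)) * u x powi l \<partial>M) =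
      (\<integral>x. g x * of_real (p1 (u x)) * u x powi l \<partial>M) + (\<integral>x. g x * of_real (p2 (u x)) * u x powi l \<partial>M)" for l
    using 1 2 by (intro Bochner_Integration.integral_add integrable_mult_u_powi) (auto simp: orth_def)
  moreover have "integrable M (\<lambda>x. g x * of_real (p1 (u x)) + g x * of_real (p2 (u x)))"
    using 1 2 by (intro Bochner_Integration.integrable_add) (auto simp: orth_def)
  ultimately show ?case
    using 1 2 by (simp add: orth_def distrib_left distrib_right)
next
  case (mult p1 p2)
  have "orth (\<lambda>x. g x * of_real (p1 (u x)) * of_real (p2 (u x)))"
    by (intro mult.IH mult.prems)
  then show ?case by (simp add: mult.assoc)
qed

text \<open>By Stone-Weierstrass on the unit circle, \<open>p\<close> is uniformly close to a
  polynomial, and the integral against the polynomial vanishes.\<close>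

lemma integral_continuous_eq_0:
  assumes g: "orth g" and p: "continuous_on UNIV p"
  shows "(\<integral>x. g x * of_real (p (u x)) \<partial>M) = 0"
proof -
  have int: "integrable M g" using g by (simp add: orth_def)
  have bound: "norm (\<integral>x. g x * of_real (p (u x)) \<partial>M) \<le> 0 + e * (\<integral>x. norm (g x) \<partial>M)" if e: "0 < e" for e
  proof -
    obtain r where r: "real_polynomial_function r" "\<And>z. z \<in> sphere 0 1 \<Longrightarrow> \<bar>p z - r z\<bar> < e"
      by (rule Stone_Weierstrass_real_polynomial_function[OF compact_sphere continuous_on_subset[OF p subset_UNIV] e])
      blast
    have o: "orth (\<lambda>x. g x * of_real (r (u x)))"
      by (rule orth_polynomial[OF r(1) g])
    then have r_int: "integrable M (\<lambda>x. g x * of_real (r (u x)))" and "(\<integral>x. g x * of_real (r (u x)) * u x powi 0 \<partial>M) = 0"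
      unfolding orth_def by blast+
    then have r0: "(\<integral>x. g x * of_real (r (u x)) \<partial>M) = 0" by simp
    have "(\<integral>x. g x * of_real (p (u x)) - g x * of_real (r (u x)) \<partial>M) =
        (\<integral>x. g x * of_real (p (u x)) \<partial>M) - (\<integral>x. g x * of_real (r (u x)) \<partial>M)"
      by (rule Bochner_Integration.integral_diff[OF integrable_mult_continuous[OF int p] r_int])
    then have "norm (\<integral>x. g x * of_real (p (u x)) \<partial>M) =
        norm (\<integral>x. g x * of_real (p (u x)) - g x * of_real (r (u x)) \<partial>M)"
      unfolding r0 by simp
    also have "\<dots> \<le> (\<integral>x. norm (g x * of_real (p (u x)) - g x * of_real (r (u x))) \<partial>M)"
      by (rule integral_norm_bound)
    also have "\<dots> \<le> (\<integral>x. e * norm (g x) \<partial>M)"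
    proof (rule Bochner_Integration.integral_mono)
      show "integrable M (\<lambda>x. norm (g x * of_real (p (u x)) - g x * of_real (r (u x))))"
        by (intro integrable_norm Bochner_Integration.integrable_diff integrable_mult_continuous[OF int p] r_int)
      show "integrable M (\<lambda>x. e * norm (g x))"
        using int by auto
      fix x
      have "g x * of_real (p (u x)) - g x * of_real (r (u x)) = of_real (p (u x) - r (u x)) * g x"
        by (simp add: algebra_simps)
      then have "norm (g x * of_real (p (u x)) - g x * of_real (r (u x))) = \<bar>p (u x) - r (u x)\<bar> * norm (g x)"
        by (simp only: norm_mult norm_of_real)
      also have "\<dots> \<le> e * norm (g x)"
        using r(2)[of "u x"] norm_u[of x] by (intro mult_right_mono) auto
      finally show "norm (g x * of_real (p (u x)) - g x * of_real (r (u x))) \<le> e * norm (g x)" .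
    qed
    also have "(\<integral>x. e * norm (g x) \<partial>M) = e * (\<integral>x. norm (g x) \<partial>M)"
      by (rule integral_mult_right_zero)
    finally show ?thesis by (simp only: add_0)
  qed
  have "norm (\<integral>x. g x * of_real (p (u x)) \<partial>M) \<le> 0"
  proof (rule field_le_epsilon)
    define K where "K = (\<integral>x. norm (g x) \<partial>M)"
    have K: "0 \<le> K" by (simp add: K_def)
    fix e :: real assume "0 < e"
    then have "norm (\<integral>x. g x * of_real (p (u x)) \<partial>M) \<le> 0 + e / (K + 1) * K"
      using bound[of "e / (K + 1)"] K unfolding K_def by simp
    also have "e / (K + 1) * K \<le> e"
      using K \<open>0 < e\<close> by (simp add: field_simps)
    finally show "norm (\<integral>x. g x * of_real (p (u x)) \<partial>M) \<le> 0 + e" by simp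
  qed
  then show ?thesis by simp
qed

text \<open>The continuous functions max(0, 1 - n dist(z, C)) converge to the indicator of
  \<open>C\<close> because \<open>C\<close> is closed; dominated convergence does the rest.\<close>

lemma integral_closed_eq_0:
  assumes g: "orth g" and C: "closed C"
  shows "(\<integral>x. g x * of_real (indicator C (u x)) \<partial>M) = 0"
proof (cases "C = {}")
  case False
  have int: "integrable M g" using g by (simp add: orth_def)
  define f where "f n z = max 0 (1 - real n * infdist z C)" for n z
  have f: "continuous_on UNIV (f n)" for n
    unfolding f_def by (intro continuous_intros)
  have lim: "(\<lambda>n. f n z) \<longlonglongrightarrow> indicator C z" for z
  proof (cases "z \<in> C")
    case True
    then show ?thesis by (simp add: f_def)
  next
    case False
    then have pos: "0 < infdist z C"
      using C \<open>C \<noteq> {}\<close> by (simp add: infdist_pos_not_in_closed)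
    obtain N where N: "1 < real N * infdist z C"
      using pos reals_Archimedean3 by blast
    have "eventually (\<lambda>n. f n z = 0) sequentially"
    proof (rule eventually_sequentiallyI)
      fix n assume "N \<le> n"
      then have "real N * infdist z C \<le> real n * infdist z C"
        using pos by (intro mult_right_mono) auto
      with N show "f n z = 0" by (simp add: f_def)
    qed
    then show ?thesis using False by (simp add: tendsto_eventually)
  qed
  have "(\<lambda>n. \<integral>x. g x * of_real (f n (u x)) \<partial>M) \<longlonglongrightarrow> (\<integral>x. g x * of_real (indicator C (u x)) \<partial>M)"
  proof (rule integral_dominated_convergence[where w = "\<lambda>x. norm (g x)"])
    show "(\<lambda>x. g x * of_real (f n (u x))) \<in> borel_measurable M" for n
      by (rule borel_measurable_integrable[OF integrable_mult_continuous[OF int f]])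
    have "(\<lambda>x. indicator C (u x) :: real) \<in> borel_measurable M"
      by (rule measurable_compose[OF u_measurable]) (use C in simp)
    then show "(\<lambda>x. g x * of_real (indicator C (u x))) \<in> borel_measurable M"
      using borel_measurable_integrable[OF int] by measurable
    show "AE x in M. (\<lambda>n. g x * of_real (f n (u x))) \<longlonglongrightarrow> g x * of_real (indicator C (u x))"
      by (intro AE_I2 tendsto_intros lim)
    have "\<bar>f n z\<bar> \<le> 1" for n z
      by (auto simp: f_def infdist_nonneg)
    then show "AE x in M. norm (g x * of_real (f n (u x))) \<le> norm (g x)" for n
      by (intro AE_I2) (simp add: norm_mult mult_left_le)
  qed (use int in auto)
  then show ?thesis
    unfolding integral_continuous_eq_0[OF g f] by (simp add: LIMSEQ_const_iff)
qed simp

text \<open>Closed sets are stable under intersection and generate the Borel sets. Complements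
  follow by linearity, as the integral of \<open>g\<close> itself is 0, and disjoint unions by
  dominated convergence.\<close>

lemma integral_borel_eq_0:
  assumes g: "orth g" and B: "B \<in> sets borel"
  shows "(\<integral>x. g x * of_real (indicator B (u x)) \<partial>M) = 0"
proof -
  have int: "integrable M g" using g by (simp add: orth_def)
  have ind: "(\<lambda>x. of_real (indicator A (u x)) :: complex) \<in> borel_measurable M" if "A \<in> sets borel" for A
  proof -
    have "(\<lambda>x. indicator A (u x) :: real) \<in> borel_measurable M"
      by (rule measurable_compose[OF u_measurable]) (use that in simp)
    then show ?thesis by measurable
  qed
  have int_ind: "integrable M (\<lambda>x. g x * of_real (indicator A (u x)))" if "A \<in> sets borel" for A
    by (rule Bochner_Integration.integrable_bound[OF int])
      (use ind[OF that] borel_measurable_integrable[OF int] in \<open>auto simp: norm_mult indicator_def\<close>)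
  have borel: "sigma_sets UNIV (Collect closed) = sets (borel :: complex measure)"
    by (subst borel_eq_closed) simp
  have "Int_stable (Collect closed :: complex set set)"
    by (auto simp: Int_stable_def)
  moreover have "Collect closed \<subseteq> Pow (UNIV :: complex set)" by simp
  moreover have "B \<in> sigma_sets UNIV (Collect closed)"
    using B borel by simp
  ultimately show ?thesis
  proof (induction rule: sigma_sets_induct_disjoint)
    case (basic A)
    then show ?case using integral_closed_eq_0[OF g] by simp
  next
    case empty
    then show ?case by simp
  next
    case (compl A)
    then have A: "A \<in> sets borel" by (simp add: borel)
    have "(\<integral>x. g x * of_real (indicator (UNIV - A) (u x)) \<partial>M) =
        (\<integral>x. g x - g x * of_real (indicator A (u x)) \<partial>M)"
      by (rule Bochner_Integration.integral_cong) (auto simp: indicator_def)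
    also have "\<dots> = (\<integral>x. g x \<partial>M) - (\<integral>x. g x * of_real (indicator A (u x)) \<partial>M)"
      by (rule Bochner_Integration.integral_diff[OF int int_ind[OF A]])
    also have "(\<integral>x. g x \<partial>M) = 0"
      using integral_closed_eq_0[OF g closed_UNIV] by simp
    finally show ?case using compl.IH by simp
  next
    case (union A)
    then have A: "A i \<in> sets borel" for i
      using borel by auto
    have sum_ind: "(\<Sum>i<n. indicator (A i) z) = (indicator (\<Union>i<n. A i) z :: real)" for n z
    proof (rule indicator_UN_disjoint[symmetric])
      show "disjoint_family_on A {..<n}"
        using union.hyps(1) by (rule disjoint_family_on_mono[OF subset_UNIV])
    qed simp
    have "(\<lambda>n. \<integral>x. g x * of_real (\<Sum>i<n. indicator (A i) (u x)) \<partial>M) \<longlonglongrightarrow>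
        (\<integral>x. g x * of_real (indicator (\<Union>i. A i) (u x)) \<partial>M)"
    proof (rule integral_dominated_convergence[where w = "\<lambda>x. norm (g x)"])
      show "(\<lambda>x. g x * of_real (indicator (\<Union>i. A i) (u x))) \<in> borel_measurable M"
        using A by (intro borel_measurable_integrable int_ind) auto
      show "(\<lambda>x. g x * of_real (\<Sum>i<n. indicator (A i) (u x))) \<in> borel_measurable M" for n
        unfolding sum_ind using A by (intro borel_measurable_integrable int_ind) auto
      show "AE x in M. (\<lambda>n. g x * of_real (\<Sum>i<n. indicator (A i) (u x))) \<longlonglongrightarrow> g x * of_real (indicator (\<Union>i. A i) (u x))"
        unfolding sum_ind by (intro AE_I2 tendsto_intros LIMSEQ_indicator_UN)
      show "AE x in M. norm (g x * of_real (\<Sum>i<n. indicator (A i) (u x))) \<le> norm (g x)" for n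
        unfolding sum_ind by (intro AE_I2) (simp add: indicator_def)
    qed (use int in auto)
    moreover have "(\<integral>x. g x * of_real (\<Sum>i<n. indicator (A i) (u x)) \<partial>M) = 0" for n
    proof -
      have "(\<integral>x. g x * of_real (\<Sum>i<n. indicator (A i) (u x)) \<partial>M) =
          (\<integral>x. (\<Sum>i<n. g x * of_real (indicator (A i) (u x))) \<partial>M)"
        by (simp add: sum_distrib_left)
      also have "\<dots> = (\<Sum>i<n. \<integral>x. g x * of_real (indicator (A i) (u x)) \<partial>M)"
        by (rule Bochner_Integration.integral_sum) (use A int_ind in auto)
      finally show ?thesis using union.IH by simp
    qed
    ultimately show ?case by (simp add: LIMSEQ_const_iff)
  qed
qed

end

text \<open>Testing on the set where the function is positive shows that it is at most 0; this is
  applied to \<open>h\<close> and to \<open>- h\<close>.\<close>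

lemma AE_zero_of_set_integrals_real:
  fixes h :: "'a \<Rightarrow> real"
  assumes h: "integrable M h" and z: "\<And>A. A \<in> sets M \<Longrightarrow> (\<integral>x. h x * indicator A x \<partial>M) = 0"
  shows "AE x in M. h x = 0"
proof -
  have hm [measurable]: "h \<in> borel_measurable M"
    using h by (rule borel_measurable_integrable)
  have pos: "AE x in M. f x \<le> 0"
    if f: "integrable M f" and fz: "\<And>A. A \<in> sets M \<Longrightarrow> (\<integral>x. f x * indicator A x \<partial>M) = 0" for f :: "'a \<Rightarrow> real"
  proof -
    have fm [measurable]: "f \<in> borel_measurable M"
      using f by (rule borel_measurable_integrable)
    define A where "A = {x \<in> space M. 0 < f x}"
    have A: "A \<in> sets M" unfolding A_def by measurable
    have "AE x in M. f x * indicator A x = 0"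
    proof (subst integral_nonneg_eq_0_iff_AE[symmetric])
      show "integrable M (\<lambda>x. f x * indicator A x)"
        by (rule integrable_real_mult_indicator[OF A f])
      show "AE x in M. 0 \<le> f x * indicator A x"
        by (intro AE_I2) (auto simp: A_def indicator_def)
    qed (rule fz[OF A])
    with AE_space show ?thesis
      by eventually_elim (auto simp: A_def indicator_def split: if_splits)
  qed
  have "AE x in M. - h x \<le> 0"
    using h z by (intro pos) auto
  moreover have "AE x in M. h x \<le> 0"
    using h z by (rule pos)
  ultimately show ?thesis
    by eventually_elim simp
qed

lemma AE_zero_of_set_integrals:
  fixes g :: "'a \<Rightarrow> complex"
  assumes g: "integrable M g" and z: "\<And>A. A \<in> sets M \<Longrightarrow> (\<integral>x. g x * of_real (indicator A x) \<partial>M) = 0"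
  shows "AE x in M. g x = 0"
proof -
  have int: "integrable M (\<lambda>x. g x * of_real (indicator A x))" if A: "A \<in> sets M" for A
    by (rule Bochner_Integration.integrable_bound[OF g])
      (use A borel_measurable_integrable[OF g] in \<open>auto simp: norm_mult indicator_def\<close>)
  have "AE x in M. Re (g x) = 0"
  proof (rule AE_zero_of_set_integrals_real[OF integrable_Re[OF g]])
    fix A assume A: "A \<in> sets M"
    show "(\<integral>x. Re (g x) * indicator A x \<partial>M) = 0"
      using integral_Re[OF int[OF A]] z[OF A] by simp
  qed
  moreover have "AE x in M. Im (g x) = 0"
  proof (rule AE_zero_of_set_integrals_real[OF integrable_Im[OF g]])
    fix A assume A: "A \<in> sets M"
    show "(\<integral>x. Im (g x) * indicator A x \<partial>M) = 0"
      using integral_Im[OF int[OF A]] z[OF A] by simp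
  qed
  ultimately show ?thesis
    by eventually_elim (simp add: complex_eq_iff)
qed

context q_parameter
begin

section \<open>Unitarity\<close>

lemma angular_L2:
  assumes f: "angular l c f" "f \<in> borel_measurable (mu q)"
    and c: "(\<lambda>n. q powi (2 * n) * (c n)\<^sup>2) summable_on UNIV"
  shows "f \<in> L2 (mu q)"
proof -
  have "integrable (mu q) (\<lambda>z. (norm (f z))\<^sup>2)"
  proof (rule integrable_muI[OF _ _ c])
    show "(\<lambda>z. (norm (f z))\<^sup>2) \<in> borel_measurable (mu q)"
      using f(2) by measurable
    show "AE \<phi> in circ. norm ((norm (f (of_real (q powi k) * cis \<phi>)))\<^sup>2) \<le> (c k)\<^sup>2" for k
      using angularD[OF f(1)] by (intro AE_I2) (simp add: norm_mult norm_power_int)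
  qed
  with f(2) show ?thesis by (simp add: L2_def)
qed

lemma L2_inner_angular_right:
  assumes f: "f \<in> L2 (mu q)" and g: "angular l c g" "g \<in> L2 (mu q)"
  shows "((\<lambda>n. of_real (q powi (2 * n) * c n) * (\<integral>\<phi>. f (of_real (q powi n) * cis \<phi>) * cis \<phi> powi (- l) \<partial>circ))
    has_sum L2_inner (mu q) f g) UNIV"
proof -
  have sect: "f (of_real (q powi n) * cis \<phi>) * cnj (g (of_real (q powi n) * cis \<phi>)) =
      of_real (c n) * (f (of_real (q powi n) * cis \<phi>) * cis \<phi> powi (- l))" for n \<phi>
    unfolding angularD[OF g(1) norm_cis] using cnj_unit_powi[OF norm_cis, of \<phi> l]
    by (simp add: mult_ac)
  from integral_mu_has_sum[OF L2_product_integrable[OF f g(2)]]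
  show ?thesis
    unfolding L2_inner_def[symmetric] sect integral_mult_right_zero
    by (simp add: scaleR_conv_of_real mult.assoc)
qed

lemma L2_inner_angular:
  assumes f: "angular l c f" "f \<in> L2 (mu q)" and g: "angular l' c' g" "g \<in> L2 (mu q)"
  shows "((\<lambda>n. of_real (q powi (2 * n) * c n * c' n * (if l = l' then 1 else 0))) has_sum L2_inner (mu q) f g) UNIV"
proof -
  have "(\<integral>\<phi>. f (of_real (q powi n) * cis \<phi>) * cis \<phi> powi (- l') \<partial>circ) = of_real (c n * (if l = l' then 1 else 0))" for n
  proof -
    have "f (of_real (q powi n) * cis \<phi>) * cis \<phi> powi (- l') = of_real (c n) * cis \<phi> powi (l - l')" for \<phi>
      unfolding angularD[OF f(1) norm_cis] by (simp add: power_int_diff power_int_minus divide_inverse)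
    then show ?thesis by (simp add: integral_cis_powi_circ)
  qed
  then have e: "of_real (q powi (2 * n) * c' n) * (\<integral>\<phi>. f (of_real (q powi n) * cis \<phi>) * cis \<phi> powi (- l') \<partial>circ) =
      of_real (q powi (2 * n) * c n * c' n * (if l = l' then 1 else 0))" for n
    by (simp only: of_real_mult mult_ac)
  show ?thesis
    using L2_inner_angular_right[OF f(2) g] unfolding e .
qed

text \<open>The circle of radius q^k has mass q^(2k), so q^(-k) normalises g_kl.\<close>

definition source_basis :: "int \<times> int \<Rightarrow> complex \<Rightarrow> complex" where
  "source_basis p z = of_real (q powi (- fst p)) * gkl q (fst p) (snd p) z"

text \<open>The image of \<open>source_basis p\<close> under \<open>q\<^sup>-\<^sup>1 \<F> \<sigma>\<^sub>i\<close>, as \<open>\<sigma>\<^sub>i\<close> multiplies \<open>g\<^sub>k\<^sub>l\<close> by \<open>q\<^sup>l\<close>.\<close>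

definition target_basis :: "int \<times> int \<Rightarrow> complex \<Rightarrow> complex" where
  "target_basis p z = of_real (q powi (snd p - 1 - fst p)) * fourier q (gkl q (fst p) (snd p)) z"

lemma angular_scale: "angular l c f \<Longrightarrow> angular l (\<lambda>n. a * c n) (\<lambda>z. of_real a * f z)"
  by (simp add: angular_def mult.assoc)

lemma angular_source: "angular l (\<lambda>n. if n = k then q powi (- k) else 0) (source_basis (k, l))"
proof -
  have "angular l (\<lambda>n. q powi (- k) * (if n = k then 1 else 0)) (source_basis (k, l))"
    using angular_scale[OF angular_gkl[of l k], of "q powi (- k)"] by (simp add: source_basis_def[abs_def])
  then show ?thesis by (rule angular_cong) auto
qed

lemma angular_target: "angular (- l) (\<lambda>n. q powi (- n) * hankel l (n + k)) (target_basis (k, l))"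
proof -
  have "angular (- l) (\<lambda>n. q powi (l - 1 - k) * (q powi (2 * k) * qJ (- l) (n + k))) (target_basis (k, l))"
    unfolding target_basis_def[abs_def] fst_conv snd_conv by (rule angular_scale[OF fourier_gkl_angular])
  moreover have "q powi (l - 1 - k) * (q powi (2 * k) * qJ (- l) (n + k)) = q powi (- n) * hankel l (n + k)" for n
  proof -
    have "q powi (l - 1 - k) * q powi (2 * k) = q powi (- n) * q powi (l - 1 + (n + k))"
      unfolding q_powi_add[symmetric] by (simp add: algebra_simps)
    then show ?thesis by (simp add: hankel_def mult.assoc[symmetric])
  qed
  ultimately show ?thesis by (rule angular_cong) auto
qed

lemma powi_double_mult_inverse_square: "q powi (2 * n) * (q powi (- n) * x) * (q powi (- n) * y) = x * y"
proof -
  have "q powi (2 * n) * q powi (- n) * q powi (- n) = 1"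
    unfolding q_powi_add[symmetric] by simp
  then have "(q powi (2 * n) * q powi (- n) * q powi (- n)) * (x * y) = x * y" by simp
  then show ?thesis by (simp only: mult_ac)
qed

lemma source_L2: "source_basis (k, l) \<in> L2 (mu q)"
proof (rule angular_L2[OF angular_source])
  show "source_basis (k, l) \<in> borel_measurable (mu q)"
    unfolding source_basis_def[abs_def] by (intro borel_measurable_times gkl_measurable) auto
  show "(\<lambda>n. q powi (2 * n) * (if n = k then q powi (- k) else 0)\<^sup>2) summable_on UNIV"
    by (rule finite_nonzero_values_imp_summable_on) (rule finite_subset[of _ "{k}"], auto)
qed

lemma target_L2: "target_basis (k, l) \<in> L2 (mu q)"
proof (rule angular_L2[OF angular_target])
  show "target_basis (k, l) \<in> borel_measurable (mu q)"
    unfolding target_basis_def[abs_def] by (intro borel_measurable_times fourier_gkl_measurable) auto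
  have "q powi (2 * n) * (q powi (- n) * hankel l (n + k))\<^sup>2 = hankel l (n + k) * hankel l (n + k)" for n
    using powi_double_mult_inverse_square[of n "hankel l (n + k)" "hankel l (n + k)"]
    by (simp only: power2_eq_square mult.assoc)
  then show "(\<lambda>n. q powi (2 * n) * (q powi (- n) * hankel l (n + k))\<^sup>2) summable_on UNIV"
    using has_sum_imp_summable[OF hankel_orthogonal[of l k k]] by simp
qed

lemma source_orthonormal:
  "L2_inner (mu q) (source_basis p) (source_basis p') = (if p = p' then 1 else 0)"
proof -
  obtain k l k' l' where p: "p = (k, l)" "p' = (k', l')" by fastforce
  have "((\<lambda>n. of_real (q powi (2 * n) * (if n = k then q powi (- k) else 0) * (if n = k' then q powi (- k') else 0) *
      (if l = l' then 1 else 0))) has_sum L2_inner (mu q) (source_basis p) (source_basis p')) UNIV"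
    unfolding p by (rule L2_inner_angular[OF angular_source source_L2 angular_source source_L2])
  moreover have "((\<lambda>n. of_real (q powi (2 * n) * (if n = k then q powi (- k) else 0) * (if n = k' then q powi (- k') else 0) *
      (if l = l' then 1 else 0)) :: complex) has_sum (if p = p' then 1 else 0)) UNIV"
  proof (rule has_sum_finite_neutralI[of "{k}"])
    show "(if p = p' then 1 else 0 :: complex) = (\<Sum>n\<in>{k}. of_real (q powi (2 * n) * (if n = k then q powi (- k) else 0) *
        (if n = k' then q powi (- k') else 0) * (if l = l' then 1 else 0)))"
      using powi_double_mult_inverse_square[of k 1 1] by (auto simp: p simp del: of_real_mult of_real_power_int)
  qed auto
  ultimately show ?thesis by (rule has_sum_unique)
qed

lemma target_orthonormal:
  "L2_inner (mu q) (target_basis p) (target_basis p') = (if p = p' then 1 else 0)"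
proof -
  obtain k l k' l' where p: "p = (k, l)" "p' = (k', l')" by fastforce
  have "((\<lambda>n. of_real (q powi (2 * n) * (q powi (- n) * hankel l (n + k)) * (q powi (- n) * hankel l' (n + k')) *
      (if - l = - l' then 1 else 0))) has_sum L2_inner (mu q) (target_basis p) (target_basis p')) UNIV"
    unfolding p by (rule L2_inner_angular[OF angular_target target_L2 angular_target target_L2])
  moreover have "((\<lambda>n. of_real (hankel l (n + k) * hankel l' (n + k') * (if - l = - l' then 1 else 0)) :: complex)
      has_sum (if p = p' then 1 else 0)) UNIV"
  proof (cases "l = l'")
    case True
    have "((\<lambda>n. of_real (hankel l (n + k) * hankel l (n + k')) :: complex) has_sum of_real (if k = k' then 1 else 0)) UNIV"
      by (intro has_sum_of_real hankel_orthogonal)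
    with True show ?thesis by (auto simp: p)
  qed (simp add: p)
  ultimately show ?thesis
    unfolding powi_double_mult_inverse_square by (rule has_sum_unique)
qed

text \<open>The Hankel matrix \<open>(hankel l (n + k))\<^sub>n\<^sub>k\<close> is its own inverse, also on bounded sequences.\<close>

lemma hankel_injective:
  fixes x :: "int \<Rightarrow> complex"
  assumes x: "\<And>n. norm (x n) \<le> C" and zero: "\<And>k. ((\<lambda>n. of_real (hankel l (n + k)) * x n) has_sum 0) UNIV"
  shows "x m = 0"
proof -
  \<comment> \<open>Summed over \<open>n\<close> first, \<open>F\<close> gives 0 by hypothesis;
    summed over \<open>k\<close> first, it gives \<open>x m\<close> by orthogonality. The bound on
    \<open>x\<close> and the absolute row sum \<open>S\<close>, the same for all rows, justify the
    exchange.\<close>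
  define F where "F k n = of_real (hankel l (m + k)) * (of_real (hankel l (n + k)) * x n)" for k n
  define S where "S = (\<Sum>\<^sub>\<infinity>j. \<bar>hankel l j\<bar>)"
  have abs_shift: "((\<lambda>n. \<bar>hankel l (n + k)\<bar>) has_sum S) UNIV" for k
    unfolding has_sum_shift_iff[of "\<lambda>n. \<bar>hankel l n\<bar>" k] S_def by (rule has_sum_infsum[OF summable_hankel])
  have dom: "(\<lambda>(k, n). \<bar>hankel l (m + k)\<bar> * (\<bar>hankel l (n + k)\<bar> * C)) summable_on UNIV \<times> UNIV"
  proof (rule summable_on_SigmaI)
    show "((\<lambda>n. case (k, n) of (k, n) \<Rightarrow> \<bar>hankel l (m + k)\<bar> * (\<bar>hankel l (n + k)\<bar> * C)) has_sum
        \<bar>hankel l (m + k)\<bar> * (S * C)) UNIV" for k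
      unfolding split_conv by (intro has_sum_cmult_right has_sum_cmult_left abs_shift)
    show "(\<lambda>k. \<bar>hankel l (m + k)\<bar> * (S * C)) summable_on UNIV"
      using has_sum_imp_summable[OF abs_shift[of m]] by (intro summable_on_cmult_left) (simp add: add.commute)
    show "0 \<le> (case (k, n) of (k, n) \<Rightarrow> \<bar>hankel l (m + k)\<bar> * (\<bar>hankel l (n + k)\<bar> * C))" for k n
      using order_trans[OF norm_ge_zero x] by simp
  qed
  have "(\<lambda>p. norm (case p of (k, n) \<Rightarrow> F k n)) summable_on UNIV \<times> UNIV"
  proof (rule abs_summable_on_le[OF dom])
    fix p :: "int \<times> int"
    obtain k n where p: "p = (k, n)" by fastforce
    show "norm (case p of (k, n) \<Rightarrow> F k n) \<le> (case p of (k, n) \<Rightarrow> \<bar>hankel l (m + k)\<bar> * (\<bar>hankel l (n + k)\<bar> * C))"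
      unfolding p split_conv F_def norm_mult norm_of_real by (intro mult_left_mono x) auto
  qed
  then have "(\<lambda>(k, n). F k n) summable_on UNIV \<times> UNIV"
    by (rule abs_summable_summable)
  then have "(\<Sum>\<^sub>\<infinity>k. \<Sum>\<^sub>\<infinity>n. F k n) = (\<Sum>\<^sub>\<infinity>n. \<Sum>\<^sub>\<infinity>k. F k n)"
    by (rule infsum_swap_banach)
  moreover have "(\<Sum>\<^sub>\<infinity>n. F k n) = 0" for k
    using has_sum_cmult_right[OF zero[of k], of "of_real (hankel l (m + k))"]
    unfolding F_def by (simp add: infsumI)
  moreover have "(\<Sum>\<^sub>\<infinity>k. F k n) = (if m = n then x n else 0)" for n
  proof (rule infsumI)
    have "((\<lambda>k. of_real (hankel l (k + m) * hankel l (k + n)) * x n) has_sum of_real (if m = n then 1 else 0) * x n) UNIV"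
      by (intro has_sum_cmult_left has_sum_of_real hankel_orthogonal)
    then show "((\<lambda>k. F k n) has_sum (if m = n then x n else 0)) UNIV"
      by (cases "m = n") (simp_all add: F_def add.commute mult.assoc)
  qed
  moreover have "(\<Sum>\<^sub>\<infinity>n. if m = n then x n else 0) = x m"
    by (rule infsumI, rule has_sum_finite_neutralI[of "{m}"]) auto
  ultimately show ?thesis by simp
qed

text \<open>The point 0 belongs to the space but lies on no circle, so an argument circle by circle
  has to discard it.\<close>

lemma AE_mu_nonzero: "AE z in mu q. z \<noteq> 0"
proof -
  have "{z \<in> Gam_bar q. z \<noteq> 0} \<in> sets (restrict_space borel (Gam_bar q))"
  proof -
    have "{z \<in> Gam_bar q. z \<noteq> 0} = Gam_bar q \<inter> (- {0})" by auto
    then show ?thesis by (auto simp: sets_restrict_space)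
  qed
  then have "(AE z in mu q. z \<noteq> 0) \<longleftrightarrow> (AE x in weights \<Otimes>\<^sub>M circ. (case x of (k, \<phi>) \<Rightarrow> of_real (q powi k) * cis \<phi>) \<noteq> 0)"
    unfolding mu_def by (intro AE_distr_iff polar_measurable) (simp add: space_restrict_space)
  also have "\<dots>" by (intro AE_I2) auto
  finally show ?thesis .
qed

text \<open>Multiplication by g_(k,0), the indicator of one circle, gives an integrable function
  orthogonal to all powers of the angular variable, hence null. Countably many circles exhaust
  Gamma.\<close>

lemma source_total:
  assumes f: "f \<in> L2 (mu q)" and zero: "\<And>p. L2_inner (mu q) f (source_basis p) = 0"
  shows "AE z in mu q. f z = 0"
proof -
  have gkl_L2: "gkl q k l \<in> L2 (mu q)" for k l
  proof -
    have "(\<lambda>z. of_real (q powi k) * source_basis (k, l) z) \<in> L2 (mu q)"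
      by (rule L2_cmult[OF source_L2])
    moreover have "of_real (q powi k) * source_basis (k, l) z = gkl q k l z" for z
      by (simp add: source_basis_def power_int_minus)
    ultimately show ?thesis by simp
  qed
  have gkl_zero: "(\<integral>z. f z * cnj (gkl q k l z) \<partial>mu q) = 0" for k l
  proof -
    have "L2_inner (mu q) (source_basis (k, l)) f = 0"
      using zero[of "(k, l)"] L2_inner_commute[of "mu q" "source_basis (k, l)" f] by simp
    then have "of_real (q powi (- k)) * L2_inner (mu q) (gkl q k l) f = 0"
      unfolding source_basis_def[abs_def] L2_inner_cmult_left by simp
    then have "L2_inner (mu q) (gkl q k l) f = 0" by simp
    then show ?thesis
      using L2_inner_commute[of "mu q" f "gkl q k l"] by (simp add: L2_inner_def)
  qed
  have circle: "AE z in mu q. f z * cnj (gkl q k 0 z) = 0" for k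
  proof (rule AE_zero_of_set_integrals)
    \<comment> \<open>The locale asks for |u| = 1 everywhere. The value 1 off the circle does no
      harm because \<open>g\<close> vanishes there.\<close>
    define u where "u z = (if norm z = q powi k then z / of_real (q powi k) else 1)" for z :: complex
    define g where "g z = f z * cnj (gkl q k 0 z)" for z
    have gint: "integrable (mu q) g"
      unfolding g_def by (rule L2_product_integrable[OF f gkl_L2])
    show "integrable (mu q) (\<lambda>z. f z * cnj (gkl q k 0 z))"
      using gint by (simp add: g_def[abs_def])
    interpret trig_orthogonal "mu q" u
    proof
      have "u \<in> borel_measurable borel"
        unfolding u_def by measurable
      then show "u \<in> borel_measurable (mu q)"
        unfolding measurable_mu by (rule measurable_restrict_space1)
      show "norm (u z) = 1" for z
        using q_pos by (simp add: u_def norm_divide norm_power_int)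
    qed
    have gkl_u: "gkl q k l z = (if norm z = q powi k then u z powi l else 0)" for l z
      using angularD[OF angular_gkl, of "u z" k l k] norm_u[of z] by (auto simp: u_def gkl_def)
    have "g z * u z powi l = f z * cnj (gkl q k (- l) z)" for z l
      unfolding g_def gkl_u using cnj_unit_powi[OF norm_u, of z "- l"] by simp
    then have orth: "orth g"
      unfolding orth_def using gint gkl_zero by simp
    fix A assume "A \<in> sets (mu q)"
    then obtain S where S: "S \<in> sets borel" "A = Gam_bar q \<inter> S"
      by (auto simp: mu_def sets_restrict_space)
    \<comment> \<open>On the circle, \<open>z\<close> lies in \<open>S\<close> exactly when
      \<open>u z\<close> lies in \<open>B\<close>.\<close>
    define B where "B = (\<lambda>w. of_real (q powi k) * w) -` S"
    have "(\<lambda>w::complex. of_real (q powi k) * w) \<in> borel_measurable borel"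
      by (intro borel_measurable_continuous_onI continuous_intros)
    from measurable_sets[OF this S(1)] have B: "B \<in> sets borel"
      by (simp add: B_def)
    have "(\<integral>z. f z * cnj (gkl q k 0 z) * of_real (indicator A z) \<partial>mu q) = (\<integral>z. g z * of_real (indicator B (u z)) \<partial>mu q)"
    proof (rule Bochner_Integration.integral_cong[OF refl])
      fix z assume "z \<in> space (mu q)"
      then show "f z * cnj (gkl q k 0 z) * of_real (indicator A z) = g z * of_real (indicator B (u z))"
        using q_pos by (auto simp: g_def gkl_u u_def B_def S(2) indicator_def)
    qed
    also have "\<dots> = 0" by (rule integral_borel_eq_0[OF orth B])
    finally show "(\<integral>z. f z * cnj (gkl q k 0 z) * of_real (indicator A z) \<partial>mu q) = 0" .
  qed
  then have "AE z in mu q. \<forall>k. f z * cnj (gkl q k 0 z) = 0"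
    unfolding AE_all_countable by blast
  with AE_mu_nonzero AE_space show ?thesis
  proof eventually_elim
    case (elim z)
    then obtain k where "norm z = q powi k"
      by (auto simp: Gam_bar_def Gam_def)
    then have "gkl q k 0 z = 1" by (simp add: gkl_def)
    moreover have "f z * cnj (gkl q k 0 z) = 0"
      using elim(3) by blast
    ultimately show ?case by simp
  qed
qed

text \<open>Orthogonality to the targets \<open>(k, l)\<close> for all \<open>k\<close> says that
  the Hankel matrix annihilates the coefficients \<open>x\<close> of \<open>h\<close> at frequency
  \<open>- l\<close>. These are bounded by the Cauchy-Schwarz inequality, so
  \<open>hankel_injective\<close> applies.\<close>

lemma target_total:
  assumes h: "h \<in> L2 (mu q)" and zero: "\<And>p. L2_inner (mu q) h (target_basis p) = 0"
  shows "AE z in mu q. h z = 0"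
proof (rule source_total[OF h])
  fix p :: "int \<times> int"
  obtain m l' where p: "p = (m, l')" by fastforce
  \<comment> \<open>The target functions with second index \<open>l\<close> have frequency
    \<open>- l\<close>.\<close>
  define l where "l = - l'"
  define I where "I n = (\<integral>\<phi>. h (of_real (q powi n) * cis \<phi>) * cis \<phi> powi l \<partial>circ)" for n
  define x where "x n = L2_inner (mu q) h (source_basis (n, - l))" for n
  have x: "x n = of_real (q powi n) * I n" for n
  proof -
    have "((\<lambda>j. of_real (q powi (2 * j) * (if j = n then q powi (- n) else 0)) * I j) has_sum x n) UNIV"
      using L2_inner_angular_right[OF h angular_source source_L2, of n "- l"] by (simp only: x_def I_def minus_minus)
    moreover have "((\<lambda>j. of_real (q powi (2 * j) * (if j = n then q powi (- n) else 0)) * I j) has_sum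
        of_real (q powi (2 * n) * q powi (- n)) * I n) UNIV"
      by (rule has_sum_finite_neutralI[of "{n}"]) auto
    ultimately have "x n = of_real (q powi (2 * n) * q powi (- n)) * I n"
      by (rule has_sum_unique)
    then show ?thesis unfolding q_powi_add[symmetric] by simp
  qed
  have "x m = 0"
  proof (rule hankel_injective)
    show "norm (x n) \<le> sqrt (sqnorm (mu q) h)" for n
    proof -
      have "sqnorm (mu q) (source_basis (n, - l)) = 1"
        using L2_inner_self[of "mu q" "source_basis (n, - l)"] source_orthonormal[of "(n, - l)" "(n, - l)"]
        by simp
      then show ?thesis
        unfolding x_def by (intro real_le_rsqrt L2_Cauchy_Schwarz h source_L2)
    qed
    fix k
    have "((\<lambda>n. of_real (q powi (2 * n) * (q powi (- n) * hankel l (n + k))) * I n) has_sum 0) UNIV"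
      using L2_inner_angular_right[OF h angular_target target_L2, of l k] zero[of "(k, l)"]
      by (simp only: I_def minus_minus)
    moreover have "of_real (q powi (2 * n) * (q powi (- n) * hankel l (n + k))) * I n = of_real (hankel l (n + k)) * x n" for n
    proof -
      have "q powi (2 * n) * q powi (- n) = q powi n"
        unfolding q_powi_add[symmetric] by simp
      then have "q powi (2 * n) * (q powi (- n) * hankel l (n + k)) = hankel l (n + k) * q powi n"
      proof -
        have "(q powi (2 * n) * q powi (- n)) * hankel l (n + k) = q powi n * hankel l (n + k)"
          by (simp only: \<open>q powi (2 * n) * q powi (- n) = q powi n\<close>)
        then show ?thesis by (simp only: mult_ac)
      qed
      then show ?thesis
        by (simp only: x of_real_mult mult.assoc)
    qed
    ultimately show "((\<lambda>n. of_real (hankel l (n + k)) * x n) has_sum 0) UNIV" by (simp only:)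
  qed
  then show "L2_inner (mu q) h (source_basis p) = 0"
    by (simp add: x_def p l_def)
qed

section \<open>Construction of the unitary operator\<close>

definition pair_of :: "nat \<Rightarrow> int \<times> int" where
  "pair_of n = map_prod int_decode int_decode (prod_decode n)"

lemma bij_pair_of: "bij pair_of"
proof -
  have "bij (map_prod int_decode int_decode)"
    unfolding bij_def
    by (intro conjI prod.inj_map map_prod_surj) (simp_all add: bij_int_decode bij_is_inj bij_is_surj)
  then have "bij (map_prod int_decode int_decode \<circ> prod_decode)"
    using bij_prod_decode by (rule bij_comp[rotated])
  then show ?thesis by (simp add: pair_of_def[abs_def] comp_def)
qed

lemma orthonormal_basis_pairs:
  assumes "\<And>k l. b (k, l) \<in> L2 M" "\<And>p p'. L2_inner M (b p) (b p') = (if p = p' then 1 else 0)"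
    and "\<And>f. f \<in> L2 M \<Longrightarrow> (\<And>p. L2_inner M f (b p) = 0) \<Longrightarrow> AE x in M. f x = 0"
  shows "orthonormal_basis_L2 M (\<lambda>n. b (pair_of n))"
proof
  show "b (pair_of i) \<in> L2 M" for i
    using assms(1)[of "fst (pair_of i)" "snd (pair_of i)"] by simp
  show "L2_inner M (b (pair_of i)) (b (pair_of j)) = (if i = j then 1 else 0)" for i j
    using bij_pair_of by (simp add: assms(2) bij_def inj_eq)
  fix f assume f: "f \<in> L2 M" "\<And>i. L2_inner M f (b (pair_of i)) = 0"
  have "L2_inner M f (b p) = 0" for p
  proof -
    obtain i where "p = pair_of i"
      using bij_is_surj[OF bij_pair_of] by (rule surjE)
    with f(2) show ?thesis by simp
  qed
  then show "AE x in M. f x = 0"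
    by (rule assms(3)[OF f(1)])
qed

text \<open>\<open>shift\<close> chooses an extension of the whole combination, so its linearity is
  not immediate. An explicit extension of the sum is exhibited, and uniqueness of extensions yields
  the value.\<close>

lemma sigma_i_gkl_span:
  assumes S: "finite S" and f: "f = (\<lambda>z. \<Sum>(k, l)\<in>S. c k l * gkl q k l z)" and z: "z \<in> Gam_bar q"
  shows "sigma_i q f z = (\<Sum>(k, l)\<in>S. c k l * of_real (q powi l) * gkl q k l z)"
proof (cases "z = 0")
  case True
  then show ?thesis by (simp add: sigma_i_def shift_def f case_prod_unfold)
next
  case False
  with z obtain n u where u: "norm u = 1" "z = of_real (q powi n) * u"
    using Gam_polarE unfolding Gam_bar_def by blast
  define G where "G z = (\<Sum>(k, l)\<in>S. c k l * (of_real (if n = k then 1 else 0) * (z / of_real (q powi n)) powi l))" for z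
  have ext: "is_circle_extension q (gkl q k l) n (\<lambda>z. of_real (if n = k then 1 else 0) * (z / of_real (q powi n)) powi l)" for k l
    by (rule angular_is_circle_extension[OF angular_gkl])
  have hol: "(\<lambda>z. of_real (if n = k then 1 else 0) * (z / of_real (q powi n)) powi l) holomorphic_on UNIV - {0}" for k l
    using ext[of k l] unfolding is_circle_extension_def by blast
  have val: "of_real (if n = k then 1 else 0) * (z / of_real (q powi n)) powi l = gkl q k l z"
    if "norm z = q powi n" for k l z
    using ext[of k l] that unfolding is_circle_extension_def by blast
  have "is_circle_extension q f n G"
    unfolding is_circle_extension_def
  proof (intro conjI allI impI)
    show "G holomorphic_on UNIV - {0}"
      unfolding G_def case_prod_unfold
      by (rule holomorphic_on_sum) (rule holomorphic_on_mult[OF holomorphic_on_const hol])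
    show "G z = f z" if "norm z = q powi n" for z
      unfolding G_def f case_prod_unfold val[OF that] ..
  qed
  then have "sigma_i q f z = G (of_real q * z)"
    unfolding sigma_i_def u(2) by (rule shift_eq_circle_extension[OF u(1) _ q_neq_0(1)])
  also have "\<dots> = (\<Sum>(k, l)\<in>S. c k l * of_real (q powi l) * gkl q k l z)"
    unfolding G_def case_prod_unfold
  proof (rule sum.cong[OF refl])
    fix p :: "int \<times> int"
    have "of_real q * z / of_real (q powi n) = of_real q * u"
      by (simp add: u(2))
    then have "(of_real q * z / of_real (q powi n)) powi snd p = of_real (q powi snd p) * u powi snd p"
      by (simp add: power_int_mult_distrib)
    moreover have "gkl q (fst p) (snd p) z = of_real (if n = fst p then 1 else 0) * u powi snd p"
      unfolding u(2) by (rule angularD[OF angular_gkl u(1)])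
    ultimately show "c (fst p) (snd p) * (of_real (if n = fst p then 1 else 0) * (of_real q * z / of_real (q powi n)) powi snd p) =
        c (fst p) (snd p) * of_real (q powi snd p) * gkl q (fst p) (snd p) z"
      by (simp only: mult_ac)
  qed
  finally show ?thesis .
qed

text \<open>The scalars agree since q^-1 q^l = q^k q^(l - 1 - k): the first factor undoes the
  normalisation of the source, the second is that of the target.\<close>

lemma fourier_sigma_i_gkl_span:
  assumes S: "finite S" and f: "f = (\<lambda>z. \<Sum>(k, l)\<in>S. c k l * gkl q k l z)" and \<zeta>: "\<zeta> \<in> Gam_bar q"
  shows "of_real (1 / q) * fourier q (sigma_i q f) \<zeta> = (\<Sum>(k, l)\<in>S. c k l * of_real (q powi k) * target_basis (k, l) \<zeta>)"
proof -
  have "fourier q (sigma_i q f) \<zeta> = (\<integral>z. (\<Sum>p\<in>S. c (fst p) (snd p) * of_real (q powi snd p) *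
      (Fq q (\<zeta> * z) * gkl q (fst p) (snd p) z)) \<partial>mu q)"
    unfolding fourier_def
    by (intro Bochner_Integration.integral_cong refl)
      (simp add: sigma_i_gkl_span[OF S f] case_prod_unfold sum_distrib_left mult_ac)
  also have "\<dots> = (\<Sum>p\<in>S. c (fst p) (snd p) * of_real (q powi snd p) * fourier q (gkl q (fst p) (snd p)) \<zeta>)"
    unfolding fourier_def
    by (subst Bochner_Integration.integral_sum)
      (auto intro!: integrable_mult_right integrable_Fq_gkl \<zeta>)
  finally have "of_real (1 / q) * fourier q (sigma_i q f) \<zeta> =
      (\<Sum>p\<in>S. of_real (1 / q) * (c (fst p) (snd p) * of_real (q powi snd p) * fourier q (gkl q (fst p) (snd p)) \<zeta>))"
    by (simp only: sum_distrib_left)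
  also have "\<dots> = (\<Sum>p\<in>S. c (fst p) (snd p) * of_real (q powi fst p) * target_basis p \<zeta>)"
  proof (rule sum.cong[OF refl])
    fix p :: "int \<times> int"
    have "1 / q * q powi snd p = q powi fst p * q powi (snd p - 1 - fst p)"
    proof -
      have "q powi fst p * q powi (snd p - 1 - fst p) = q powi (snd p - 1)"
        unfolding q_powi_add[symmetric] by simp
      then show ?thesis by (simp add: power_int_diff)
    qed
    then have "complex_of_real (1 / q) * of_real (q powi snd p) = of_real (q powi fst p) * of_real (q powi (snd p - 1 - fst p))"
      by (simp only: of_real_mult[symmetric])
    then have "c (fst p) (snd p) * fourier q (gkl q (fst p) (snd p)) \<zeta> * (complex_of_real (1 / q) * of_real (q powi snd p)) =
        c (fst p) (snd p) * fourier q (gkl q (fst p) (snd p)) \<zeta> * (of_real (q powi fst p) * of_real (q powi (snd p - 1 - fst p)))"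
      by (simp only:)
    then show "of_real (1 / q) * (c (fst p) (snd p) * of_real (q powi snd p) * fourier q (gkl q (fst p) (snd p)) \<zeta>) =
        c (fst p) (snd p) * of_real (q powi fst p) * target_basis p \<zeta>"
      unfolding target_basis_def by (simp only: mult_ac)
  qed
  finally show ?thesis by (simp add: case_prod_unfold)
qed

text \<open>The operator that carries the source basis to the target basis is unitary. On a finite
  combination its value has the same coefficients as the combination \<open>W\<close> of targets,
  which is q^-1 F sigma_i f pointwise on the closure of Gamma.\<close>

lemma fourier_sigma_i_unitary:
  "\<exists>U. unitary_L2 (mu q) U \<and>
    (\<forall>f \<in> gkl_span q. AE z in mu q. U f z = of_real (1/q) * fourier q (sigma_i q f) z)"
proof -
  interpret s: orthonormal_basis_L2 "mu q" "\<lambda>n. source_basis (pair_of n)"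
  proof (rule orthonormal_basis_pairs[of source_basis "mu q"])
    show "AE z in mu q. f z = 0"
      if "f \<in> L2 (mu q)" "\<And>p. L2_inner (mu q) f (source_basis p) = 0" for f
      using that by (rule source_total)
  qed (rule source_L2 source_orthonormal)+
  interpret t: orthonormal_basis_L2 "mu q" "\<lambda>n. target_basis (pair_of n)"
  proof (rule orthonormal_basis_pairs[of target_basis "mu q"])
    show "AE z in mu q. f z = 0"
      if "f \<in> L2 (mu q)" "\<And>p. L2_inner (mu q) f (target_basis p) = 0" for f
      using that by (rule target_total)
  qed (rule target_L2 target_orthonormal)+
  obtain U where U: "unitary_L2 (mu q) U"
    "\<And>f i. f \<in> L2 (mu q) \<Longrightarrow> L2_inner (mu q) (U f) (target_basis (pair_of i)) = L2_inner (mu q) f (source_basis (pair_of i))"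
  proof (rule unitary_L2_of_bases[OF s.orthonormal_basis_L2_axioms t.orthonormal_basis_L2_axioms])
    fix U assume "unitary_L2 (mu q) U" and "\<And>f i. f \<in> L2 (mu q) \<Longrightarrow>
      L2_inner (mu q) (U f) (target_basis (pair_of i)) = L2_inner (mu q) f (source_basis (pair_of i))"
    then show thesis by (rule that)
  qed
  have "AE z in mu q. U f z = of_real (1/q) * fourier q (sigma_i q f) z" if "f \<in> gkl_span q" for f
  proof -
    obtain S c where S: "finite S" and f: "f = (\<lambda>z. \<Sum>(k, l)\<in>S. c k l * gkl q k l z)"
    proof -
      have "\<exists>S c. finite S \<and> f = (\<lambda>z. \<Sum>(k, l)\<in>S. c k l * gkl q k l z)"
        using \<open>f \<in> gkl_span q\<close> unfolding gkl_span_def by (rule CollectD)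
      then show thesis by (elim exE conjE) (rule that)
    qed
    define d where "d p = c (fst p) (snd p) * of_real (q powi fst p)" for p
    have f': "f = (\<lambda>z. \<Sum>p\<in>S. d p * source_basis p z)"
      unfolding f d_def source_basis_def case_prod_unfold
      by (intro ext sum.cong refl) (simp add: power_int_minus)
    have sL: "source_basis p \<in> L2 (mu q)" and tL: "target_basis p \<in> L2 (mu q)" for p
      using source_L2[of "fst p" "snd p"] target_L2[of "fst p" "snd p"] by simp_all
    have fL: "f \<in> L2 (mu q)"
      unfolding f' by (intro L2_sum L2_cmult sL)
    define W where "W z = (\<Sum>p\<in>S. d p * target_basis p z)" for z
    have WL: "W \<in> L2 (mu q)"
      unfolding W_def[abs_def] by (intro L2_sum L2_cmult tL)
    have "AE z in mu q. U f z = W z"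
    proof (rule t.coeff_unique[OF _ WL])
      show "U f \<in> L2 (mu q)"
        using U(1) fL unfolding unitary_L2_def by blast
      fix i
      have "L2_inner (mu q) W (target_basis (pair_of i)) = (\<Sum>p\<in>S. d p * (if p = pair_of i then 1 else 0))"
        unfolding W_def[abs_def] by (subst L2_inner_sum_left[OF L2_cmult[OF tL] tL])
          (simp only: L2_inner_cmult_left target_orthonormal)
      also have "\<dots> = L2_inner (mu q) f (source_basis (pair_of i))"
        unfolding f' by (subst L2_inner_sum_left[OF L2_cmult[OF sL] sL])
          (simp only: L2_inner_cmult_left source_orthonormal)
      finally show "L2_inner (mu q) (U f) (target_basis (pair_of i)) = L2_inner (mu q) W (target_basis (pair_of i))"
        unfolding U(2)[OF fL] by (rule sym)
    qed
    then show ?thesis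
      using AE_space
    proof eventually_elim
      case (elim z)
      then have "z \<in> Gam_bar q" by simp
      then have "of_real (1/q) * fourier q (sigma_i q f) z = W z"
        unfolding W_def d_def fourier_sigma_i_gkl_span[OF S f \<open>z \<in> Gam_bar q\<close>] case_prod_unfold
        by simp
      with elim(1) show ?case by (simp only:)
    qed
  qed
  note U_eq = this
  show ?thesis
  proof (rule exI[of _ U], rule conjI[OF U(1)], rule ballI)
    show "AE z in mu q. U f z = of_real (1/q) * fourier q (sigma_i q f) z" if "f \<in> gkl_span q" for f
      using that by (rule U_eq)
  qed
qed

end

theorem theorem6p2:
  fixes q :: real
  assumes "0 < q" and "q < 1"
  shows "(\<forall>k l. fourier q (gkl q k l) \<in> Cq_inf q \<and> integrable (mu q) (fourier q (gkl q k l))) \<and>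
    (\<forall>k l. \<forall>z \<in> Gam_bar q.
       fourier_adj q (fourier q (gkl q k l)) z
         = ((\<lambda>h w. of_real q * sigma_minus_i q h w) ^^ 2) (gkl q k l) z) \<and>
    (\<exists>U. unitary_L2 (mu q) U \<and>
       (\<forall>f \<in> gkl_span q. AE z in mu q. U f z = of_real (1/q) * fourier q (sigma_i q f) z))"
proof -
  interpret q_parameter q
    using assms by unfold_locales
  show ?thesis
    by (intro conjI allI ballI fourier_gkl_Cq_inf integrable_fourier_gkl fourier_adj_fourier_gkl fourier_sigma_i_unitary)
qed

end
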